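(* Fix positive integers $d_2,g$ and a pearl chain $\mathcal{P}$ of type $(d_2,g)$. Then the generating series $$\sum_{d_1} N^{\operatorname{trop},\mathcal{P}}_{(d_1,d_2,g)}\, q^{d_1}$$ obtained for the fixed pearl chain $\mathcal{P}$ as the sum of the contributions over all orders, i.e. the series $\frac{1}{|\operatorname{Aut}(\mathcal{P})|}\sum_{\Omega}I_{\mathcal{P},\Omega}(q)$, is a homogeneous quasimodular form of weight $4(d_2+g-1)$.
   Context: **Pearl chains.** A pearl chain of type $(d_2,g)$ is a (non-metric) connected graph $\mathcal{P}$ of genus (first Betti number) $g$ with $d_2$ white and $d_2+g-1$ black vertices; edges only connect a white with a black vertex; black vertices are $2$-valent, white vertices can have any valency; there are no cycles of length two. $\operatorname{Aut}(\mathcal{P})$ is the group of colour-preserving graph automorphisms. **Feynman integrals.** Let $$P(x,q)=-\sum_{d=1}^\infty d\,x^d-\sum_{n=1}^\infty\Bigl(\sum_{d\mid n}d\,(x^d+x^{-d})\Bigr)q^n .$$ Label the vertices of $\mathcal{P}$ by $x_1,\dots,x_n$ and the edges by $q_1,\dots,q_r$. For a total order $\Omega$ of the $n$ vertices, denote the vertices adjacent to the edge $q_k$ by $x_{k^1},x_{k^2}$ with $x_{k^1}<x_{k^2}$ in $\Omega$, and set $$I_{\mathcal{P},\Omega}(q)=\operatorname{Coef}_{[x_1^{0}\cdots x_n^{0}]}\prod_{k=1}^rP\Bigl(\frac{x_{k^1}}{x_{k^2}},q\Bigr).$$ **Tropical counts for a fixed pearl chain.** A (cut) tropical stable map to $E_{\mathbb{T}}\times\mathbb{P}^1_{\mathbb{T}}$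 without leaking is a balanced map $f:\Gamma\to\mathbb{R}^2$, integer affine on edges (with directions in $\mathbb{Z}^2$), from a metric graph $\Gamma$ with ends such that there are $n$ marked contracted ends, $d_2$ ends of direction $(0,-1)$, $d_2$ ends of direction $(0,1)$, and the remaining ends are of primitive direction $(\pm1,0)$ and come in pairs, one of primitive direction $(1,0)$ and one of $(-1,0)$, with the same expansion factor (gcd of the entries of the direction vector) and the same $y$-coordinate. Gluing the pairs gives a graph $\Gamma'$, whose genus is the genus of the map; the map is connected if $\Gamma'$ is; the bidegree is $(d_1,d_2)$ with $d_1$ the sum of the expansion factors of the ends of primitive direction $(1,0)$. Maps are considered up to the labelling of the horizontal ends. Let $n=2d_2+g-1$ and fix $n$ points in general position in $\mathbb{R}^2$ that are horizontally stretched (the differences of $x$-coordinates are much larger than those of $y$-coordinates). For a map whose marked ends are contracted to these points, the floors are the connected components of $\Gamma$ minus the edges of primitive direction $(\pm1,0)$ that contain an end of direction $(0,-1)$; shrinking in $\Gamma'$ each floor to a white vertex and each marked point on a horizontal edge to a black vertex, and forgetting the metric, yields a pearl chain. $N^{\operatorname{trop},\mathcal{P}}_{(d_1,d_2,g)}$ is the number of connected such maps of bidegree $(d_1,d_2)$ and genus $g$ satisfying the point conditions whose associated pearl chain is $\mathcal{P}$, counted with multiplicity $\prod_V|\det(v_1,v_2)|$, over the vertices $V$ not adjacent to contracted ends, with $v_1,v_2$ the directions of two edges at $V$. One has $\sum_{d_1} N^{\operatorname{trop},\mathcal{P}}_{(d_1,d_2,g)}q^{d_1}=\frac{1}{|\operatorname{Aut}(\mathcal{P})|}\sum_{\Omega}I_{\mathcal{P},\Omega}(q)$.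 **Quasimodular forms.** A series in $q$ is quasimodular if it lies in the polynomial ring generated by the Eisenstein series $E_2,E_4,E_6$ ($E_2=1-24\sum\sigma_1(d)q^d$, $E_4=1+240\sum\sigma_3(d)q^d$, $E_6=1-504\sum\sigma_5(d)q^d$). It is a (homogeneous) quasimodular form of weight $w$ if it is a homogeneous polynomial of degree $w$, where $E_{2k}$ has degree $2k$. *)

theory Defs
  imports
    "Graph_Theory.Digraph_Component"
    "HOL-Computational_Algebra.Formal_Power_Series"
    "HOL-Combinatorics.Permutations"
begin

section \<open>Pearl chains\<close>

text \<open>
  A two-coloured graph is given by its set \<open>W\<close> of white vertices and a graph \<open>G\<close> with labelled
  edges; the vertices of \<open>G\<close> outside \<open>W\<close> are black. The underlying graph is undirected: since edges
  only join a white to a black vertex, each edge is recorded once, as an arc with white tail and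
  black head, and this direction has no further meaning.
\<close>

definition first_betti :: "('v, 'e) pre_digraph \<Rightarrow> int" where
  "first_betti G = int (card (arcs G)) - int (card (verts G))
     + int (card (pre_digraph.sccs (with_proj (mk_symmetric G))))"

text \<open>
  The locale predicate \<open>digraph\<close> says that \<open>G\<close> is finite, without loops and without parallel arcs.
  As all arcs go from white to black, absence of parallel arcs is absence of cycles of length two,
  and the valency of a black vertex is its in-degree.
\<close>

definition pearl_chain :: "nat \<Rightarrow> nat \<Rightarrow> 'v set \<Rightarrow> ('v, 'e) pre_digraph \<Rightarrow> bool" where
  "pearl_chain d2 g W G \<longleftrightarrow>
     digraph G \<and>
     Digraph_Component.connected G \<and>
     first_betti G = int g \<and>
     W \<subseteq> verts G \<and>
     card W = d2 \<and>
     int (card (verts G - W)) = int d2 + int g - 1 \<and>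
     (\<forall>e\<in>arcs G. tail G e \<in> W \<and> head G e \<in> verts G - W) \<and>
     (\<forall>b\<in>verts G - W. in_degree G b = 2)"

text \<open>
  Permutations in the sense of \<open>permutes\<close> fix everything outside the given set, so every
  automorphism of the finite graph is represented exactly once.
\<close>

definition pearl_aut :: "'v set \<Rightarrow> ('v, 'e) pre_digraph \<Rightarrow> (('v \<Rightarrow> 'v) \<times> ('e \<Rightarrow> 'e)) set" where
  "pearl_aut W G = {(\<sigma>, \<tau>). \<sigma> permutes verts G \<and> \<tau> permutes arcs G \<and> \<sigma> ` W = W \<and>
     (\<forall>e\<in>arcs G. tail G (\<tau> e) = \<sigma> (tail G e) \<and> head G (\<tau> e) = \<sigma> (head G e))}"


section \<open>Feynman integrals\<close>

text \<open>\<open>propagator a n\<close> is the coefficient of $x^a q^n$ in $P(x,q)$.\<close>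

definition propagator :: "int \<Rightarrow> nat \<Rightarrow> rat" where
  "propagator a n =
     (if n = 0 then (if a \<ge> 1 then - of_int a else 0)
      else - (\<Sum>d | d dvd n. of_nat d * (of_bool (a = int d) + of_bool (a = - int d))))"

text \<open>
  A formal series in $q$ and Laurent monomials in variables $x_v$ is represented by its coefficient
  function: \<open>F \<alpha> m\<close> is the coefficient of $q^m \prod_v x_v^{\alpha(v)}$.
\<close>

type_synonym 'v laurent_series = "('v \<Rightarrow> int) \<Rightarrow> nat \<Rightarrow> rat"

text \<open>
  The series $P(x_u/x_v, q)$. For \<open>u \<noteq> v\<close>, the only case used, at most one \<open>a\<close> contributes to a
  given monomial.
\<close>

definition propagator_quotient :: "'v \<Rightarrow> 'v \<Rightarrow> 'v laurent_series" where
  "propagator_quotient u v \<alpha> m =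
     (\<Sum>a | \<alpha> = (\<lambda>w. a * (of_bool (w = u) - of_bool (w = v))). propagator a m)"

text \<open>
  The product of a finite family of such series: sum over all ways to pick one monomial with nonzero
  coefficient from each factor so that the picked monomials multiply to the given one. Such a sum
  is meaningful only if there are finitely many choices. This holds for the Feynman integrals
  below: an exponent \<open>a\<close> picked from a factor is at least \<open>-m\<close>, and for each initial segment
  of the vertex order the exponents of the edges leaving it sum to zero, so \<open>a\<close> is also at most
  \<open>m\<close> times the number of edges.
\<close>

definition laurent_prod :: "'k set \<Rightarrow> ('k \<Rightarrow> 'v laurent_series) \<Rightarrow> 'v laurent_series" where
  "laurent_prod K F \<alpha> m =
     (\<Sum>(\<beta>, \<mu>) | \<beta> \<in> extensional K \<and> \<mu> \<in> extensional K \<and>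
          (\<forall>v. (\<Sum>k\<in>K. \<beta> k v) = \<alpha> v) \<and> (\<Sum>k\<in>K. \<mu> k) = m \<and>
          (\<forall>k\<in>K. F k (\<beta> k) (\<mu> k) \<noteq> 0).
        \<Prod>k\<in>K. F k (\<beta> k) (\<mu> k))"

definition lower_end :: "('v, 'e) pre_digraph \<Rightarrow> 'v rel \<Rightarrow> 'e \<Rightarrow> 'v" where
  "lower_end G \<Omega> e = (if (tail G e, head G e) \<in> \<Omega> then tail G e else head G e)"

definition upper_end :: "('v, 'e) pre_digraph \<Rightarrow> 'v rel \<Rightarrow> 'e \<Rightarrow> 'v" where
  "upper_end G \<Omega> e = (if (tail G e, head G e) \<in> \<Omega> then head G e else tail G e)"

definition feynman_integral :: "('v, 'e) pre_digraph \<Rightarrow> 'v rel \<Rightarrow> rat fps" where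
  "feynman_integral G \<Omega> = Abs_fps (\<lambda>m.
     laurent_prod (arcs G) (\<lambda>e. propagator_quotient (lower_end G \<Omega> e) (upper_end G \<Omega> e))
       (\<lambda>_. 0) m)"

definition pearl_chain_series :: "'v set \<Rightarrow> ('v, 'e) pre_digraph \<Rightarrow> rat fps" where
  "pearl_chain_series W G =
     fps_const (1 / of_nat (card (pearl_aut W G))) *
       (\<Sum>\<Omega> | linear_order_on (verts G) \<Omega>. feynman_integral G \<Omega>)"


section \<open>Quasimodular forms\<close>

definition divisor_power_sum :: "nat \<Rightarrow> nat \<Rightarrow> nat" where
  "divisor_power_sum k n = (\<Sum>d | d dvd n. d ^ k)"

definition E2 :: "rat fps" where
  "E2 = Abs_fps (\<lambda>n. if n = 0 then 1 else - 24 * of_nat (divisor_power_sum 1 n))"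

definition E4 :: "rat fps" where
  "E4 = Abs_fps (\<lambda>n. if n = 0 then 1 else 240 * of_nat (divisor_power_sum 3 n))"

definition E6 :: "rat fps" where
  "E6 = Abs_fps (\<lambda>n. if n = 0 then 1 else - 504 * of_nat (divisor_power_sum 5 n))"

text \<open>
  Homogeneous of weight \<open>w\<close>. The coefficients are taken in the rationals; for a series with rational
  coefficients this is the same as being such a polynomial over the complex numbers, because
  $E_2, E_4, E_6$ have rational coefficients.
\<close>

definition quasimodular_form :: "nat \<Rightarrow> rat fps \<Rightarrow> bool" where
  "quasimodular_form w f \<longleftrightarrow>
     (\<exists>c :: nat \<Rightarrow> nat \<Rightarrow> nat \<Rightarrow> rat.
        f = (\<Sum>(i, j, k) | 2 * i + 4 * j + 6 * k = w.
               fps_const (c i j k) * E2 ^ i * E4 ^ j * E6 ^ k))"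

end

theory Submission
  imports
    Defs
    "HOL-Computational_Algebra.Formal_Laurent_Series"
    "HOL-Combinatorics.Multiset_Permutations"
begin

text \<open>
  The coefficient of \<open>x^a\<close> in \<open>P(x,q)\<close> is \<open>- a / (1 - q^a)\<close>, so that a Feynman integral is a sum over the
  integral circulations \<open>a\<close> on the graph. Replace the factor of each edge by \<open>s^a / (1 - w * q^a)\<close> with
  parameters \<open>s = exp(\<sigma> \<epsilon>)\<close> and \<open>w = exp(\<alpha> \<epsilon>)\<close>. Fay's identity for Kronecker's function
  \<open>\<Sum>n. s^n / (1 - w * q^n)\<close> moves one end of an edge along another edge; it eliminates the vertices one
  after the other, until only products of Kronecker functions remain. Their coefficients in \<open>\<epsilon>\<close> are
  derivatives of Eisenstein series, hence quasimodular of the weight prescribed by the power of \<open>\<epsilon>\<close>.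

  For a single order the elimination produces inhomogeneous factors \<open>1 / (1 - w)\<close>. If the orders are
  weighted by the integral of an exponential over the simplex \<open>\<epsilon> \<ge> t 1 \<ge> \<dots> \<ge> t n \<ge> 0\<close>, then these factors
  become \<open>- 1 / (\<alpha> \<epsilon>)\<close> in the sum over all orders, which is therefore homogeneous. To leading order in
  \<open>\<epsilon>\<close> the weights are all equal to \<open>\<epsilon>^n / n!\<close>, and the difference of \<open>s^a / (1 - w * q^a)\<close> at \<open>\<sigma>\<close> and
  \<open>- \<sigma>\<close> is \<open>2 \<sigma> \<epsilon> a / (1 - q^a)\<close>, which gives back the sum of the Feynman integrals.
\<close>

section \<open>Infinite sums of power series\<close>

text \<open>The weight is a difference of two exponents of \<epsilon>. The averaged sums start at
  |V| - |E|: each Kronecker function has a simple pole, an isolated vertex contributes a factor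
  \<epsilon>, and a leaf takes away one vertex and one edge at the cost of a constant. The Feynman
  integrals appear at |V| + |E|, where |V| comes from the volume of the simplex and |E| from
  antisymmetrising each edge in \<sigma>. Hence the weight 2|E|. Averaging is compatible with Fay's
  identity because the exponents in the simplex integral are the net outflows of \<alpha>, which do
  not change when an edge is moved. The reduction to E2, E4, E6 is formal. The products of the
  Weierstrass function with itself and with its second and fourth derivatives are computed on
  Fourier coefficients, by the addition theorem that also yields Fay's identity. Expanded at the
  origin, the first gives a recurrence for the Eisenstein series of weight at least 8; the Fourier
  coefficients of index 0 of all three give closure under q d/dq.\<close>

definition q_summable :: "'i set \<Rightarrow> ('i \<Rightarrow> 'k::comm_ring_1 fps) \<Rightarrow> bool" where
  "q_summable A f \<longleftrightarrow> (\<forall>m. finite {i\<in>A. f i $ m \<noteq> 0})"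

text \<open>Convergence is coefficientwise: for a summable family each power of q receives finitely
  many nonzero terms. The operator is total; a coefficient with infinitely many nonzero terms
  defaults to 0.\<close>

definition q_sum :: "'i set \<Rightarrow> ('i \<Rightarrow> 'k::comm_ring_1 fps) \<Rightarrow> 'k fps" where
  "q_sum A f = Abs_fps (\<lambda>m. \<Sum>i | i \<in> A \<and> f i $ m \<noteq> 0. f i $ m)"

lemma q_sum_nth: "q_sum A f $ m = (\<Sum>i | i \<in> A \<and> f i $ m \<noteq> 0. f i $ m)"
  by (simp add: q_sum_def)

lemma q_sum_nth_superset:
  assumes "finite B" "B \<subseteq> A" "\<And>i. i \<in> A \<Longrightarrow> f i $ m \<noteq> 0 \<Longrightarrow> i \<in> B"
  shows "q_sum A f $ m = (\<Sum>i\<in>B. f i $ m)"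
  unfolding q_sum_nth using assms by (intro sum.mono_neutral_left) auto

lemma q_summableI_bound:
  assumes "\<And>m. finite (B m)" "\<And>m i. i \<in> A \<Longrightarrow> f i $ m \<noteq> 0 \<Longrightarrow> i \<in> B m"
  shows "q_summable A f"
  unfolding q_summable_def
proof
  fix m show "finite {i\<in>A. f i $ m \<noteq> 0}"
    by (rule finite_subset[OF _ assms(1)[of m]]) (use assms(2) in auto)
qed

lemma q_sum_cong: "(\<And>i. i \<in> A \<Longrightarrow> f i = g i) \<Longrightarrow> q_sum A f = q_sum A g"
  unfolding q_sum_def by (intro arg_cong[of _ _ Abs_fps] ext sum.cong) auto

lemma q_sum_finite: "finite A \<Longrightarrow> q_sum A f = (\<Sum>i\<in>A. f i)"
  by (rule fps_ext) (simp add: q_sum_nth_superset[of A] fps_sum_nth)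

lemma q_summable_add:
  assumes "q_summable A f" "q_summable A g"
  shows "q_summable A (\<lambda>i. f i + g i)"
proof (rule q_summableI_bound)
  show "finite ({i\<in>A. f i $ m \<noteq> 0} \<union> {i\<in>A. g i $ m \<noteq> 0})" for m
    using assms by (auto simp: q_summable_def)
  show "i \<in> {i\<in>A. f i $ m \<noteq> 0} \<union> {i\<in>A. g i $ m \<noteq> 0}"
    if "i \<in> A" "(f i + g i) $ m \<noteq> 0" for m i
    using that by auto
qed

lemma q_sum_add:
  assumes "q_summable A f" "q_summable A g"
  shows "q_sum A (\<lambda>i. f i + g i) = q_sum A f + q_sum A g"
proof (rule fps_ext)
  fix m
  let ?B = "{i\<in>A. f i $ m \<noteq> 0} \<union> {i\<in>A. g i $ m \<noteq> 0}"
  have "finite ?B" using assms by (auto simp: q_summable_def)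
  then have "q_sum A (\<lambda>i. f i + g i) $ m = (\<Sum>i\<in>?B. f i $ m + g i $ m)"
    by (subst q_sum_nth_superset[of ?B]) auto
  also have "\<dots> = q_sum A f $ m + q_sum A g $ m"
    using \<open>finite ?B\<close>
    by (subst (1 2) q_sum_nth_superset[of ?B]) (auto simp: sum.distrib)
  finally show "q_sum A (\<lambda>i. f i + g i) $ m = (q_sum A f + q_sum A g) $ m" by simp
qed

lemma q_summable_mult_left:
  assumes "q_summable A f"
  shows "q_summable A (\<lambda>i. c * f i)"
proof (rule q_summableI_bound)
  fix m show "finite (\<Union>l\<le>m. {i\<in>A. f i $ l \<noteq> 0})"
    using assms by (auto simp: q_summable_def)
next
  fix m i assume i: "i \<in> A" "(c * f i) $ m \<noteq> 0"
  have "\<exists>l\<in>{0..m}. c $ l * f i $ (m - l) \<noteq> 0"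
    using i(2) unfolding fps_mult_nth by (meson sum.neutral)
  then obtain l where "f i $ (m - l) \<noteq> 0" by (metis mult_zero_right)
  then show "i \<in> (\<Union>l\<le>m. {i\<in>A. f i $ l \<noteq> 0})"
    using i(1) by (intro UN_I[of "m - l"]) auto
qed

lemma q_sum_mult_left:
  assumes "q_summable A f"
  shows "q_sum A (\<lambda>i. c * f i) = c * q_sum A f"
proof (rule fps_ext)
  fix m
  let ?B = "\<Union>l\<le>m. {i\<in>A. f i $ l \<noteq> 0}"
  have fin: "finite ?B" using assms by (auto simp: q_summable_def)
  have "q_sum A (\<lambda>i. c * f i) $ m = (\<Sum>i\<in>?B. (c * f i) $ m)"
  proof (rule q_sum_nth_superset[OF fin])
    fix i assume i: "i \<in> A" "(c * f i) $ m \<noteq> 0"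
    have "\<exists>l\<in>{0..m}. c $ l * f i $ (m - l) \<noteq> 0"
      using i(2) unfolding fps_mult_nth by (meson sum.neutral)
    then obtain l where "f i $ (m - l) \<noteq> 0" by (metis mult_zero_right)
    then show "i \<in> ?B" using i(1) by (intro UN_I[of "m - l"]) auto
  qed auto
  also have "\<dots> = (\<Sum>l=0..m. c $ l * (\<Sum>i\<in>?B. f i $ (m - l)))"
    unfolding fps_mult_nth sum_distrib_left by (rule sum.swap)
  also have "\<dots> = (\<Sum>l=0..m. c $ l * q_sum A f $ (m - l))"
  proof (rule sum.cong[OF refl])
    fix l assume "l \<in> {0..m}"
    have "q_sum A f $ (m - l) = (\<Sum>i\<in>?B. f i $ (m - l))"
      by (rule q_sum_nth_superset[OF fin]) auto
    then show "c $ l * (\<Sum>i\<in>?B. f i $ (m - l)) = c $ l * q_sum A f $ (m - l)" by simp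
  qed
  finally show "q_sum A (\<lambda>i. c * f i) $ m = (c * q_sum A f) $ m" by (simp add: fps_mult_nth)
qed

lemma q_summable_reindex:
  assumes "bij_betw h A B"
  shows "q_summable B f \<longleftrightarrow> q_summable A (\<lambda>i. f (h i))"
proof -
  have "bij_betw h {i\<in>A. f (h i) $ m \<noteq> 0} {i\<in>B. f i $ m \<noteq> 0}" for m
    using assms by (auto simp: bij_betw_def inj_on_def)
  then show ?thesis unfolding q_summable_def using bij_betw_finite by blast
qed

lemma q_sum_reindex:
  assumes "bij_betw h A B"
  shows "q_sum B f = q_sum A (\<lambda>i. f (h i))"
proof (rule fps_ext)
  fix m
  have "bij_betw h {i\<in>A. f (h i) $ m \<noteq> 0} {i\<in>B. f i $ m \<noteq> 0}"
    using assms by (auto simp: bij_betw_def inj_on_def)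
  then show "q_sum B f $ m = q_sum A (\<lambda>i. f (h i)) $ m"
    unfolding q_sum_nth by (rule sum.reindex_bij_betw[symmetric])
qed

lemma q_sum_Sigma:
  assumes "q_summable (Sigma A B) f"
  shows "q_sum (Sigma A B) f = q_sum A (\<lambda>i. q_sum (B i) (\<lambda>j. f (i, j)))"
proof (rule fps_ext)
  fix m
  let ?S = "{p \<in> Sigma A B. f p $ m \<noteq> 0}"
  have fin: "finite ?S" using assms by (auto simp: q_summable_def)
  have inner: "q_sum (B i) (\<lambda>j. f (i, j)) $ m = (\<Sum>j | j \<in> B i \<and> f (i, j) $ m \<noteq> 0. f (i, j) $ m)" for i
    by (rule q_sum_nth)
  have fin2: "finite {j \<in> B i. f (i, j) $ m \<noteq> 0}" if "i \<in> A" for i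
    by (rule finite_subset[OF _ finite_imageI[OF fin, of snd]]) (use that in force)
  have "q_sum A (\<lambda>i. q_sum (B i) (\<lambda>j. f (i, j))) $ m
      = (\<Sum>i\<in>fst ` ?S. q_sum (B i) (\<lambda>j. f (i, j)) $ m)"
  proof (rule q_sum_nth_superset)
    fix i assume i: "i \<in> A" "q_sum (B i) (\<lambda>j. f (i, j)) $ m \<noteq> 0"
    then obtain j where "j \<in> B i" "f (i, j) $ m \<noteq> 0"
      unfolding inner by (metis (mono_tags, lifting) mem_Collect_eq sum.neutral)
    then show "i \<in> fst ` ?S" using i(1) by (intro image_eqI[of _ _ "(i, j)"]) auto
  qed (use fin in auto)
  also have "\<dots> = (\<Sum>p\<in>Sigma (fst ` ?S) (\<lambda>i. {j \<in> B i. f (i, j) $ m \<noteq> 0}). f p $ m)"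
    unfolding inner by (subst sum.Sigma) (use fin fin2 in \<open>auto simp: split_def\<close>)
  also have "Sigma (fst ` ?S) (\<lambda>i. {j \<in> B i. f (i, j) $ m \<noteq> 0}) = ?S" by force
  finally show "q_sum (Sigma A B) f $ m = q_sum A (\<lambda>i. q_sum (B i) (\<lambda>j. f (i, j))) $ m"
    by (simp add: q_sum_nth)
qed

section \<open>Kronecker's function and Fay's identity\<close>

text \<open>
  The expansion of \<open>1 / (1 - w * q^a)\<close> in nonnegative powers of \<open>q\<close>; for \<open>a = 0\<close> and \<open>w = 1\<close> it is
  \<open>0\<close>, as \<open>inverse 0 = 0\<close>.
\<close>

definition kap :: "'k::field \<Rightarrow> int \<Rightarrow> 'k fps" where
  "kap w a = (if a \<ge> 0 then inverse (1 - fps_const w * fps_X ^ nat a)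
     else 1 - inverse (1 - fps_const (inverse w) * fps_X ^ nat (- a)))"

lemma inverse_one_minus_monom:
  fixes w :: "'k::field"
  assumes "n > 0"
  shows "inverse (1 - fps_const w * fps_X ^ n) = Abs_fps (\<lambda>m. if n dvd m then w ^ (m div n) else 0)"
    (is "_ = ?S")
proof -
  have "(1 - fps_const w * fps_X ^ n) * ?S = 1"
  proof (rule fps_ext)
    fix m
    have "((1 - fps_const w * fps_X ^ n) * ?S) $ m = ?S $ m - w * (if m < n then 0 else ?S $ (m - n))"
      by (simp add: left_diff_distrib mult.assoc fps_X_power_mult_nth)
    also have "\<dots> = 1 $ m"
    proof (cases "m < n")
      case True
      then show ?thesis using assms by (auto simp: dvd_def)
    next
      case False
      then have "m div n = Suc ((m - n) div n)" "n dvd m \<longleftrightarrow> n dvd m - n"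
        using assms by (simp_all add: le_div_geq dvd_minus_self)
      then show ?thesis using False assms by auto
    qed
    finally show "((1 - fps_const w * fps_X ^ n) * ?S) $ m = 1 $ m" .
  qed
  then show ?thesis using fps_inverse_unique by blast
qed

lemma kap_pos_nth: "a > 0 \<Longrightarrow> kap w a $ m = (if nat a dvd m then w ^ (m div nat a) else 0)"
  by (simp add: kap_def inverse_one_minus_monom)

lemma kap_0: "kap w 0 = fps_const (inverse (1 - w))"
proof -
  have "1 - fps_const w = fps_const (1 - w)" by (metis fps_const_1_eq_1 fps_const_sub)
  then have "inverse (1 - fps_const w) = fps_const (inverse (1 - w))"
    by (metis fps_const_inverse)
  then show ?thesis by (simp add: kap_def)
qed

lemma kap_neg_nth:
  "a < 0 \<Longrightarrow> kap w a $ m = (if m > 0 \<and> nat (- a) dvd m then - (inverse w ^ (m div nat (- a))) else 0)"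
  by (auto simp add: kap_def inverse_one_minus_monom)

text \<open>Writing a = r - p with natural numbers turns 1 / (1 - w q^a) into q^p / (q^p - w q^r),
  so that both signs of a are handled by one polynomial identity.\<close>

lemma kap_mult_self:
  assumes "w \<noteq> 0" "w \<noteq> 1 \<or> a \<noteq> 0" "a = int r - int p"
  shows "(fps_X ^ p - fps_const w * fps_X ^ r) * kap w a = fps_X ^ p"
proof (cases "a \<ge> 0")
  case True
  then have r: "r = p + nat a" using assms by simp
  have nz: "(1 - fps_const w * fps_X ^ nat a) $ 0 \<noteq> 0"
    using assms True by (cases "a = 0") (auto simp: fps_X_power_nth)
  have "(fps_X ^ p - fps_const w * fps_X ^ r) * kap w a
      = fps_X ^ p * ((1 - fps_const w * fps_X ^ nat a) * inverse (1 - fps_const w * fps_X ^ nat a))"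
    using True by (simp add: kap_def r power_add algebra_simps)
  then show ?thesis using inverse_mult_eq_1'[OF nz] by simp
next
  case False
  define b where "b = nat (- a)"
  have p: "p = r + b" and b: "b > 0" using assms False by (simp_all add: b_def)
  let ?D = "1 - fps_const (inverse w) * fps_X ^ b"
  have nz: "?D $ 0 \<noteq> 0" using b by simp
  have ww: "fps_const w * fps_const (inverse w) = 1" using assms(1) by simp
  have 1: "fps_X ^ b - fps_const w = - fps_const w * ?D"
    using ww by (simp add: algebra_simps flip: mult.assoc)
  have "(fps_X ^ p - fps_const w * fps_X ^ r) * kap w a
      = fps_X ^ r * ((fps_X ^ b - fps_const w) - (fps_X ^ b - fps_const w) * inverse ?D)"
    using False by (simp add: kap_def p power_add b_def algebra_simps)
  also have "(fps_X ^ b - fps_const w) * inverse ?D = - fps_const w * (?D * inverse ?D)"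
    unfolding 1 by (simp only: mult.assoc)
  also have "\<dots> = - fps_const w" using inverse_mult_eq_1'[OF nz] by simp
  finally show ?thesis by (simp add: p power_add)
qed

lemma kap_denominator_nonzero:
  assumes "w \<noteq> 1 \<or> p \<noteq> r"
  shows "fps_X ^ p - fps_const w * fps_X ^ r \<noteq> (0 :: 'k::field fps)"
proof
  assume "fps_X ^ p - fps_const w * fps_X ^ r = (0 :: 'k fps)"
  then have "(fps_X ^ p - fps_const w * fps_X ^ r) $ p = (0 :: 'k)"
    by (simp only: fps_zero_nth)
  then show False using assms by (cases "p = r") (auto simp: fps_X_power_nth)
qed

text \<open>This is 1 / (1 - x) + 1 / (1 - 1 / x) = 1 for x = w q^a; it underlies every edge
  reversal below.\<close>

lemma kap_flip:
  assumes "w \<noteq> 0" "w \<noteq> 1 \<or> a \<noteq> 0"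
  shows "kap w a = 1 - kap (inverse w) (- a)"
proof (cases "a = 0")
  case True
  have "inverse (1 - w) = 1 - inverse (1 - inverse w)"
    using assms True by (simp add: field_simps)
  then show ?thesis using True by (simp add: kap_0 flip: fps_const_1_eq_1 fps_const_sub)
next
  case False
  then show ?thesis by (auto simp: kap_def)
qed

text \<open>The addition theorem of the cotangent; it is the source of Fay's identity.\<close>

lemma kap_mult:
  fixes w1 w2 :: "'a::field"
  assumes w: "w1 \<noteq> 0" "w2 \<noteq> 0" and "w1 \<noteq> 1 \<or> a \<noteq> 0" "w2 \<noteq> 1 \<or> b \<noteq> 0" "w1 * w2 \<noteq> 1 \<or> a + b \<noteq> 0"
  shows "kap w1 a * kap w2 b = kap (w1 * w2) (a + b) * (kap w1 a + kap w2 b - 1)"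
proof -
  define p1 r1 p2 r2 where "p1 = nat (- a)" "r1 = nat a" "p2 = nat (- b)" "r2 = nat b"
  have ab: "a = int r1 - int p1" "b = int r2 - int p2" by (auto simp: p1_r1_p2_r2_def)
  let ?D1 = "fps_X ^ p1 - fps_const w1 * fps_X ^ r1"
  let ?D2 = "fps_X ^ p2 - fps_const w2 * fps_X ^ r2"
  let ?D3 = "fps_X ^ (p1 + p2) - fps_const (w1 * w2) * fps_X ^ (r1 + r2)"
  have k1: "?D1 * kap w1 a = fps_X ^ p1" by (rule kap_mult_self) (use assms ab in auto)
  have k2: "?D2 * kap w2 b = fps_X ^ p2" by (rule kap_mult_self) (use assms ab in auto)
  have k3: "?D3 * kap (w1 * w2) (a + b) = fps_X ^ p1 * fps_X ^ p2"
    by (rule trans[OF kap_mult_self power_add]) (use assms ab in auto)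
  have nz: "?D1 * ?D2 * ?D3 \<noteq> 0"
    using kap_denominator_nonzero[of w1 p1 r1] kap_denominator_nonzero[of w2 p2 r2]
      kap_denominator_nonzero[of "w1 * w2" "p1 + p2" "r1 + r2"] assms ab by auto
  \<comment> \<open>With D1 = x1 - y1 and D2 = x2 - y2 this says x1 x2 - y1 y2 = x1 D2 + x2 D1 - D1
    D2, the addition theorem with denominators cleared.\<close>
  have D3: "?D3 = fps_X ^ p1 * ?D2 + fps_X ^ p2 * ?D1 - ?D1 * ?D2"
    by (simp add: power_add algebra_simps flip: fps_const_mult)
  have "d1 * d2 * d3 * (k1 * k2) = d1 * d2 * d3 * (k3 * (k1 + k2 - 1))"
    if "d1 * k1 = x1" "d2 * k2 = x2" "d3 * k3 = x1 * x2" "d3 = x1 * d2 + x2 * d1 - d1 * d2"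
    for d1 d2 d3 k1 k2 k3 x1 x2 :: "'a fps"
  proof -
    have "d1 * d2 * d3 * (k3 * (k1 + k2 - 1)) = (d3 * k3) * ((d1 * k1) * d2 + (d2 * k2) * d1 - d1 * d2)"
      by (simp add: algebra_simps)
    also have "\<dots> = (d1 * k1) * (d2 * k2) * d3" by (simp only: that(1-3)) (simp only: that(4) mult.commute)
    finally show ?thesis by (simp only: mult_ac)
  qed
  from this[OF k1 k2 k3 D3] have
    "?D1 * ?D2 * ?D3 * (kap w1 a * kap w2 b) = ?D1 * ?D2 * ?D3 * (kap (w1 * w2) (a + b) * (kap w1 a + kap w2 b - 1))" .
  then show ?thesis using nz mult_left_cancel by blast
qed

text \<open>Subtracting the constant term 1 for n > 0 leaves a series of order at least |n| in q,
  which makes the sum over all n converge. The removed geometric series returns in closed form in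
  \<open>kron\<close>.\<close>

definition kap_reg :: "'k::field \<Rightarrow> int \<Rightarrow> 'k fps" where
  "kap_reg w n = kap w n - of_bool (n > 0)"

text \<open>The coefficient of x^a in Kronecker's function at s x. The flag \<delta> chooses the
  annulus of expansion: subtracting 1 moves the constant term in q from exponents a > 0 to exponents
  a < 0, as appropriate for an edge whose source comes later in the order than its target.\<close>

definition phi :: "'k::field \<Rightarrow> 'k \<Rightarrow> bool \<Rightarrow> int \<Rightarrow> 'k fps" where
  "phi s w \<delta> a = fps_const (s powi a) * (kap w a - of_bool \<delta>)"

text \<open>
  Kronecker's function \<open>\<Sum>n. s^n / (1 - w * q^n)\<close>, whose divergent part \<open>\<Sum>n>0. s^n\<close> is replaced by
  its value as a rational function.
\<close>

definition kron :: "'k::field \<Rightarrow> 'k \<Rightarrow> 'k fps" where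
  "kron s w = q_sum UNIV (\<lambda>n. fps_const (s powi n) * kap_reg w n) + fps_const (s / (1 - s))"

lemma kap_reg_nth:
  "kap_reg w n $ m = (if n = 0 then (if m = 0 then inverse (1 - w) else 0)
     else if m = 0 \<or> \<not> n dvd int m then 0
     else if n > 0 then w ^ (m div nat n) else - (inverse w ^ (m div nat (- n))))"
proof -
  have "nat (- n) dvd m \<longleftrightarrow> n dvd int m" if "n < 0"
    using that by (metis int_dvd_int_iff int_nat_eq minus_dvd_iff neg_0_le_iff_le less_le_not_le nle_le)
  moreover have "nat n dvd m \<longleftrightarrow> n dvd int m" if "n > 0"
    using that by (metis int_dvd_int_iff int_nat_eq less_le)
  ultimately show ?thesis
    unfolding kap_reg_def
    by (cases n "0 :: int" rule: linorder_cases) (auto simp: kap_pos_nth kap_neg_nth kap_0)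
qed

lemma kap_reg_nth_nonzero: "kap_reg w n $ m \<noteq> 0 \<Longrightarrow> \<bar>n\<bar> \<le> int m"
  by (auto simp: kap_reg_nth zdvd_imp_le dvd_imp_le_int split: if_splits)

lemma q_summable_kap_reg: "q_summable UNIV (\<lambda>n. fps_const (c n) * kap_reg w n)"
proof (rule q_summableI_bound)
  show "n \<in> {- int m..int m}" if "(fps_const (c n) * kap_reg w n) $ m \<noteq> 0" for m n
    using that kap_reg_nth_nonzero[of w n m] by auto
qed auto

lemma sum_int_telescope:
  fixes Q :: "int \<Rightarrow> 'k::field"
  assumes "\<And>n. Q (n + 1) - Q n = p n" "a \<le> b"
  shows "(\<Sum>n\<in>{a..<b}. p n) = Q b - Q a"
  using assms(2)
proof (induction b rule: int_ge_induct)
  case (step b)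
  have "{a..<b + 1} = insert b {a..<b}" using step.hyps by auto
  then show ?case using step.IH assms(1)[of b] by (simp add: algebra_simps)
qed simp

text \<open>The two step functions differ only between 1 and b, with a sign depending on which is
  larger; in both cases the finite sum telescopes to \<open>Q b - Q 1\<close>. Such a sum remains
  when both factors of a convolution are replaced by their regularisations.\<close>

lemma q_sum_step_difference:
  fixes Q :: "int \<Rightarrow> 'k::field"
  assumes Q: "\<And>n. Q (n + 1) - Q n = p n"
  shows "q_summable UNIV (\<lambda>n. fps_const (p n) * (of_bool (n > 0) - of_bool (n \<ge> b)))"
    and "q_sum UNIV (\<lambda>n. fps_const (p n) * (of_bool (n > 0) - of_bool (n \<ge> b))) = fps_const (Q b - Q 1)"
proof -
  let ?f = "\<lambda>n. fps_const (p n) * (of_bool (n > 0) - of_bool (n \<ge> b))"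
  let ?B = "{min 1 b..<max 1 b}"
  have supp: "n \<in> ?B" if "?f n $ m \<noteq> 0" for n m
    using that by (auto simp: of_bool_def split: if_splits)
  show "q_summable UNIV ?f"
    by (rule q_summableI_bound[of "\<lambda>_. ?B"]) (use supp in auto)
  show "q_sum UNIV ?f = fps_const (Q b - Q 1)"
  proof (rule fps_ext)
    fix m
    have 1: "q_sum UNIV ?f $ m = (\<Sum>n\<in>?B. ?f n $ m)"
      by (rule q_sum_nth_superset) (use supp in auto)
    have 2: "(\<Sum>n\<in>?B. ?f n $ m) = fps_const (Q b - Q 1) $ m"
    proof (cases "b \<ge> 1")
      case True
      then have "(\<Sum>n\<in>?B. ?f n $ m) = (\<Sum>n\<in>{1..<b}. fps_const (p n) $ m)"
        by (intro sum.cong) auto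
      then show ?thesis using sum_int_telescope[of Q p, OF Q, of 1 b] True by (cases "m = 0") auto
    next
      case False
      then have "(\<Sum>n\<in>?B. ?f n $ m) = (\<Sum>n\<in>{b..<1}. - fps_const (p n) $ m)"
        by (intro sum.cong) auto
      then show ?thesis using sum_int_telescope[of Q p, OF Q, of b 1] False
        by (cases "m = 0") (auto simp: sum_negf)
    qed
    show "q_sum UNIV ?f $ m = fps_const (Q b - Q 1) $ m" unfolding 1 2 ..
  qed
qed

lemma bij_int_reflect: "bij_betw (\<lambda>n. b - n :: int) UNIV UNIV"
  by (rule bij_betw_byWitness[of _ "\<lambda>n. b - n"]) auto

lemma phi_flip:
  assumes "s \<noteq> 0" "w \<noteq> 0" "w \<noteq> 1"
  shows "phi (inverse s) (inverse w) (\<not> \<delta>) (- a) = - phi s w \<delta> a"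
proof -
  have "kap (inverse w) (- a) = 1 - kap w a" using kap_flip[of w a] assms by simp
  moreover have "inverse s powi (- a) = s powi a"
    by (simp add: power_int_minus power_int_inverse)
  ultimately have "phi (inverse s) (inverse w) (\<not> \<delta>) (- a)
      = fps_const (s powi a) * (1 - kap w a - of_bool (\<not> \<delta>))"
    by (simp only: phi_def)
  then show ?thesis by (cases \<delta>) (simp_all add: phi_def algebra_simps)
qed

text \<open>Neither part of \<open>kron\<close> is odd by itself: apart from the sign, inversion
  changes the sum by 1, because of its term n = 0, and the rational part by -1.\<close>

lemma kron_flip:
  assumes "s \<noteq> 0" "s \<noteq> 1" "w \<noteq> 0" "w \<noteq> 1"
  shows "kron (inverse s) (inverse w) = - kron s w"
proof -
  have kr: "kap_reg (inverse w) (- n) = of_bool (n = 0) - kap_reg w n" for n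
    using kap_flip[of w n] assms by (cases n "0::int" rule: linorder_cases) (simp_all add: kap_reg_def)
  have fin: "q_summable UNIV (\<lambda>n. fps_const (s powi n) * of_bool (n = 0))"
    by (rule q_summableI_bound[of "\<lambda>_. {0}"]) (auto simp: of_bool_def split: if_splits)
  have one: "q_sum UNIV (\<lambda>n. fps_const (s powi n) * of_bool (n = 0)) = 1"
  proof (rule fps_ext)
    fix m
    have "q_sum UNIV (\<lambda>n. fps_const (s powi n) * of_bool (n = 0)) $ m
        = (\<Sum>n\<in>{0}. (fps_const (s powi n) * of_bool (n = 0)) $ m)"
      by (rule q_sum_nth_superset) (auto simp: of_bool_def split: if_splits)
    then show "q_sum UNIV (\<lambda>n. fps_const (s powi n) * of_bool (n = 0)) $ m = 1 $ m" by simp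
  qed
  have "q_sum UNIV (\<lambda>n. fps_const (inverse s powi n) * kap_reg (inverse w) n)
      = q_sum UNIV (\<lambda>n. fps_const (inverse s powi (0 - n)) * kap_reg (inverse w) (0 - n))"
    by (rule q_sum_reindex[OF bij_int_reflect])
  also have "\<dots> = q_sum UNIV (\<lambda>n. fps_const (s powi n) * of_bool (n = 0) + (- 1) * (fps_const (s powi n) * kap_reg w n))"
    by (rule q_sum_cong) (simp add: kr power_int_minus power_int_inverse algebra_simps)
  also have "\<dots> = 1 - q_sum UNIV (\<lambda>n. fps_const (s powi n) * kap_reg w n)"
    by (subst q_sum_add[OF fin q_summable_mult_left[OF q_summable_kap_reg]])
       (simp only: one q_sum_mult_left[OF q_summable_kap_reg], simp)
  finally have "kron (inverse s) (inverse w)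
      = 1 - q_sum UNIV (\<lambda>n. fps_const (s powi n) * kap_reg w n) + fps_const (inverse s / (1 - inverse s))"
    by (simp add: kron_def)
  moreover have "inverse s / (1 - inverse s) = - 1 - s / (1 - s)"
    using assms by (simp add: field_simps)
  moreover have "fps_const (- 1 - s / (1 - s)) = - 1 - fps_const (s / (1 - s))"
    by (metis fps_const_1_eq_1 fps_const_neg fps_const_sub)
  ultimately show ?thesis by (simp only: kron_def) (simp add: algebra_simps)
qed

text \<open>
  Fay's identity on the level of Fourier coefficients, for two factors with the same argument. All
  sums but the finite geometric one are cut off by \<open>kap_reg\<close>; the closed form of the geometric
  series that is added back is hidden in \<open>kron\<close>.
\<close>

lemma q_sum_phi_convolution_aux:
  fixes s1 s2 w1 w2 :: "'k::field"
  assumes s: "s1 \<noteq> 0" "s2 \<noteq> 0" "s1 \<noteq> s2"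
    and w: "w1 \<noteq> 0" "w2 \<noteq> 0" "w1 \<noteq> 1" "w2 \<noteq> 1" "w1 * w2 \<noteq> 1"
  shows "q_sum UNIV (\<lambda>n. phi s1 w1 False (b - n) * phi s2 w2 False n)
    = kron (s2 / s1) w2 * phi s1 (w1 * w2) False b + kron (s1 / s2) w1 * phi s2 (w1 * w2) False b"
proof -
  define r where "r = s2 / s1"
  have r: "r \<noteq> 0" "r \<noteq> 1" using s by (auto simp: r_def)
  let ?c = "fps_const (s1 powi b) * kap (w1 * w2) b"
  let ?f1 = "\<lambda>n. fps_const (r powi n) * kap_reg w2 n"
  let ?f2 = "\<lambda>n. fps_const (r powi n) * kap_reg w1 (b - n)"
  let ?f3 = "\<lambda>n. fps_const (r powi n) * (of_bool (n > 0) - of_bool (n \<ge> b)) :: 'k fps"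
  let ?g = "\<lambda>n. fps_const (inverse r powi n) * kap_reg w1 n"
  have f2g: "?f2 n = fps_const (r powi b) * ?g (b - n)" for n
    using r by (simp add: power_int_diff power_int_inverse divide_inverse flip: fps_const_mult)
  have s2: "q_summable UNIV (\<lambda>n. ?g (b - n))"
    using q_summable_reindex[OF bij_int_reflect, of ?g b] q_summable_kap_reg by blast
  then have sf2: "q_summable UNIV ?f2"
    unfolding f2g by (rule q_summable_mult_left)
  have tel: "- (r powi (n + 1)) / (1 - r) - - (r powi n) / (1 - r) = r powi n" for n
  proof -
    have "- (r powi (n + 1)) / (1 - r) - - (r powi n) / (1 - r) = (r powi n * (1 - r)) / (1 - r)"
      using r(1) by (simp add: power_int_add algebra_simps flip: diff_divide_distrib)
    then show ?thesis using r(2) by simp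
  qed
  have term_eq: "phi s1 w1 False (b - n) * phi s2 w2 False n = ?c * (?f1 n + ?f2 n + ?f3 n)" for n
  proof -
    have "s1 powi (b - n) * s2 powi n = s1 powi b * r powi n"
      using s by (simp add: r_def power_int_diff power_int_divide_distrib)
    then have "phi s1 w1 False (b - n) * phi s2 w2 False n
        = fps_const (s1 powi b) * fps_const (r powi n) * (kap w1 (b - n) * kap w2 n)"
      unfolding phi_def by (simp add: mult_ac)
    also have "kap w1 (b - n) * kap w2 n = kap (w1 * w2) b * (kap w1 (b - n) + kap w2 n - 1)"
      using kap_mult[of w1 w2 "b - n" n] w by simp
    also have "kap w1 (b - n) + kap w2 n - 1
        = kap_reg w1 (b - n) + kap_reg w2 n + (of_bool (n > 0) - of_bool (n \<ge> b))"
      by (auto simp: kap_reg_def)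
    finally show ?thesis by (simp only: distrib_left mult_ac add_ac)
  qed
  have "q_sum UNIV (\<lambda>n. phi s1 w1 False (b - n) * phi s2 w2 False n)
      = ?c * (q_sum UNIV ?f1 + q_sum UNIV ?f2 + q_sum UNIV ?f3)"
    unfolding term_eq
    by (simp add: q_sum_mult_left q_sum_add q_summable_add q_summable_kap_reg sf2
        q_sum_step_difference(1)[of "\<lambda>n. - (r powi n) / (1 - r)", OF tel])
  also have "q_sum UNIV ?f1 = kron r w2 - fps_const (r / (1 - r))" by (simp add: kron_def)
  also have "q_sum UNIV ?f2 = fps_const (r powi b) * q_sum UNIV (\<lambda>n. ?g (b - n))"
    unfolding f2g by (rule q_sum_mult_left[OF s2])
  also have "q_sum UNIV (\<lambda>n. ?g (b - n)) = q_sum UNIV ?g"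
    by (rule q_sum_reindex[OF bij_int_reflect, symmetric])
  also have "q_sum UNIV ?g = kron (inverse r) w1 - fps_const (inverse r / (1 - inverse r))"
    by (simp add: kron_def)
  also have "inverse r / (1 - inverse r) = - 1 / (1 - r)"
    using r by (simp add: field_simps)
  also have "q_sum UNIV ?f3 = fps_const ((r - r powi b) / (1 - r))"
    using q_sum_step_difference(2)[of "\<lambda>n. - (r powi n) / (1 - r)", OF tel]
    by (simp add: diff_divide_distrib)
  \<comment> \<open>The closed forms built into the two values of \<open>kron\<close> cancel the
    finite geometric sum exactly.\<close>
  also have "kron r w2 - fps_const (r / (1 - r)) + fps_const (r powi b) * (kron (inverse r) w1 - fps_const (- 1 / (1 - r)))
      + fps_const ((r - r powi b) / (1 - r)) = kron r w2 + fps_const (r powi b) * kron (inverse r) w1"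
  proof -
    have "fps_const (r powi b) * fps_const (- 1 / (1 - r)) + fps_const (r / (1 - r))
        = fps_const ((r - r powi b) / (1 - r))"
      by (simp add: add_divide_distrib diff_divide_distrib)
    then show ?thesis by (simp add: algebra_simps)
  qed
  also have "?c * \<dots> = kron r w2 * phi s1 (w1 * w2) False b
      + kron (inverse r) w1 * (fps_const (s1 powi b) * fps_const (r powi b) * kap (w1 * w2) b)"
    by (simp add: phi_def algebra_simps)
  also have "fps_const (s1 powi b) * fps_const (r powi b) = fps_const (s2 powi b)"
    using s by (simp add: r_def power_int_divide_distrib)
  finally show ?thesis by (simp add: phi_def r_def)
qed

text \<open>The expansion with \<delta> true is the one with \<delta> false after inverting all
  parameters; the signs of \<open>phi_flip\<close> and \<open>kron_flip\<close> cancel in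
  pairs.\<close>

lemma q_sum_phi_convolution:
  fixes s1 s2 w1 w2 :: "'k::field"
  assumes s: "s1 \<noteq> 0" "s2 \<noteq> 0" "s1 \<noteq> s2"
    and w: "w1 \<noteq> 0" "w2 \<noteq> 0" "w1 \<noteq> 1" "w2 \<noteq> 1" "w1 * w2 \<noteq> 1"
  shows "q_sum UNIV (\<lambda>n. phi s1 w1 \<delta> (b - n) * phi s2 w2 \<delta> n)
    = kron (s2 / s1) w2 * phi s1 (w1 * w2) \<delta> b + kron (s1 / s2) w1 * phi s2 (w1 * w2) \<delta> b"
proof (cases \<delta>)
  case False
  then show ?thesis using q_sum_phi_convolution_aux[OF assms] by simp
next
  case True
  have fl: "phi s w True a = - phi (inverse s) (inverse w) False (- a)" if "s \<noteq> 0" "w \<noteq> 0" "w \<noteq> 1" for s w :: 'k and a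
    using phi_flip[OF that, of True a] by simp
  have "q_sum UNIV (\<lambda>n. phi s1 w1 True (b - n) * phi s2 w2 True n)
      = q_sum UNIV (\<lambda>n. phi (inverse s1) (inverse w1) False (- b + n) * phi (inverse s2) (inverse w2) False (- n))"
    by (rule q_sum_cong) (simp add: fl s w)
  also have "\<dots> = q_sum UNIV (\<lambda>n. phi (inverse s1) (inverse w1) False (- b - n) * phi (inverse s2) (inverse w2) False n)"
    by (subst q_sum_reindex[OF bij_int_reflect[of 0]]) simp
  also have "\<dots> = kron (inverse s2 / inverse s1) (inverse w2) * phi (inverse s1) (inverse w1 * inverse w2) False (- b)
      + kron (inverse s1 / inverse s2) (inverse w1) * phi (inverse s2) (inverse w1 * inverse w2) False (- b)"
    by (rule q_sum_phi_convolution_aux) (use s w in \<open>auto simp: field_simps\<close>)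
  also have "kron (inverse s2 / inverse s1) (inverse w2) = - kron (s2 / s1) w2"
    using kron_flip[of "s2 / s1" w2] s w by (simp add: divide_inverse mult.commute) (simp add: field_simps)
  also have "kron (inverse s1 / inverse s2) (inverse w1) = - kron (s1 / s2) w1"
    using kron_flip[of "s1 / s2" w1] s w by (simp add: divide_inverse mult.commute) (simp add: field_simps)
  also have "phi (inverse s1) (inverse w1 * inverse w2) False (- b) = - phi s1 (w1 * w2) True b"
    using fl[of s1 "w1 * w2" b] s w by simp
  also have "phi (inverse s2) (inverse w1 * inverse w2) False (- b) = - phi s2 (w1 * w2) True b"
    using fl[of s2 "w1 * w2" b] s w by simp
  finally show ?thesis using True by simp
qed

text \<open>After \<open>kap_mult\<close> only the constants remain to be compared: \<delta>1
  \<delta>2 = \<delta>1 \<delta> + \<delta>2 (1 - \<delta>), which is \<open>order\<close>. It holds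
  if the three flags say t1 < v, t2 < v and t2 < t1 in a linear order.\<close>

lemma phi_mult_phi:
  fixes s1 s2 w1 w2 :: "'k::field"
  assumes s: "s1 \<noteq> 0" "s2 \<noteq> 0"
    and w: "w1 \<noteq> 0" "w2 \<noteq> 0" "w1 \<noteq> 1" "w2 \<noteq> 1" "w1 * w2 \<noteq> 1"
    and order: "\<delta>1 \<and> \<delta>2 \<longleftrightarrow> \<delta>1 \<and> \<delta> \<or> \<delta>2 \<and> \<not> \<delta>"
  shows "phi s1 w1 \<delta>1 a * phi s2 w2 \<delta>2 b
    = phi s1 (w1 * w2) \<delta>1 (a + b) * phi (s2 / s1) w2 \<delta> b
      + phi s2 (w1 * w2) \<delta>2 (a + b) * phi (s1 / s2) w1 (\<not> \<delta>) a"
proof -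
  have s_eq: "s1 powi (a + b) * (s2 / s1) powi b = s1 powi a * s2 powi b"
    "s2 powi (a + b) * (s1 / s2) powi a = s1 powi a * s2 powi b"
    using s by (simp_all add: power_int_add power_int_divide_distrib)
  have "phi s1 (w1 * w2) \<delta>1 (a + b) * phi (s2 / s1) w2 \<delta> b
      = fps_const (s1 powi (a + b) * (s2 / s1) powi b)
        * ((kap (w1 * w2) (a + b) - of_bool \<delta>1) * (kap w2 b - of_bool \<delta>))"
    unfolding phi_def by (simp add: mult_ac flip: fps_const_mult)
  moreover have "phi s2 (w1 * w2) \<delta>2 (a + b) * phi (s1 / s2) w1 (\<not> \<delta>) a
      = fps_const (s2 powi (a + b) * (s1 / s2) powi a)
        * ((kap (w1 * w2) (a + b) - of_bool \<delta>2) * (kap w1 a - of_bool (\<not> \<delta>)))"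
    unfolding phi_def by (simp add: mult_ac flip: fps_const_mult)
  moreover have "phi s1 w1 \<delta>1 a * phi s2 w2 \<delta>2 b
      = fps_const (s1 powi a * s2 powi b) * ((kap w1 a - of_bool \<delta>1) * (kap w2 b - of_bool \<delta>2))"
    unfolding phi_def by (simp add: mult_ac flip: fps_const_mult)
  moreover have "(kap w1 a - of_bool \<delta>1) * (kap w2 b - of_bool \<delta>2)
      = (kap (w1 * w2) (a + b) - of_bool \<delta>1) * (kap w2 b - of_bool \<delta>)
        + (kap (w1 * w2) (a + b) - of_bool \<delta>2) * (kap w1 a - of_bool (\<not> \<delta>))"
    using kap_mult[of w1 w2 a b] w order
    by (cases \<delta>1; cases \<delta>2; cases \<delta>) (simp_all add: algebra_simps)
  ultimately show ?thesis unfolding s_eq by (simp only: distrib_left)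
qed

section \<open>Sums over circulations\<close>

text \<open>Generic in the ring because it has two uses: conservation of the integer exponents at
  each vertex, and the exponents of the simplex integral, formed from the parameters
  \<alpha>.\<close>

definition outflow :: "'e set \<Rightarrow> ('e \<Rightarrow> 'v) \<Rightarrow> ('e \<Rightarrow> 'v) \<Rightarrow> ('e \<Rightarrow> 'k::comm_ring_1) \<Rightarrow> 'v \<Rightarrow> 'k" where
  "outflow E src tgt a v = (\<Sum>e\<in>E. (of_bool (src e = v) - of_bool (tgt e = v)) * a e)"

text \<open>A loop does not affect any outflow, so its value is pinned to 0, as are the values
  outside E; each circulation then has exactly one representative.\<close>

definition flows :: "'e set \<Rightarrow> ('e \<Rightarrow> 'v) \<Rightarrow> ('e \<Rightarrow> 'v) \<Rightarrow> ('e \<Rightarrow> int) set" where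
  "flows E src tgt = {a. (\<forall>e. e \<notin> E \<or> src e = tgt e \<longrightarrow> a e = 0) \<and> (\<forall>v. outflow E src tgt a v = 0)}"

definition flow_weight :: "('v \<Rightarrow> nat) \<Rightarrow> ('e \<Rightarrow> 'v) \<Rightarrow> ('e \<Rightarrow> 'v) \<Rightarrow> ('e \<Rightarrow> 'k::field) \<Rightarrow> ('e \<Rightarrow> 'k) \<Rightarrow>
    'e set \<Rightarrow> ('e \<Rightarrow> int) \<Rightarrow> 'k fps" where
  "flow_weight r src tgt s w E a =
     (\<Prod>e | e \<in> E \<and> src e \<noteq> tgt e. phi (s e) (w e) (r (tgt e) < r (src e)) (a e))"

text \<open>
  A loop carries an unconstrained exponent, so it contributes the full series \<open>kron\<close>; the exponents of
  the other edges run over circulations.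
\<close>

definition flow_sum :: "('v \<Rightarrow> nat) \<Rightarrow> ('e \<Rightarrow> 'v) \<Rightarrow> ('e \<Rightarrow> 'v) \<Rightarrow> ('e \<Rightarrow> 'k::field) \<Rightarrow> ('e \<Rightarrow> 'k) \<Rightarrow>
    'e set \<Rightarrow> 'k fps" where
  "flow_sum r src tgt s w E =
     (\<Prod>e | e \<in> E \<and> src e = tgt e. kron (s e) (w e)) *
     q_sum (flows E src tgt) (flow_weight r src tgt s w E)"

section \<open>Finiteness of the sums over circulations\<close>

lemma phi_nth_nonzero:
  assumes "phi s w \<delta> a $ m \<noteq> 0"
  shows "- int m \<le> (if \<delta> then - a else a)"
proof -
  have nz: "(kap w a - of_bool \<delta>) $ m \<noteq> 0" using assms by (auto simp: phi_def)
  show ?thesis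
  proof (cases \<delta>)
    case True
    show ?thesis
    proof (cases "a > 0")
      case pos: True
      then have "kap_reg w a $ m \<noteq> 0" using nz True by (simp add: kap_reg_def)
      then show ?thesis using kap_reg_nth_nonzero[of w a m] True by simp
    qed (use True in simp)
  next
    case False
    show ?thesis
    proof (cases "a < 0")
      case neg: True
      then have "kap_reg w a $ m \<noteq> 0" using nz False by (simp add: kap_reg_def)
      then show ?thesis using kap_reg_nth_nonzero[of w a m] False by simp
    qed (use False in simp)
  qed
qed

lemma fps_prod_nth_nonzero:
  fixes f :: "'a \<Rightarrow> 'k::idom fps"
  assumes "finite A" "(\<Prod>e\<in>A. f e) $ m \<noteq> 0" "e \<in> A"
  shows "\<exists>l\<le>m. f e $ l \<noteq> 0"
proof -
  have "(f e * prod f (A - {e})) $ m \<noteq> 0" using assms by (metis prod.remove)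
  then have "\<exists>l\<in>{0..m}. f e $ l * prod f (A - {e}) $ (m - l) \<noteq> 0"
    unfolding fps_mult_nth by (meson sum.neutral)
  then show ?thesis by auto
qed

lemma sum_of_bool_eq:
  "finite T \<Longrightarrow> (\<Sum>v\<in>T. of_bool (x = v)) = (of_bool (x \<in> T) :: 'k::comm_ring_1)"
  by (simp add: of_bool_def)

lemma sum_outflow:
  assumes "finite T"
  shows "(\<Sum>v\<in>T. outflow E src tgt a v) = (\<Sum>e\<in>E. (of_bool (src e \<in> T) - of_bool (tgt e \<in> T)) * a e)"
  unfolding outflow_def using assms
  by (subst sum.swap) (simp only: sum_distrib_right[symmetric] sum_subtractf sum_of_bool_eq)

text \<open>Lower bounds on the flow in the direction of the order imply upper bounds. Cut the
  vertices at the lower end of e: every edge crossing the cut leaves the initial segment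
  \<open>T\<close> upwards and the crossing flows sum to 0, so the flow of e is at most m times the
  number of other edges.\<close>

lemma finite_bounded_flows:
  assumes fin: "finite E" and r: "\<And>e. e \<in> E \<Longrightarrow> src e \<noteq> tgt e \<Longrightarrow> (r (src e) :: nat) \<noteq> r (tgt e)"
  shows "finite {a \<in> flows E src tgt. \<forall>e\<in>E. src e \<noteq> tgt e \<longrightarrow>
    - int m \<le> (if r (tgt e) < r (src e) then - a e else a e)}" (is "finite ?A")
proof (rule finite_subset)
  let ?B = "{- int m * (1 + int (card E))..int m * (1 + int (card E))}"
  show "finite {a. \<forall>e. (e \<in> E \<longrightarrow> a e \<in> ?B) \<and> (e \<notin> E \<longrightarrow> a e = 0)}"
    by (rule finite_set_of_finite_funs) (use fin in auto)
  show "?A \<subseteq> {a. \<forall>e. (e \<in> E \<longrightarrow> a e \<in> ?B) \<and> (e \<notin> E \<longrightarrow> a e = 0)}"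
  proof
    fix a assume a: "a \<in> ?A"
    define b where "b e = (if r (tgt e) < r (src e) then - a e else a e)" for e
    have lower: "- int m \<le> b e" if e: "e \<in> E" for e
      using a e by (cases "src e = tgt e") (auto simp: b_def flows_def)
    have upper: "b e \<le> int m * int (card E)" if e: "e \<in> E" "src e \<noteq> tgt e" for e
    proof -
      define T where "T = {v \<in> src ` E \<union> tgt ` E. r v \<le> min (r (src e)) (r (tgt e))}"
      have T: "finite T" using fin by (auto simp: T_def)
      define C where "C e' \<longleftrightarrow> (src e' \<in> T) \<noteq> (tgt e' \<in> T)" for e'
      have "(\<Sum>v\<in>T. outflow E src tgt a v) = 0" using a by (simp add: flows_def)
      then have "0 = (\<Sum>e'\<in>E. (of_bool (src e' \<in> T) - of_bool (tgt e' \<in> T)) * a e')"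
        using sum_outflow[OF T] by metis
      also have "\<dots> = (\<Sum>e'\<in>E. of_bool (C e') * b e')"
        by (intro sum.cong refl) (auto simp: C_def b_def T_def)
      also have "\<dots> = b e + (\<Sum>e'\<in>E - {e}. of_bool (C e') * b e')"
      proof -
        have "C e" using e r[OF e] by (auto simp: C_def T_def min_def)
        then show ?thesis using fin e by (subst sum.remove[of _ e]) auto
      qed
      finally have "b e = - (\<Sum>e'\<in>E - {e}. of_bool (C e') * b e')" by simp
      also have "\<dots> = (\<Sum>e'\<in>E - {e}. - (of_bool (C e') * b e'))" by (simp add: sum_negf)
      also have "\<dots> \<le> (\<Sum>e'\<in>E - {e}. int m)"
      proof (rule sum_mono)
        fix e' assume "e' \<in> E - {e}"
        then show "- (of_bool (C e') * b e') \<le> int m" using lower[of e'] by (cases "C e'") auto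
      qed
      also have "\<dots> = int m * int (card (E - {e}))" by simp
      also have "\<dots> \<le> int m * int (card E)"
        by (intro mult_left_mono) (use fin in \<open>simp_all add: card_mono\<close>)
      finally show ?thesis .
    qed
    show "a \<in> {a. \<forall>e. (e \<in> E \<longrightarrow> a e \<in> ?B) \<and> (e \<notin> E \<longrightarrow> a e = 0)}"
    proof (clarify, intro conjI impI)
      fix e assume e: "e \<in> E"
      have nn: "0 \<le> int m * int (card E)" by simp
      show "a e \<in> ?B"
      proof (cases "src e = tgt e")
        case True
        then have "a e = 0" using a by (auto simp: flows_def)
        then show ?thesis by simp
      next
        case False
        have "\<bar>a e\<bar> = \<bar>b e\<bar>" by (simp add: b_def)
        also have "\<dots> \<le> int m * (1 + int (card E))"
          using lower[OF e] upper[OF e False] nn unfolding distrib_left by linarith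
        finally show ?thesis by auto
      qed
    qed (use a in \<open>auto simp: flows_def\<close>)
  qed
qed

lemma q_summable_flow_weight:
  assumes fin: "finite E" and r: "\<And>e. e \<in> E \<Longrightarrow> src e \<noteq> tgt e \<Longrightarrow> r (src e) \<noteq> r (tgt e)"
  shows "q_summable (flows E src tgt) (flow_weight r src tgt s w E)"
proof (rule q_summableI_bound)
  let ?B = "\<lambda>m. {a \<in> flows E src tgt. \<forall>e\<in>E. src e \<noteq> tgt e \<longrightarrow>
    - int m \<le> (if r (tgt e) < r (src e) then - a e else a e)}"
  show "finite (?B m)" for m
    by (rule finite_bounded_flows[OF fin]) (rule r)
  fix m a assume a: "a \<in> flows E src tgt" "flow_weight r src tgt s w E a $ m \<noteq> 0"
  have "- int m \<le> (if r (tgt e) < r (src e) then - a e else a e)" if e: "e \<in> E" "src e \<noteq> tgt e" for e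
  proof -
    obtain l where "l \<le> m" "phi (s e) (w e) (r (tgt e) < r (src e)) (a e) $ l \<noteq> 0"
      using fps_prod_nth_nonzero[OF _ a(2)[unfolded flow_weight_def], of e] fin e by auto
    then show ?thesis using phi_nth_nonzero by fastforce
  qed
  then show "a \<in> ?B m" using a(1) by simp
qed

text \<open>The edge e2 is moved from its source to the head of e1, and its flow travels through e1
  first; the balance at every vertex stays the same.\<close>

lemma outflow_absorb:
  assumes "finite E" "e1 \<in> E" "e2 \<in> E" "e1 \<noteq> e2" "src e1 = src e2"
  shows "outflow E (src(e2 := tgt e1)) tgt (a(e1 := a e1 + a e2)) = outflow E src tgt a"
proof
  fix v
  define R where "R = E - {e1, e2}"
  have E: "E = insert e1 (insert e2 R)" "finite R" "e1 \<notin> R" "e2 \<notin> R"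
    using assms by (auto simp: R_def)
  have R: "(\<Sum>e\<in>R. (of_bool ((src(e2 := tgt e1)) e = v) - of_bool (tgt e = v)) * (a(e1 := a e1 + a e2)) e)
      = (\<Sum>e\<in>R. (of_bool (src e = v) - of_bool (tgt e = v)) * a e)"
    by (intro sum.cong) (use E in auto)
  show "outflow E (src(e2 := tgt e1)) tgt (a(e1 := a e1 + a e2)) v = outflow E src tgt a v"
    unfolding outflow_def E(1) using E(2-4) assms(4,5) R by (simp add: algebra_simps)
qed

lemma outflow_cong:
  assumes "\<And>e. e \<in> E \<Longrightarrow> src e \<noteq> tgt e \<Longrightarrow> a e = b e"
  shows "outflow E src tgt a = outflow E src tgt b"
  unfolding outflow_def by (intro ext sum.cong refl) (use assms in auto)

lemma flow_weight_split:
  assumes "finite E" "e1 \<in> E" "e2 \<in> E" "e1 \<noteq> e2"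
  shows "flow_weight r src tgt s w E a =
    (if src e1 = tgt e1 then 1 else phi (s e1) (w e1) (r (tgt e1) < r (src e1)) (a e1)) *
    (if src e2 = tgt e2 then 1 else phi (s e2) (w e2) (r (tgt e2) < r (src e2)) (a e2)) *
    flow_weight r src tgt s w (E - {e1, e2}) a"
proof -
  define R where "R = {e \<in> E - {e1, e2}. src e \<noteq> tgt e}"
  have R: "finite R" "e1 \<notin> R" "e2 \<notin> R" using assms by (auto simp: R_def)
  have "{e \<in> E. src e \<noteq> tgt e} = (if src e1 = tgt e1 then {} else {e1}) \<union> ((if src e2 = tgt e2 then {} else {e2}) \<union> R)"
    using assms by (auto simp: R_def)
  then show ?thesis
    unfolding flow_weight_def R_def[symmetric] using R assms(4) by (auto simp: mult_ac)
qed

lemma flow_weight_cong: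
  assumes "\<And>e. e \<in> E \<Longrightarrow> src e = src' e \<and> s e = s' e \<and> w e = w' e \<and> a e = a' e"
  shows "flow_weight r src tgt s w E a = flow_weight r src' tgt s' w' E a'"
  unfolding flow_weight_def by (intro prod.cong) (use assms in auto)

lemma flows_absorb:
  assumes "finite E" "e1 \<in> E" "e2 \<in> E" "e1 \<noteq> e2" "src e1 = src e2"
    "tgt e1 \<noteq> src e1" "tgt e2 \<noteq> src e1" "tgt e1 \<noteq> tgt e2"
  shows "bij_betw (\<lambda>a. a(e1 := a e1 + a e2)) (flows E src tgt) (flows E (src(e2 := tgt e1)) tgt)"
proof (rule bij_betw_byWitness[of _ "\<lambda>a. a(e1 := a e1 - a e2)"])
  have of: "outflow E (src(e2 := tgt e1)) tgt (a(e1 := a e1 + a e2)) = outflow E src tgt a" for a :: "'a \<Rightarrow> int"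
    by (rule outflow_absorb) (use assms in auto)
  have of': "outflow E src tgt (a(e1 := a e1 - a e2)) = outflow E (src(e2 := tgt e1)) tgt a" for a :: "'a \<Rightarrow> int"
    using of[of "a(e1 := a e1 - a e2)"] assms(4) by simp
  show "(\<lambda>a. a(e1 := a e1 + a e2)) ` flows E src tgt \<subseteq> flows E (src(e2 := tgt e1)) tgt"
  proof (clarify)
    fix a assume a: "a \<in> flows E src tgt"
    have "(a(e1 := a e1 + a e2)) e = 0" if "e \<notin> E \<or> (src(e2 := tgt e1)) e = tgt e" for e
    proof -
      have "e \<noteq> e1" "e \<noteq> e2" using that assms by auto
      then show ?thesis using that a by (auto simp: flows_def)
    qed
    then show "a(e1 := a e1 + a e2) \<in> flows E (src(e2 := tgt e1)) tgt"
      using a unfolding flows_def mem_Collect_eq of by blast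
  qed
  show "(\<lambda>a. a(e1 := a e1 - a e2)) ` flows E (src(e2 := tgt e1)) tgt \<subseteq> flows E src tgt"
  proof (clarify)
    fix a assume a: "a \<in> flows E (src(e2 := tgt e1)) tgt"
    have "(a(e1 := a e1 - a e2)) e = 0" if "e \<notin> E \<or> src e = tgt e" for e
    proof -
      have "e \<noteq> e1" "e \<noteq> e2" using that assms by auto
      then show ?thesis using that a by (auto simp: flows_def)
    qed
    then show "a(e1 := a e1 - a e2) \<in> flows E src tgt"
      using a unfolding flows_def mem_Collect_eq of' by blast
  qed
qed (use assms in auto)

text \<open>Fay's identity termwise: \<open>phi_mult_phi\<close> splits the weight of each
  circulation into the weights of its two rerouted images. The flags are consistent since
  \<open>r\<close> orders the common source and both targets.\<close>

lemma flow_sum_fay_distinct: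
  fixes s w :: "'e \<Rightarrow> 'k::field"
  assumes fin: "finite E" and e: "e1 \<in> E" "e2 \<in> E" "e1 \<noteq> e2" and src: "src e1 = src e2"
    and tgt: "tgt e1 \<noteq> src e1" "tgt e2 \<noteq> src e1" "tgt e1 \<noteq> tgt e2"
    and r: "\<And>e. e \<in> E \<Longrightarrow> src e \<noteq> tgt e \<Longrightarrow> r (src e) \<noteq> r (tgt e)" "r (tgt e1) \<noteq> r (tgt e2)"
    and s: "s e1 \<noteq> 0" "s e2 \<noteq> 0"
    and w: "w e1 \<noteq> 0" "w e2 \<noteq> 0" "w e1 \<noteq> 1" "w e2 \<noteq> 1" "w e1 * w e2 \<noteq> 1"
  shows "flow_sum r src tgt s w E
    = flow_sum r (src(e2 := tgt e1)) tgt (s(e2 := s e2 / s e1)) (w(e1 := w e1 * w e2)) E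
      + flow_sum r (src(e1 := tgt e2)) tgt (s(e1 := s e1 / s e2)) (w(e2 := w e1 * w e2)) E"
proof -
  let ?L = "\<lambda>src s w. (\<Prod>e | e \<in> E \<and> src e = tgt e. kron (s e) (w e)) :: 'k fps"
  define W where "W = w e1 * w e2"
  let ?src1 = "src(e2 := tgt e1)" and ?s1 = "s(e2 := s e2 / s e1)" and ?w1 = "w(e1 := W)"
  let ?src2 = "src(e1 := tgt e2)" and ?s2 = "s(e1 := s e1 / s e2)" and ?w2 = "w(e2 := W)"
  have L1: "?L ?src1 ?s1 ?w1 = ?L src s w" and L2: "?L ?src2 ?s2 ?w2 = ?L src s w"
    by (intro prod.cong; use e src tgt in auto)+
  let ?h1 = "\<lambda>a. a(e1 := a e1 + a e2) :: 'e \<Rightarrow> int" and ?h2 = "\<lambda>a. a(e2 := a e2 + a e1) :: 'e \<Rightarrow> int"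
  let ?R = "E - {e1, e2}"
  have wt: "flow_weight r src tgt s w E a
      = flow_weight r ?src1 tgt ?s1 ?w1 E (?h1 a) + flow_weight r ?src2 tgt ?s2 ?w2 E (?h2 a)" for a
  proof -
    have R1: "flow_weight r ?src1 tgt ?s1 ?w1 ?R (?h1 a) = flow_weight r src tgt s w ?R a"
      by (rule flow_weight_cong) auto
    have R2: "flow_weight r ?src2 tgt ?s2 ?w2 ?R (?h2 a) = flow_weight r src tgt s w ?R a"
      by (rule flow_weight_cong) auto
    have "phi (s e1) (w e1) (r (tgt e1) < r (src e1)) (a e1) * phi (s e2) (w e2) (r (tgt e2) < r (src e2)) (a e2)
      = phi (s e1) W (r (tgt e1) < r (src e1)) (a e1 + a e2) * phi (s e2 / s e1) (w e2) (r (tgt e2) < r (tgt e1)) (a e2)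
      + phi (s e2) W (r (tgt e2) < r (src e2)) (a e1 + a e2) * phi (s e1 / s e2) (w e1) (\<not> r (tgt e2) < r (tgt e1)) (a e1)"
      unfolding W_def
      by (rule phi_mult_phi) (use s w src r(1)[OF e(1)] r(1)[OF e(2)] r(2) tgt in auto)
    moreover have "(\<not> r (tgt e2) < r (tgt e1)) = (r (tgt e1) < r (tgt e2))" using r(2) by auto
    ultimately show ?thesis
      unfolding flow_weight_split[OF fin e] R1 R2 using e(3) src tgt
      by (simp add: algebra_simps)
  qed
  have sum1: "q_summable (flows E ?src1 tgt) (flow_weight r ?src1 tgt ?s1 ?w1 E)"
    by (rule q_summable_flow_weight[OF fin]) (use r tgt in \<open>auto split: if_splits\<close>)
  have sum2: "q_summable (flows E ?src2 tgt) (flow_weight r ?src2 tgt ?s2 ?w2 E)"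
    by (rule q_summable_flow_weight[OF fin]) (use r tgt in \<open>auto split: if_splits\<close>)
  have b1: "bij_betw ?h1 (flows E src tgt) (flows E ?src1 tgt)"
    by (rule flows_absorb) (use fin e src tgt in auto)
  have b2: "bij_betw ?h2 (flows E src tgt) (flows E ?src2 tgt)"
    by (rule flows_absorb) (use fin e src tgt in auto)
  have "q_sum (flows E src tgt) (flow_weight r src tgt s w E)
      = q_sum (flows E src tgt) (\<lambda>a. flow_weight r ?src1 tgt ?s1 ?w1 E (?h1 a))
        + q_sum (flows E src tgt) (\<lambda>a. flow_weight r ?src2 tgt ?s2 ?w2 E (?h2 a))"
    using sum1 sum2 unfolding q_summable_reindex[OF b1] q_summable_reindex[OF b2]
    by (subst q_sum_add[symmetric]) (auto simp: wt intro: q_sum_cong)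
  also have "\<dots> = q_sum (flows E ?src1 tgt) (flow_weight r ?src1 tgt ?s1 ?w1 E)
        + q_sum (flows E ?src2 tgt) (flow_weight r ?src2 tgt ?s2 ?w2 E)"
    by (simp only: q_sum_reindex[OF b1] q_sum_reindex[OF b2])
  finally show ?thesis
    unfolding flow_sum_def W_def[symmetric] L1 L2 by (simp add: distrib_left)
qed

text \<open>With equal targets the moved edge becomes a loop. A circulation on the original graph is
  a circulation on the new one together with a free integer n, the flow of e2; summing over n is the
  convolution \<open>q_sum_phi_convolution\<close>, whose factors \<open>kron\<close> are the
  contributions of the loops.\<close>

lemma flow_sum_fay_parallel:
  fixes s w :: "'e \<Rightarrow> 'k::field"
  assumes fin: "finite E" and e: "e1 \<in> E" "e2 \<in> E" "e1 \<noteq> e2" and src: "src e1 = src e2"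
    and tgt: "tgt e1 \<noteq> src e1" "tgt e1 = tgt e2"
    and r: "\<And>e. e \<in> E \<Longrightarrow> src e \<noteq> tgt e \<Longrightarrow> r (src e) \<noteq> r (tgt e)"
    and s: "s e1 \<noteq> 0" "s e2 \<noteq> 0" "s e1 \<noteq> s e2"
    and w: "w e1 \<noteq> 0" "w e2 \<noteq> 0" "w e1 \<noteq> 1" "w e2 \<noteq> 1" "w e1 * w e2 \<noteq> 1"
  shows "flow_sum r src tgt s w E
    = flow_sum r (src(e2 := tgt e1)) tgt (s(e2 := s e2 / s e1)) (w(e1 := w e1 * w e2)) E
      + flow_sum r (src(e1 := tgt e2)) tgt (s(e1 := s e1 / s e2)) (w(e2 := w e1 * w e2)) E"
proof -
  let ?L = "\<lambda>src s w. (\<Prod>e | e \<in> E \<and> src e = tgt e. kron (s e) (w e)) :: 'k fps"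
  define W where "W = w e1 * w e2"
  let ?src1 = "src(e2 := tgt e1)" and ?s1 = "s(e2 := s e2 / s e1)" and ?w1 = "w(e1 := W)"
  let ?src2 = "src(e1 := tgt e2)" and ?s2 = "s(e1 := s e1 / s e2)" and ?w2 = "w(e2 := W)"
  let ?R = "E - {e1, e2}"
  let ?\<delta> = "r (tgt e1) < r (src e1)"
  have L: "?L src' s' w' = kron (s' e') (w' e') * ?L src s w"
    if "src' = src(e' := tgt e')" "\<And>e. e \<notin> {e1, e2} \<Longrightarrow> s' e = s e \<and> w' e = w e" "e' \<in> {e1, e2}" for src' s' w' e'
  proof -
    have "{e \<in> E. src' e = tgt e} = insert e' {e \<in> E. src e = tgt e}" "e' \<notin> {e \<in> E. src e = tgt e}"
      using that e src tgt by auto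
    moreover have "(\<Prod>e | e \<in> E \<and> src e = tgt e. kron (s' e) (w' e)) = ?L src s w"
    proof (rule prod.cong)
      fix x assume "x \<in> {e \<in> E. src e = tgt e}"
      then have "x \<notin> {e1, e2}" using e src tgt by auto
      then show "kron (s' x) (w' x) = kron (s x) (w x)" using that(2) by simp
    qed simp
    ultimately show ?thesis using fin by simp
  qed
  have L1: "?L ?src1 ?s1 ?w1 = kron (s e2 / s e1) (w e2) * ?L src s w"
    using L[of ?src1 e2 ?s1 ?w1] e tgt by simp
  have L2: "?L ?src2 ?s2 ?w2 = kron (s e1 / s e2) (w e1) * ?L src s w"
    using L[of ?src2 e1 ?s2 ?w2] e tgt by simp
  \<comment> \<open>\<open>?h\<close> splits the joint flow of e1 and e2 into b e1 - n and n;
    \<open>?g\<close> moves the joint flow from e1 to e2, so that both new graphs are summed over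
    the same index set.\<close>
  let ?h = "\<lambda>p :: ('e \<Rightarrow> int) \<times> int. (fst p)(e1 := fst p e1 - snd p, e2 := snd p)"
  let ?g = "\<lambda>a :: 'e \<Rightarrow> int. a(e1 := 0, e2 := a e1)"
  have of1: "outflow E ?src1 tgt b = outflow E src tgt (?h (b, n))" for b :: "'e \<Rightarrow> int" and n
  proof -
    have "outflow E ?src1 tgt b = outflow E ?src1 tgt ((?h (b, n))(e1 := (?h (b, n)) e1 + (?h (b, n)) e2))"
      by (rule outflow_cong) (use e tgt in auto)
    also have "\<dots> = outflow E src tgt (?h (b, n))"
      by (rule outflow_absorb) (use fin e src tgt in auto)
    finally show ?thesis .
  qed
  have of2: "outflow E ?src2 tgt c = outflow E ?src1 tgt (c(e1 := c e2, e2 := 0))" for c :: "'e \<Rightarrow> int"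
  proof -
    let ?a = "c(e1 := 0)"
    have "outflow E ?src2 tgt c = outflow E ?src2 tgt (?a(e2 := ?a e2 + ?a e1))"
      by (rule outflow_cong) (use e tgt in auto)
    also have "\<dots> = outflow E src tgt ?a"
      by (rule outflow_absorb) (use fin e src tgt in auto)
    also have "?a = ?h (c(e1 := c e2, e2 := 0), c e2)"
      using e by (auto simp: fun_eq_iff)
    finally show ?thesis using of1 by metis
  qed
  have b1: "bij_betw ?h (flows E ?src1 tgt \<times> UNIV) (flows E src tgt)"
  proof (rule bij_betw_byWitness[of _ "\<lambda>a. (a(e1 := a e1 + a e2, e2 := 0), a e2)"])
    show "\<forall>p\<in>flows E ?src1 tgt \<times> UNIV. ((?h p)(e1 := ?h p e1 + ?h p e2, e2 := 0), ?h p e2) = p"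
      using e tgt by (auto simp: flows_def fun_eq_iff)
    show "\<forall>a\<in>flows E src tgt. ?h (a(e1 := a e1 + a e2, e2 := 0), a e2) = a"
      using e by (auto simp: fun_eq_iff)
    show "?h ` (flows E ?src1 tgt \<times> UNIV) \<subseteq> flows E src tgt"
    proof clarify
      fix b n assume b: "b \<in> flows E ?src1 tgt"
      have "?h (b, n) x = 0" if "x \<notin> E \<or> src x = tgt x" for x
      proof -
        have "x \<noteq> e1" "x \<noteq> e2" using that e src tgt by auto
        then show ?thesis using that b by (auto simp: flows_def)
      qed
      then show "?h (b, n) \<in> flows E src tgt"
        using b unfolding flows_def mem_Collect_eq of1[of b n] by blast
    qed
    show "(\<lambda>a. (a(e1 := a e1 + a e2, e2 := 0), a e2)) ` flows E src tgt \<subseteq> flows E ?src1 tgt \<times> UNIV"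
    proof (rule image_subsetI)
      fix a assume a: "a \<in> flows E src tgt"
      let ?b = "a(e1 := a e1 + a e2, e2 := 0)"
      have "?h (?b, a e2) = a" using e by (auto simp: fun_eq_iff)
      then have of: "outflow E ?src1 tgt ?b = outflow E src tgt a" using of1[of ?b "a e2"] by simp
      have "?b x = 0" if "x \<notin> E \<or> ?src1 x = tgt x" for x
        using that a e src tgt by (cases "x = e1"; cases "x = e2") (auto simp: flows_def)
      then have "?b \<in> flows E ?src1 tgt"
        using a unfolding flows_def mem_Collect_eq of by blast
      then show "(?b, a e2) \<in> flows E ?src1 tgt \<times> UNIV" by simp
    qed
  qed
  have b2: "bij_betw ?g (flows E ?src1 tgt) (flows E ?src2 tgt)"
  proof (rule bij_betw_byWitness[of _ "\<lambda>c. c(e1 := c e2, e2 := 0)"])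
    show "\<forall>a\<in>flows E ?src1 tgt. (?g a)(e1 := ?g a e2, e2 := 0) = a"
      using e tgt by (auto simp: flows_def fun_eq_iff)
    show "\<forall>c\<in>flows E ?src2 tgt. ?g (c(e1 := c e2, e2 := 0)) = c"
      using e tgt by (auto simp: flows_def fun_eq_iff)
    show "?g ` flows E ?src1 tgt \<subseteq> flows E ?src2 tgt"
    proof (rule image_subsetI)
      fix a assume a: "a \<in> flows E ?src1 tgt"
      have "(?g a)(e1 := ?g a e2, e2 := 0) = a"
        using a e tgt by (auto simp: flows_def fun_eq_iff)
      then have of: "outflow E ?src2 tgt (?g a) = outflow E ?src1 tgt a" using of2[of "?g a"] by simp
      have "?g a x = 0" if "x \<notin> E \<or> ?src2 x = tgt x" for x
        using that a e src tgt by (cases "x = e1"; cases "x = e2") (auto simp: flows_def)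
      then show "?g a \<in> flows E ?src2 tgt"
        using a unfolding flows_def mem_Collect_eq of by blast
    qed
    show "(\<lambda>c. c(e1 := c e2, e2 := 0)) ` flows E ?src2 tgt \<subseteq> flows E ?src1 tgt"
    proof (rule image_subsetI)
      fix c assume c: "c \<in> flows E ?src2 tgt"
      have "(c(e1 := c e2, e2 := 0)) x = 0" if "x \<notin> E \<or> ?src1 x = tgt x" for x
        using that c e src tgt by (cases "x = e1"; cases "x = e2") (auto simp: flows_def)
      then show "c(e1 := c e2, e2 := 0) \<in> flows E ?src1 tgt"
        using c unfolding flows_def mem_Collect_eq of2 by blast
    qed
  qed
  have R: "flow_weight r src tgt s w ?R (?h (b, n)) = flow_weight r src tgt s w ?R b"
    "flow_weight r ?src1 tgt ?s1 ?w1 ?R b = flow_weight r src tgt s w ?R b"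
    "flow_weight r ?src2 tgt ?s2 ?w2 ?R (?g b) = flow_weight r src tgt s w ?R b" for b n
    by (rule flow_weight_cong; auto)+
  have wt: "flow_weight r src tgt s w E (?h (b, n))
      = flow_weight r src tgt s w ?R b * (phi (s e1) (w e1) ?\<delta> (b e1 - n) * phi (s e2) (w e2) ?\<delta> n)" for b n
    unfolding flow_weight_split[OF fin e] R using e src tgt by (simp add: mult_ac)
  have wt1: "flow_weight r ?src1 tgt ?s1 ?w1 E b = flow_weight r src tgt s w ?R b * phi (s e1) W ?\<delta> (b e1)" for b
    unfolding flow_weight_split[OF fin e] R using e src tgt by (simp add: mult_ac)
  have wt2: "flow_weight r ?src2 tgt ?s2 ?w2 E (?g b) = flow_weight r src tgt s w ?R b * phi (s e2) W ?\<delta> (b e1)" for b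
    unfolding flow_weight_split[OF fin e] R using e src tgt by (simp add: mult_ac)
  have "q_summable (flows E src tgt) (flow_weight r src tgt s w E)"
    by (rule q_summable_flow_weight[OF fin]) (use r in auto)
  then have sum0: "q_summable (flows E ?src1 tgt \<times> UNIV) (\<lambda>p. flow_weight r src tgt s w E (?h p))"
    unfolding q_summable_reindex[OF b1] .
  have sum1: "q_summable (flows E ?src1 tgt) (flow_weight r ?src1 tgt ?s1 ?w1 E)"
    by (rule q_summable_flow_weight[OF fin]) (use r tgt in \<open>auto split: if_splits\<close>)
  have sum2: "q_summable (flows E ?src1 tgt) (\<lambda>b. flow_weight r ?src2 tgt ?s2 ?w2 E (?g b))"
    unfolding q_summable_reindex[OF b2, symmetric]
    by (rule q_summable_flow_weight[OF fin]) (use r tgt in \<open>auto split: if_splits\<close>)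
  have sumn: "q_summable UNIV (\<lambda>n. phi (s e1) (w e1) ?\<delta> (b - n) * phi (s e2) (w e2) ?\<delta> n)" for b
  proof (rule q_summableI_bound)
    fix m n assume "(phi (s e1) (w e1) ?\<delta> (b - n) * phi (s e2) (w e2) ?\<delta> n) $ m \<noteq> 0"
    then have "\<exists>l\<in>{0..m}. phi (s e1) (w e1) ?\<delta> (b - n) $ l * phi (s e2) (w e2) ?\<delta> n $ (m - l) \<noteq> 0"
      unfolding fps_mult_nth by (meson sum.neutral)
    then obtain l where l: "l \<le> m" "phi (s e1) (w e1) ?\<delta> (b - n) $ l \<noteq> 0" "phi (s e2) (w e2) ?\<delta> n $ (m - l) \<noteq> 0"
      by auto
    from phi_nth_nonzero[OF l(2)] phi_nth_nonzero[OF l(3)] l(1)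
    show "n \<in> {- int m - \<bar>b\<bar>..int m + \<bar>b\<bar>}" by (auto split: if_splits)
  qed auto
  have "q_sum (flows E src tgt) (flow_weight r src tgt s w E)
      = q_sum (flows E ?src1 tgt \<times> UNIV) (\<lambda>p. flow_weight r src tgt s w E (?h p))"
    by (rule q_sum_reindex[OF b1])
  also have "\<dots> = q_sum (flows E ?src1 tgt) (\<lambda>b. q_sum UNIV (\<lambda>n. flow_weight r src tgt s w E (?h (b, n))))"
    by (rule q_sum_Sigma[OF sum0])
  also have "\<dots> = q_sum (flows E ?src1 tgt)
      (\<lambda>b. kron (s e2 / s e1) (w e2) * flow_weight r ?src1 tgt ?s1 ?w1 E b
        + kron (s e1 / s e2) (w e1) * flow_weight r ?src2 tgt ?s2 ?w2 E (?g b))"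
  proof (rule q_sum_cong)
    fix b assume "b \<in> flows E ?src1 tgt"
    show "q_sum UNIV (\<lambda>n. flow_weight r src tgt s w E (?h (b, n)))
      = kron (s e2 / s e1) (w e2) * flow_weight r ?src1 tgt ?s1 ?w1 E b
        + kron (s e1 / s e2) (w e1) * flow_weight r ?src2 tgt ?s2 ?w2 E (?g b)"
      unfolding wt wt1 wt2 q_sum_mult_left[OF sumn] q_sum_phi_convolution[OF s w] W_def[symmetric]
      by (simp add: algebra_simps)
  qed
  also have "\<dots> = kron (s e2 / s e1) (w e2) * q_sum (flows E ?src1 tgt) (flow_weight r ?src1 tgt ?s1 ?w1 E)
      + kron (s e1 / s e2) (w e1) * q_sum (flows E ?src1 tgt) (\<lambda>b. flow_weight r ?src2 tgt ?s2 ?w2 E (?g b))"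
    by (simp only: q_sum_add[OF q_summable_mult_left[OF sum1] q_summable_mult_left[OF sum2]]
        q_sum_mult_left[OF sum1] q_sum_mult_left[OF sum2])
  also have "q_sum (flows E ?src1 tgt) (\<lambda>b. flow_weight r ?src2 tgt ?s2 ?w2 E (?g b))
      = q_sum (flows E ?src2 tgt) (flow_weight r ?src2 tgt ?s2 ?w2 E)"
    by (rule q_sum_reindex[OF b2, symmetric])
  finally show ?thesis
    unfolding flow_sum_def W_def[symmetric] L1 L2 by (simp only: distrib_left mult_ac)
qed

lemma flow_sum_fay:
  fixes s w :: "'e \<Rightarrow> 'k::field"
  assumes fin: "finite E" and e: "e1 \<in> E" "e2 \<in> E" "e1 \<noteq> e2" and src: "src e1 = src e2"
    and tgt: "tgt e1 \<noteq> src e1" "tgt e2 \<noteq> src e1"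
    and r: "inj_on r V" "\<And>e. e \<in> E \<Longrightarrow> src e \<noteq> tgt e \<Longrightarrow> src e \<in> V \<and> tgt e \<in> V"
    and s: "s e1 \<noteq> 0" "s e2 \<noteq> 0" "s e1 \<noteq> s e2"
    and w: "w e1 \<noteq> 0" "w e2 \<noteq> 0" "w e1 \<noteq> 1" "w e2 \<noteq> 1" "w e1 * w e2 \<noteq> 1"
  shows "flow_sum r src tgt s w E
    = flow_sum r (src(e2 := tgt e1)) tgt (s(e2 := s e2 / s e1)) (w(e1 := w e1 * w e2)) E
      + flow_sum r (src(e1 := tgt e2)) tgt (s(e1 := s e1 / s e2)) (w(e2 := w e1 * w e2)) E"
proof (cases "tgt e1 = tgt e2")
  case True
  show ?thesis
    by (rule flow_sum_fay_parallel[OF fin e src tgt(1) True _ s w]) (meson inj_onD r)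
next
  case False
  have "tgt e1 \<in> V" "tgt e2 \<in> V" using r(2)[OF e(1)] r(2)[OF e(2)] src tgt by auto
  then have "r (tgt e1) \<noteq> r (tgt e2)" using False r(1) by (meson inj_onD)
  then show ?thesis
    by (intro flow_sum_fay_distinct[OF fin e src tgt False _ _ s(1,2) w]) (meson inj_onD r)
qed

lemma flow_sum_flip:
  fixes s w :: "'e \<Rightarrow> 'k::field"
  assumes fin: "finite E" and e: "e \<in> E" "src e \<noteq> tgt e"
    and r: "r (src e) \<noteq> r (tgt e)"
    and s: "s e \<noteq> 0" and w: "w e \<noteq> 0" "w e \<noteq> 1"
  shows "flow_sum r (src(e := tgt e)) (tgt(e := src e)) (s(e := inverse (s e))) (w(e := inverse (w e))) E
    = - flow_sum r src tgt s w E"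
proof -
  let ?src = "src(e := tgt e)" and ?tgt = "tgt(e := src e)"
  let ?s = "s(e := inverse (s e))" and ?w = "w(e := inverse (w e))"
  let ?h = "\<lambda>a :: 'e \<Rightarrow> int. a(e := - a e)"
  have L: "(\<Prod>x | x \<in> E \<and> ?src x = ?tgt x. kron (?s x) (?w x)) = (\<Prod>x | x \<in> E \<and> src x = tgt x. kron (s x) (w x))"
    by (rule prod.cong) (use e in auto)
  have of: "outflow E ?src ?tgt (?h a) = outflow E src tgt a" for a :: "'e \<Rightarrow> int"
    unfolding outflow_def by (intro ext sum.cong refl) auto
  have mem: "?h a \<in> flows E ?src ?tgt \<longleftrightarrow> a \<in> flows E src tgt" for a
    unfolding flows_def mem_Collect_eq of using e by auto
  have b: "bij_betw ?h (flows E src tgt) (flows E ?src ?tgt)"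
  proof (rule bij_betw_byWitness[of _ ?h])
    show "?h ` flows E src tgt \<subseteq> flows E ?src ?tgt" using mem by blast
    show "?h ` flows E ?src ?tgt \<subseteq> flows E src tgt"
    proof clarify
      fix a assume "a \<in> flows E ?src ?tgt"
      then show "?h a \<in> flows E src tgt" using mem[of "?h a"] by simp
    qed
  qed auto
  have wt: "flow_weight r ?src ?tgt ?s ?w E (?h a) = (- 1) * flow_weight r src tgt s w E a" for a
  proof -
    let ?N = "{x \<in> E. src x \<noteq> tgt x}"
    have N: "{x \<in> E. ?src x \<noteq> ?tgt x} = ?N" using e by auto
    have fN: "finite ?N" "e \<in> ?N" using fin e by auto
    have "phi (inverse (s e)) (inverse (w e)) (\<not> r (tgt e) < r (src e)) (- a e)
        = - phi (s e) (w e) (r (tgt e) < r (src e)) (a e)"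
      by (rule phi_flip) (use s w in auto)
    moreover have "(\<not> r (tgt e) < r (src e)) = (r (src e) < r (tgt e))" using r by auto
    ultimately show ?thesis
      unfolding flow_weight_def N prod.remove[OF fN] by (auto intro!: prod.cong)
  qed
  have "q_sum (flows E ?src ?tgt) (flow_weight r ?src ?tgt ?s ?w E)
      = q_sum (flows E src tgt) (\<lambda>a. (- 1) * flow_weight r src tgt s w E a)"
    unfolding q_sum_reindex[OF b] wt ..
  also have "\<dots> = - q_sum (flows E src tgt) (flow_weight r src tgt s w E)"
  proof (cases "\<forall>e\<in>E. src e \<noteq> tgt e \<longrightarrow> r (src e) \<noteq> r (tgt e)")
    case True
    then show ?thesis by (subst q_sum_mult_left[OF q_summable_flow_weight[OF fin]]) auto
  next
    case False
    show ?thesis by (rule fps_ext) (simp add: q_sum_nth sum_negf)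
  qed
  finally show ?thesis unfolding flow_sum_def L by simp
qed

text \<open>Conservation at the source forces the flow of a leaf edge to vanish, leaving
  \<open>phi\<close> at exponent 0. Its value, 1 / (1 - w) or w / (1 - w) depending on the order, is
  the inhomogeneous factor that \<open>ordered_sum_leaf\<close> averages away.\<close>

lemma flow_sum_leaf:
  fixes s w :: "'e \<Rightarrow> 'k::field"
  assumes fin: "finite E" and e: "e \<in> E" "src e \<noteq> tgt e"
    and leaf: "\<And>x. x \<in> E - {e} \<Longrightarrow> src x \<noteq> tgt x \<Longrightarrow> src x \<noteq> src e \<and> tgt x \<noteq> src e"
    and w: "w e \<noteq> 1"
    and r: "\<And>e. e \<in> E \<Longrightarrow> src e \<noteq> tgt e \<Longrightarrow> r (src e) \<noteq> r (tgt e)"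
  shows "flow_sum r src tgt s w E
    = fps_const ((if r (tgt e) < r (src e) then w e else 1) / (1 - w e)) * flow_sum r src tgt s w (E - {e})"
proof -
  have a0: "a e = 0" if "a \<in> flows E src tgt" for a
  proof -
    have "0 = outflow E src tgt a (src e)" using that by (simp add: flows_def)
    also have "\<dots> = a e + (\<Sum>x\<in>E - {e}. (of_bool (src x = src e) - of_bool (tgt x = src e)) * a x)"
      unfolding outflow_def using fin e by (subst sum.remove[of _ e]) auto
    also have "(\<Sum>x\<in>E - {e}. (of_bool (src x = src e) - of_bool (tgt x = src e)) * a x) = 0"
    proof (rule sum.neutral, rule ballI)
      fix x assume "x \<in> E - {e}"
      then show "(of_bool (src x = src e) - of_bool (tgt x = src e)) * a x = 0"
        using leaf[of x] by (cases "src x = tgt x") auto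
    qed
    finally show ?thesis by simp
  qed
  have of: "outflow E src tgt a = outflow (E - {e}) src tgt a" if "a e = 0" for a :: "'e \<Rightarrow> int"
    unfolding outflow_def using fin e that by (intro ext, subst sum.remove[of _ e]) auto
  have flows: "flows E src tgt = flows (E - {e}) src tgt"
  proof (intro equalityI subsetI)
    fix a assume a: "a \<in> flows E src tgt"
    then show "a \<in> flows (E - {e}) src tgt" using a0[OF a] of[of a] by (auto simp: flows_def)
  next
    fix a assume a: "a \<in> flows (E - {e}) src tgt"
    then have "a e = 0" by (auto simp: flows_def)
    then show "a \<in> flows E src tgt" using a of[of a] by (auto simp: flows_def)
  qed
  let ?c = "fps_const ((if r (tgt e) < r (src e) then w e else 1) / (1 - w e))"
  have N: "{x \<in> E. src x \<noteq> tgt x} = insert e {x \<in> E - {e}. src x \<noteq> tgt x}" using e by auto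
  have L: "{x \<in> E. src x = tgt x} = {x \<in> E - {e}. src x = tgt x}" using e by auto
  have "phi (s e) (w e) (r (tgt e) < r (src e)) 0 = ?c"
  proof -
    have "fps_const (inverse (1 - w e)) - 1 = fps_const (w e / (1 - w e))"
      using w by (simp add: field_simps flip: fps_const_1_eq_1)
    then show ?thesis by (simp add: phi_def kap_0 inverse_eq_divide)
  qed
  then have wt: "flow_weight r src tgt s w E a = ?c * flow_weight r src tgt s w (E - {e}) a"
    if "a \<in> flows E src tgt" for a
    unfolding flow_weight_def N using fin a0[OF that] by (subst prod.insert) auto
  have "q_sum (flows E src tgt) (flow_weight r src tgt s w E)
      = q_sum (flows (E - {e}) src tgt) (\<lambda>a. ?c * flow_weight r src tgt s w (E - {e}) a)"
    unfolding flows[symmetric] by (rule q_sum_cong) (rule wt)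
  also have "\<dots> = ?c * q_sum (flows (E - {e}) src tgt) (flow_weight r src tgt s w (E - {e}))"
    by (rule q_sum_mult_left[OF q_summable_flow_weight]) (use fin r in auto)
  finally show ?thesis unfolding flow_sum_def L by (simp add: mult_ac)
qed

section \<open>Simplex integrals\<close>

text \<open>
  The integral of \<open>\<Prod>v. exp (u v * t v)\<close> over the simplex \<open>\<epsilon> \<ge> t x\<^sub>1 \<ge> \<dots> \<ge> t x\<^sub>n \<ge> 0\<close>,
  as a power series in \<open>\<epsilon>\<close>.
\<close>

fun simplex_exp :: "('v \<Rightarrow> 'a::field_char_0) \<Rightarrow> 'v list \<Rightarrow> 'a fps" where
  "simplex_exp u [] = 1"
| "simplex_exp u (v # xs) = fps_integral0 (fps_exp (u v) * simplex_exp u xs)"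

definition insert_at :: "nat \<Rightarrow> 'v \<Rightarrow> 'v list \<Rightarrow> 'v list" where
  "insert_at i v xs = take i xs @ v # drop i xs"

lemma insert_at_0 [simp]: "insert_at 0 v xs = v # xs"
  by (simp add: insert_at_def)

lemma insert_at_Suc_Cons [simp]: "insert_at (Suc i) v (x # xs) = x # insert_at i v xs"
  by (simp add: insert_at_def)

lemma simplex_exp_deriv_Cons [simp]:
  "fps_deriv (simplex_exp u (v # xs)) = fps_exp (u v) * simplex_exp u xs"
  by (simp add: fps_deriv_fps_integral)

lemma simplex_exp_nth_0: "xs \<noteq> [] \<Longrightarrow> simplex_exp u xs $ 0 = 0"
  by (cases xs) auto

lemma simplex_exp_cong: "(\<And>x. x \<in> set xs \<Longrightarrow> u x = u' x) \<Longrightarrow> simplex_exp u xs = simplex_exp u' xs"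
  by (induction xs) auto

lemma fps_eqI_deriv:
  fixes f g :: "'a::field_char_0 fps"
  assumes "fps_deriv f = fps_deriv g" "f $ 0 = g $ 0"
  shows "f = g"
  using assms fps_deriv_eq_iff[of f g] by simp

lemma sum_atMost_length_Cons:
  "(\<Sum>i\<le>length (x # xs). f (insert_at i v (x # xs))) = f (v # x # xs) + (\<Sum>i\<le>length xs. f (x # insert_at i v xs))"
  by (simp add: sum.atMost_Suc_shift del: sum.atMost_Suc)

lemma sum_simplex_exp_insert_nth_0: "(\<Sum>i\<in>I. simplex_exp u (insert_at i v xs)) $ 0 = 0"
  by (simp add: fps_sum_nth simplex_exp_nth_0 insert_at_def)

text \<open>The possible positions of v cut the product of an interval and a simplex into simplices.
  The proof compares derivatives in \<epsilon>.\<close>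

lemma simplex_exp_shuffle:
  "(\<Sum>i\<le>length xs. simplex_exp u (insert_at i v xs)) = simplex_exp u [v] * simplex_exp u xs"
proof (induction xs)
  case (Cons x xs)
  show ?case
  proof (rule fps_eqI_deriv)
    show "fps_deriv (\<Sum>i\<le>length (x # xs). simplex_exp u (insert_at i v (x # xs)))
        = fps_deriv (simplex_exp u [v] * simplex_exp u (x # xs))"
      unfolding sum_atMost_length_Cons fps_deriv_add fps_deriv_sum fps_deriv_mult simplex_exp_deriv_Cons
        sum_distrib_left[symmetric] Cons.IH
      by (simp add: algebra_simps)
  qed (simp only: sum_simplex_exp_insert_nth_0, simp)
qed simp

text \<open>Placing v before j means \<open>t v \<ge> t j\<close>, and \<open>u v\<close> times the
  integral of \<open>exp (u v * t)\<close> from \<open>t j\<close> to \<epsilon> is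
  \<open>exp (u v * \<epsilon>) - exp (u v * t j)\<close>. The second term is absorbed into the
  exponent of j.\<close>

lemma simplex_exp_insert_before:
  assumes "distinct (ys @ j # zs)"
  shows "fps_const (u v) * (\<Sum>i\<le>length ys. simplex_exp u (insert_at i v (ys @ j # zs)))
    = fps_exp (u v) * simplex_exp u (ys @ j # zs) - simplex_exp (u(j := u j + u v)) (ys @ j # zs)"
  using assms
proof (induction ys)
  case Nil
  have eq: "simplex_exp (u(j := u j + u v)) zs = simplex_exp u zs"
    by (rule simplex_exp_cong) (use Nil in auto)
  show ?case
  proof (rule fps_eqI_deriv)
    show "fps_deriv (fps_const (u v) * (\<Sum>i\<le>length []. simplex_exp u (insert_at i v ([] @ j # zs))))
        = fps_deriv (fps_exp (u v) * simplex_exp u ([] @ j # zs) - simplex_exp (u(j := u j + u v)) ([] @ j # zs))"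
      by (simp add: eq fps_deriv_fps_integral fps_exp_add_mult algebra_simps)
  qed simp
next
  case (Cons x ys)
  have x: "x \<noteq> j" using Cons.prems by auto
  show ?case
  proof (rule fps_eqI_deriv)
    let ?S = "\<Sum>i\<le>length ys. simplex_exp u (insert_at i v (ys @ j # zs))"
    have S: "(\<Sum>i\<le>length (x # ys). simplex_exp u (insert_at i v ((x # ys) @ j # zs)))
        = simplex_exp u (v # x # ys @ j # zs) + (\<Sum>i\<le>length ys. simplex_exp u (x # insert_at i v (ys @ j # zs)))"
      by (simp add: sum.atMost_Suc_shift del: sum.atMost_Suc simplex_exp.simps)
    have "fps_deriv (fps_const (u v) * (\<Sum>i\<le>length (x # ys). simplex_exp u (insert_at i v ((x # ys) @ j # zs))))
        = fps_const (u v) * (fps_exp (u v) * simplex_exp u (x # ys @ j # zs)) + fps_exp (u x) * (fps_const (u v) * ?S)"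
      unfolding S fps_deriv_add fps_deriv_sum fps_deriv_mult simplex_exp_deriv_Cons
        sum_distrib_left[symmetric] by (simp add: algebra_simps)
    also have "fps_const (u v) * ?S = fps_exp (u v) * simplex_exp u (ys @ j # zs) - simplex_exp (u(j := u j + u v)) (ys @ j # zs)"
      by (rule Cons.IH) (use Cons.prems in simp)
    finally show "fps_deriv (fps_const (u v) * (\<Sum>i\<le>length (x # ys). simplex_exp u (insert_at i v ((x # ys) @ j # zs))))
        = fps_deriv (fps_exp (u v) * simplex_exp u ((x # ys) @ j # zs) - simplex_exp (u(j := u j + u v)) ((x # ys) @ j # zs))"
      using x by (simp add: fps_deriv_fps_integral algebra_simps)
    show "(fps_const (u v) * (\<Sum>i\<le>length (x # ys). simplex_exp u (insert_at i v ((x # ys) @ j # zs)))) $ 0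
      = (fps_exp (u v) * simplex_exp u ((x # ys) @ j # zs) - simplex_exp (u(j := u j + u v)) ((x # ys) @ j # zs)) $ 0"
      by (simp only: fps_mult_nth_0 fps_sub_nth sum_simplex_exp_insert_nth_0) simp
  qed
qed

lemma simplex_exp_single: "fps_const (u v) * simplex_exp u [v] = fps_exp (u v) - 1"
  by (rule fps_eqI_deriv) (simp_all add: fps_deriv_fps_integral)

text \<open>Write u for \<open>u v\<close>, t for \<open>t j\<close> and w for exp(u \<epsilon>).
  The two ranges of \<open>t v\<close> give (w - exp(u t)) + w (exp(u t) - 1) = (w - 1) exp(u t),
  and the last exponential raises the exponent of j. The weights 1 and w are the numerators in
  \<open>flow_sum_leaf\<close>, and w - 1 is there to cancel its denominator.\<close>

lemma simplex_exp_insert: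
  assumes "distinct (ys @ j # zs)"
  shows "fps_const (u v) * (\<Sum>i\<le>length (ys @ j # zs).
      (if length ys < i then fps_exp (u v) else 1) * simplex_exp u (insert_at i v (ys @ j # zs)))
    = (fps_exp (u v) - 1) * simplex_exp (u(j := u j + u v)) (ys @ j # zs)"
proof -
  let ?xs = "ys @ j # zs" and ?e = "fps_exp (u v)" and ?f = "\<lambda>i. simplex_exp u (insert_at i v (ys @ j # zs))"
  have A: "fps_const (u v) * (\<Sum>i\<le>length ys. ?f i) = ?e * simplex_exp u ?xs - simplex_exp (u(j := u j + u v)) ?xs"
    by (rule simplex_exp_insert_before[OF assms])
  have split: "(\<Sum>i\<le>length ?xs. g i) = (\<Sum>i\<le>length ys. g i) + (\<Sum>i\<in>{length ys<..length ?xs}. g i)"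
    for g :: "nat \<Rightarrow> 'b fps"
  proof -
    have "{..length ?xs} = {..length ys} \<union> {length ys<..length ?xs}" by auto
    then show ?thesis by (simp only:) (rule sum.union_disjoint, auto)
  qed
  have "(\<Sum>i\<le>length ?xs. (if length ys < i then ?e else 1) * ?f i)
      = (\<Sum>i\<le>length ys. ?f i) + ?e * (\<Sum>i\<in>{length ys<..length ?xs}. ?f i)"
    unfolding split by (simp add: sum_distrib_left)
  also have "(\<Sum>i\<in>{length ys<..length ?xs}. ?f i) = simplex_exp u [v] * simplex_exp u ?xs - (\<Sum>i\<le>length ys. ?f i)"
    using simplex_exp_shuffle[where xs = ?xs and u = u and v = v] split[of ?f] by simp
  also have "fps_const (u v) * ((\<Sum>i\<le>length ys. ?f i) + ?e * (simplex_exp u [v] * simplex_exp u ?xs - (\<Sum>i\<le>length ys. ?f i)))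
      = fps_const (u v) * (\<Sum>i\<le>length ys. ?f i) * (1 - ?e) + ?e * (fps_const (u v) * simplex_exp u [v]) * simplex_exp u ?xs"
    by (simp only: algebra_simps mult_1_left)
  finally show ?thesis unfolding A simplex_exp_single by (simp add: algebra_simps)
qed

section \<open>Positions in a list, and insertion of one vertex\<close>

definition list_pos :: "'v list \<Rightarrow> 'v \<Rightarrow> nat" where
  "list_pos xs x = length (takeWhile (\<lambda>y. y \<noteq> x) xs)"

lemma list_pos_less: "x \<in> set xs \<Longrightarrow> list_pos xs x < length xs"
  by (induction xs) (auto simp: list_pos_def)

lemma nth_list_pos: "x \<in> set xs \<Longrightarrow> xs ! list_pos xs x = x"
  by (induction xs) (auto simp: list_pos_def)

lemma inj_on_list_pos: "inj_on (list_pos xs) (set xs)"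
  by (metis inj_onI nth_list_pos)

lemma list_pos_append: "list_pos (ys @ zs) x = (if x \<in> set ys then list_pos ys x else length ys + list_pos zs x)"
  by (induction ys) (auto simp: list_pos_def)

lemma list_pos_Cons: "list_pos (y # ys) x = (if x = y then 0 else Suc (list_pos ys x))"
  by (auto simp: list_pos_def)

lemma list_pos_insert_at:
  assumes "v \<notin> set xs" "i \<le> length xs" "x \<in> set xs"
  shows "list_pos (insert_at i v xs) x = (if list_pos xs x < i then list_pos xs x else Suc (list_pos xs x))"
proof -
  have xs: "xs = take i xs @ drop i xs" by simp
  have "x \<noteq> v" using assms by auto
  have len: "length (take i xs) = i" using assms by simp
  have "list_pos xs x = list_pos (take i xs @ drop i xs) x" by simp
  also have "\<dots> = (if x \<in> set (take i xs) then list_pos (take i xs) x else i + list_pos (drop i xs) x)"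
    using len by (simp only: list_pos_append)
  finally have "list_pos xs x = (if x \<in> set (take i xs) then list_pos (take i xs) x else i + list_pos (drop i xs) x)" .
  moreover have "list_pos (insert_at i v xs) x
      = (if x \<in> set (take i xs) then list_pos (take i xs) x else Suc (i + list_pos (drop i xs) x))"
    unfolding insert_at_def list_pos_append list_pos_Cons using \<open>x \<noteq> v\<close> len by simp
  moreover have "x \<in> set (take i xs) \<Longrightarrow> list_pos (take i xs) x < i"
    using list_pos_less[of x "take i xs"] len by simp
  ultimately show ?thesis by auto
qed

lemma list_pos_insert_at_self:
  assumes "v \<notin> set xs" "i \<le> length xs"
  shows "list_pos (insert_at i v xs) v = i"
proof -
  have "v \<notin> set (take i xs)" using assms(1) by (meson in_set_takeD)
  then show ?thesis using assms by (simp add: insert_at_def list_pos_append list_pos_Cons)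
qed

lemma set_insert_at [simp]: "set (insert_at i v xs) = insert v (set xs)"
  by (metis append_take_drop_id insert_at_def insert_is_Un list.simps(15) set_append sup_left_commute)

lemma distinct_insert_at:
  assumes "v \<notin> set xs" "distinct xs"
  shows "distinct (insert_at i v xs)"
proof -
  have "set (take i xs) \<inter> set (drop i xs) = {}"
    using assms(2) by (metis append_take_drop_id distinct_append)
  then show ?thesis using assms by (auto simp: insert_at_def dest: in_set_takeD in_set_dropD)
qed

lemma sum_permutations_of_set_insert:
  assumes "finite V" "v \<notin> V"
  shows "(\<Sum>xs\<in>permutations_of_set (insert v V). f xs)
    = (\<Sum>xs\<in>permutations_of_set V. \<Sum>i\<le>length xs. f (insert_at i v xs))"
proof -
  let ?S = "Sigma (permutations_of_set V) (\<lambda>xs. {..length xs})"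
  have bij: "bij_betw (\<lambda>(xs, i). insert_at i v xs) ?S (permutations_of_set (insert v V))"
  proof (rule bij_betw_byWitness[of _ "\<lambda>xs. (remove1 v xs, list_pos xs v)"])
    have r: "remove1 v (insert_at i v xs) = xs" if "v \<notin> set xs" for xs i
    proof -
      have "v \<notin> set (take i xs)" using that by (meson in_set_takeD)
      then show ?thesis by (simp add: insert_at_def remove1_append)
    qed
    show "\<forall>p\<in>?S. (remove1 v ((\<lambda>(xs, i). insert_at i v xs) p), list_pos ((\<lambda>(xs, i). insert_at i v xs) p) v) = p"
      using assms(2) by (auto simp: permutations_of_set_def r list_pos_insert_at_self)
    have decomp: "\<exists>ys zs. xs = ys @ v # zs \<and> v \<notin> set ys \<and> v \<notin> set zs"
      if "xs \<in> permutations_of_set (insert v V)" for xs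
    proof -
      have "v \<in> set xs" "distinct xs" using that by (auto simp: permutations_of_set_def)
      then show ?thesis by (metis distinct.simps(2) distinct_append split_list_first)
    qed
    show "\<forall>xs\<in>permutations_of_set (insert v V).
        (\<lambda>(xs, i). insert_at i v xs) (remove1 v xs, list_pos xs v) = xs"
    proof
      fix xs assume "xs \<in> permutations_of_set (insert v V)"
      then obtain ys zs where "xs = ys @ v # zs" "v \<notin> set ys" "v \<notin> set zs" using decomp by blast
      then show "(\<lambda>(xs, i). insert_at i v xs) (remove1 v xs, list_pos xs v) = xs"
        by (simp add: remove1_append list_pos_append list_pos_Cons insert_at_def)
    qed
    show "(\<lambda>(xs, i). insert_at i v xs) ` ?S \<subseteq> permutations_of_set (insert v V)"
      using assms(2) by (auto simp: permutations_of_set_def distinct_insert_at)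
    show "(\<lambda>xs. (remove1 v xs, list_pos xs v)) ` permutations_of_set (insert v V) \<subseteq> ?S"
    proof (rule image_subsetI)
      fix xs assume xs: "xs \<in> permutations_of_set (insert v V)"
      then obtain ys zs where yz: "xs = ys @ v # zs" "v \<notin> set ys" "v \<notin> set zs" using decomp by blast
      have "distinct xs" "set xs = insert v V" using xs by (auto simp: permutations_of_set_def)
      then have "ys @ zs \<in> permutations_of_set V"
        using yz assms(2) by (auto simp: permutations_of_set_def)
      then show "(remove1 v xs, list_pos xs v) \<in> ?S"
        using yz by (simp add: remove1_append list_pos_append list_pos_Cons)
    qed
  qed
  have "(\<Sum>xs\<in>permutations_of_set (insert v V). f xs) = (\<Sum>p\<in>?S. f ((\<lambda>(xs, i). insert_at i v xs) p))"
    by (rule sum.reindex_bij_betw[OF bij, symmetric])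
  also have "\<dots> = (\<Sum>xs\<in>permutations_of_set V. \<Sum>i\<le>length xs. f (insert_at i v xs))"
    by (subst sum.Sigma) (use assms in \<open>auto simp: split_def\<close>)
  finally show ?thesis .
qed

section \<open>Homogeneous families of quasimodular forms\<close>

notation fls_nth (infixl "$$" 75)

section \<open>The graded algebra generated by E2, E4 and E6\<close>

lemma finite_weight_indices: "finite {(i, j, k). 2 * i + 4 * j + 6 * k = (w :: nat)}"
  by (rule finite_subset[of _ "{..w} \<times> {..w} \<times> {..w}"]) auto

lemma quasimodular_form_0: "quasimodular_form w 0"
  unfolding quasimodular_form_def by (intro exI[of _ "\<lambda>_ _ _. 0"]) simp

lemma quasimodular_form_add:
  assumes "quasimodular_form w f" "quasimodular_form w g"
  shows "quasimodular_form w (f + g)"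
proof -
  obtain c d where
    "f = (\<Sum>(i, j, k) | 2 * i + 4 * j + 6 * k = w. fps_const (c i j k) * E2 ^ i * E4 ^ j * E6 ^ k)"
    "g = (\<Sum>(i, j, k) | 2 * i + 4 * j + 6 * k = w. fps_const (d i j k) * E2 ^ i * E4 ^ j * E6 ^ k)"
    using assms unfolding quasimodular_form_def by blast
  then show ?thesis unfolding quasimodular_form_def
    by (intro exI[of _ "\<lambda>i j k. c i j k + d i j k"])
       (simp add: split_def sum.distrib distrib_right flip: fps_const_add)
qed

lemma quasimodular_form_const_mult:
  assumes "quasimodular_form w f"
  shows "quasimodular_form w (fps_const x * f)"
proof -
  obtain c where
    "f = (\<Sum>(i, j, k) | 2 * i + 4 * j + 6 * k = w. fps_const (c i j k) * E2 ^ i * E4 ^ j * E6 ^ k)"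
    using assms unfolding quasimodular_form_def by blast
  then show ?thesis unfolding quasimodular_form_def
    by (intro exI[of _ "\<lambda>i j k. x * c i j k"])
       (simp add: sum_distrib_left split_def mult.assoc flip: fps_const_mult)
qed

lemma quasimodular_form_sum:
  "(\<And>x. x \<in> A \<Longrightarrow> quasimodular_form w (f x)) \<Longrightarrow> quasimodular_form w (sum f A)"
  by (induction A rule: infinite_finite_induct) (auto intro: quasimodular_form_0 quasimodular_form_add)

lemma quasimodular_form_uminus: "quasimodular_form w f \<Longrightarrow> quasimodular_form w (- f)"
  using quasimodular_form_const_mult[of w f "- 1"] by (simp flip: fps_const_neg)

lemma quasimodular_form_diff:
  "quasimodular_form w f \<Longrightarrow> quasimodular_form w g \<Longrightarrow> quasimodular_form w (f - g)"
  using quasimodular_form_add[of w f "- g"] quasimodular_form_uminus by simp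

lemma quasimodular_form_monomial:
  "quasimodular_form (2 * i + 4 * j + 6 * k) (E2 ^ i * E4 ^ j * E6 ^ k)"
proof -
  let ?c = "\<lambda>i' j' k'. of_bool ((i', j', k') = (i, j, k)) :: rat"
  have "(\<Sum>(i', j', k') | 2 * i' + 4 * j' + 6 * k' = 2 * i + 4 * j + 6 * k.
      fps_const (?c i' j' k') * E2 ^ i' * E4 ^ j' * E6 ^ k')
      = (\<Sum>(i', j', k') \<in> {(i, j, k)}. fps_const (?c i' j' k') * E2 ^ i' * E4 ^ j' * E6 ^ k')"
    by (rule sum.mono_neutral_right[OF finite_weight_indices]) auto
  also have "\<dots> = E2 ^ i * E4 ^ j * E6 ^ k" by simp
  finally show ?thesis unfolding quasimodular_form_def by (intro exI[of _ ?c]) (rule sym)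
qed

lemma quasimodular_form_mult:
  assumes "quasimodular_form v f" "quasimodular_form w g"
  shows "quasimodular_form (v + w) (f * g)"
proof -
  obtain c d where fg:
    "f = (\<Sum>(i, j, k) | 2 * i + 4 * j + 6 * k = v. fps_const (c i j k) * E2 ^ i * E4 ^ j * E6 ^ k)"
    "g = (\<Sum>(i, j, k) | 2 * i + 4 * j + 6 * k = w. fps_const (d i j k) * E2 ^ i * E4 ^ j * E6 ^ k)"
    using assms unfolding quasimodular_form_def by blast
  have "quasimodular_form (v + w) ((fps_const c * E2 ^ i * E4 ^ j * E6 ^ k) * (fps_const d * E2 ^ i' * E4 ^ j' * E6 ^ k'))"
    if "2 * i + 4 * j + 6 * k = v" "2 * i' + 4 * j' + 6 * k' = w" for c d i j k i' j' k'
  proof -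
    have "quasimodular_form (2 * (i + i') + 4 * (j + j') + 6 * (k + k'))
        (fps_const (c * d) * (E2 ^ (i + i') * E4 ^ (j + j') * E6 ^ (k + k')))"
      by (intro quasimodular_form_const_mult quasimodular_form_monomial)
    moreover have "2 * (i + i') + 4 * (j + j') + 6 * (k + k') = v + w" using that by simp
    ultimately show ?thesis by (simp add: power_add mult_ac flip: fps_const_mult)
  qed
  then show ?thesis unfolding fg sum_product
    by (intro quasimodular_form_sum) (auto simp: split_def)
qed

lemma quasimodular_form_const: "quasimodular_form 0 (fps_const c)"
  using quasimodular_form_const_mult[OF quasimodular_form_monomial[of 0 0 0], of c] by simp

lemma quasimodular_form_power:
  "quasimodular_form w f \<Longrightarrow> quasimodular_form (n * w) (f ^ n)"
proof (induction n)
  case 0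
  show ?case using quasimodular_form_const[of 1] by simp
next
  case (Suc n)
  then show ?case using quasimodular_form_mult[of w f "n * w" "f ^ n"] by simp
qed

lemma quasimodular_form_E2: "quasimodular_form 2 E2"
  using quasimodular_form_monomial[of 1 0 0] by simp

lemma quasimodular_form_E4: "quasimodular_form 4 E4"
  using quasimodular_form_monomial[of 0 1 0] by simp

lemma quasimodular_form_E6: "quasimodular_form 6 E6"
  using quasimodular_form_monomial[of 0 0 1] by simp

section \<open>Coefficients with respect to \<epsilon>\<close>

lemma fls_times_nth_superset:
  fixes f g :: "'k::comm_ring_1 fls"
  assumes "finite B" "\<And>x. f $$ x \<noteq> 0 \<Longrightarrow> g $$ (n - x) \<noteq> 0 \<Longrightarrow> x \<in> B"
  shows "(f * g) $$ n = (\<Sum>x\<in>B. f $$ x * g $$ (n - x))"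
proof -
  let ?A = "{fls_subdegree f..n - fls_subdegree g}"
  have "(f * g) $$ n = (\<Sum>x\<in>?A. f $$ x * g $$ (n - x))" by (rule fls_times_nth(2))
  also have "\<dots> = (\<Sum>x\<in>?A \<inter> B. f $$ x * g $$ (n - x))"
  proof (rule sum.mono_neutral_right)
    show "\<forall>x\<in>?A - ?A \<inter> B. f $$ x * g $$ (n - x) = 0"
    proof
      fix x assume "x \<in> ?A - ?A \<inter> B"
      then have "f $$ x = 0 \<or> g $$ (n - x) = 0" using assms(2) by blast
      then show "f $$ x * g $$ (n - x) = 0" by auto
    qed
  qed auto
  also have "\<dots> = (\<Sum>x\<in>B. f $$ x * g $$ (n - x))"
  proof (rule sum.mono_neutral_left)
    show "\<forall>x\<in>B - ?A \<inter> B. f $$ x * g $$ (n - x) = 0"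
    proof
      fix x assume "x \<in> B - ?A \<inter> B"
      then have "x < fls_subdegree f \<or> n - x < fls_subdegree g" by auto
      then show "f $$ x * g $$ (n - x) = 0" by (auto simp: fls_eq0_below_subdegree)
    qed
  qed (use assms in auto)
  finally show ?thesis .
qed

lemma fls_nth_sum: "sum f A $$ n = (\<Sum>x\<in>A. f x $$ n)"
  by (induction A rule: infinite_finite_induct) auto

text \<open>The coefficient of \<open>\<epsilon>^k\<close>, where \<open>\<epsilon>\<close> is the variable of the Laurent series.\<close>

definition eps_coeff :: "int \<Rightarrow> 'k::comm_ring_1 fls fps \<Rightarrow> 'k fps" where
  "eps_coeff k H = Abs_fps (\<lambda>m. H $ m $$ k)"

lemma eps_coeff_nth [simp]: "eps_coeff k H $ m = H $ m $$ k"
  by (simp add: eps_coeff_def)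

lemma eps_coeff_0 [simp]: "eps_coeff k 0 = 0"
  by (rule fps_ext) simp

lemma eps_coeff_add: "eps_coeff k (H + G) = eps_coeff k H + eps_coeff k G"
  by (rule fps_ext) simp

lemma eps_coeff_uminus: "eps_coeff k (- H) = - eps_coeff k H"
  by (rule fps_ext) simp

lemma eps_coeff_diff: "eps_coeff k (H - G) = eps_coeff k H - eps_coeff k G"
  by (rule fps_ext) simp

lemma eps_coeff_sum: "eps_coeff k (sum f A) = (\<Sum>x\<in>A. eps_coeff k (f x))"
  by (rule fps_ext) (simp add: fps_sum_nth fls_nth_sum)

lemma eps_coeff_eqI: "(\<And>k. eps_coeff k H = eps_coeff k G) \<Longrightarrow> H = G"
  by (metis eps_coeff_nth fls_eqI fps_ext)

lemma eps_coeff_mult: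
  fixes H G :: "'k::comm_ring_1 fls fps"
  assumes "\<And>k. k < N \<Longrightarrow> eps_coeff k H = 0" "\<And>k. k < M \<Longrightarrow> eps_coeff k G = 0"
  shows "eps_coeff n (H * G) = (\<Sum>x\<in>{N..n - M}. eps_coeff x H * eps_coeff (n - x) G)"
proof (rule fps_ext)
  fix m
  have H: "k \<ge> N" if "H $ l $$ k \<noteq> 0" for l k
    using assms(1)[of k] that by (metis eps_coeff_nth fps_zero_nth not_le)
  have G: "k \<ge> M" if "G $ l $$ k \<noteq> 0" for l k
    using assms(2)[of k] that by (metis eps_coeff_nth fps_zero_nth not_le)
  have "eps_coeff n (H * G) $ m = (\<Sum>i=0..m. (H $ i * G $ (m - i)) $$ n)"
    by (simp add: fps_mult_nth fls_nth_sum)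
  also have "\<dots> = (\<Sum>i=0..m. \<Sum>x\<in>{N..n - M}. H $ i $$ x * G $ (m - i) $$ (n - x))"
  proof (intro sum.cong refl fls_times_nth_superset)
    fix i x assume "H $ i $$ x \<noteq> 0" "G $ (m - i) $$ (n - x) \<noteq> 0"
    then show "x \<in> {N..n - M}" using H[of i x] G[of "m - i" "n - x"] by auto
  qed auto
  also have "\<dots> = (\<Sum>x\<in>{N..n - M}. \<Sum>i=0..m. H $ i $$ x * G $ (m - i) $$ (n - x))"
    by (rule sum.swap)
  finally show "eps_coeff n (H * G) $ m = (\<Sum>x\<in>{N..n - M}. eps_coeff x H * eps_coeff (n - x) G) $ m"
    by (simp add: fps_sum_nth fps_mult_nth)
qed

definition fps_lift :: "'k::comm_ring_1 fps \<Rightarrow> 'k fls fps" where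
  "fps_lift f = Abs_fps (\<lambda>m. fls_const (f $ m))"

lemma fps_lift_nth [simp]: "fps_lift f $ m = fls_const (f $ m)"
  by (simp add: fps_lift_def)

lemma eps_coeff_lift: "eps_coeff k (fps_lift f) = (if k = 0 then f else 0)"
  by (rule fps_ext) simp

lemma eps_coeff_lift_mult: "eps_coeff k (fps_lift f * H) = f * eps_coeff k H"
  by (rule fps_ext) (simp add: fps_mult_nth fls_nth_sum)

lemma eps_coeff_const_mult: "eps_coeff k (fps_const (fls_const c) * H) = fps_const c * eps_coeff k H"
  by (rule fps_ext) simp

lemma eps_coeff_X_mult: "eps_coeff k (fps_const fls_X * H) = eps_coeff (k - 1) H"
  by (rule fps_ext) (simp add: fls_X_times_conv_shift)

text \<open>\<open>\<epsilon>\<close> has weight \<open>-1\<close>: the coefficient of \<open>\<epsilon>^(N+k)\<close> is quasimodular of weight \<open>k\<close>.\<close>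

definition homogeneous :: "int \<Rightarrow> rat fls fps \<Rightarrow> bool" where
  "homogeneous N H \<longleftrightarrow>
     (\<forall>k<N. eps_coeff k H = 0) \<and> (\<forall>k. quasimodular_form k (eps_coeff (N + int k) H))"

lemma homogeneous_0: "homogeneous N 0"
  by (simp add: homogeneous_def quasimodular_form_0)

lemma homogeneous_add: "homogeneous N H \<Longrightarrow> homogeneous N G \<Longrightarrow> homogeneous N (H + G)"
  by (simp add: homogeneous_def eps_coeff_add quasimodular_form_add)

lemma homogeneous_uminus: "homogeneous N H \<Longrightarrow> homogeneous N (- H)"
  by (simp add: homogeneous_def eps_coeff_uminus quasimodular_form_uminus)

lemma homogeneous_diff: "homogeneous N H \<Longrightarrow> homogeneous N G \<Longrightarrow> homogeneous N (H - G)"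
  by (simp add: homogeneous_def eps_coeff_diff quasimodular_form_diff)

lemma homogeneous_sum: "(\<And>x. x \<in> A \<Longrightarrow> homogeneous N (f x)) \<Longrightarrow> homogeneous N (sum f A)"
  by (induction A rule: infinite_finite_induct) (auto intro: homogeneous_0 homogeneous_add)

lemma homogeneous_const_mult: "homogeneous N H \<Longrightarrow> homogeneous N (fps_const (fls_const c) * H)"
  by (simp add: homogeneous_def eps_coeff_const_mult quasimodular_form_const_mult)

lemma homogeneous_X_mult: "homogeneous N H \<Longrightarrow> homogeneous (N + 1) (fps_const fls_X * H)"
proof -
  have "N + 1 + int k - 1 = N + int k" for k by simp
  then show "homogeneous N H \<Longrightarrow> homogeneous (N + 1) (fps_const fls_X * H)"
    by (simp add: homogeneous_def eps_coeff_X_mult)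
qed

lemma homogeneous_1: "homogeneous 0 1"
proof -
  have 1: "eps_coeff k 1 = (if k = 0 then 1 else 0)" for k
    by (rule fps_ext) (auto simp: fps_one_nth)
  have "quasimodular_form 0 1" using quasimodular_form_const[of 1] by simp
  then show ?thesis by (auto simp: homogeneous_def 1 quasimodular_form_0)
qed

lemma homogeneous_lift: "quasimodular_form k f \<Longrightarrow> homogeneous (- int k) (fps_lift f)"
  by (auto simp: homogeneous_def eps_coeff_lift quasimodular_form_0)

lemma homogeneous_mult:
  assumes "homogeneous N H" "homogeneous M G"
  shows "homogeneous (N + M) (H * G)"
  unfolding homogeneous_def
proof (intro conjI allI impI)
  have c: "eps_coeff n (H * G) = (\<Sum>x\<in>{N..n - M}. eps_coeff x H * eps_coeff (n - x) G)" for n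
    by (rule eps_coeff_mult) (use assms in \<open>auto simp: homogeneous_def\<close>)
  show "eps_coeff k (H * G) = 0" if "k < N + M" for k
    unfolding c using that by simp
  show "quasimodular_form k (eps_coeff (N + M + int k) (H * G))" for k
    unfolding c
  proof (rule quasimodular_form_sum)
    fix x assume x: "x \<in> {N..N + M + int k - M}"
    define i where "i = nat (x - N)"
    have i: "x = N + int i" "i \<le> k" using x by (auto simp: i_def)
    then have "N + M + int k - x = M + int (k - i)" by simp
    moreover have "quasimodular_form (i + (k - i)) (eps_coeff (N + int i) H * eps_coeff (M + int (k - i)) G)"
      using assms by (intro quasimodular_form_mult) (auto simp: homogeneous_def)
    ultimately show "quasimodular_form k (eps_coeff x H * eps_coeff (N + M + int k - x) G)"
      using i by simp
  qed
qed

lemma homogeneous_prod: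
  "finite A \<Longrightarrow> (\<And>x. x \<in> A \<Longrightarrow> homogeneous N (f x)) \<Longrightarrow> homogeneous (int (card A) * N) (prod f A)"
proof (induction A rule: finite_induct)
  case empty
  show ?case using homogeneous_1 by simp
next
  case (insert x A)
  then have "homogeneous (N + int (card A) * N) (f x * prod f A)"
    by (intro homogeneous_mult) auto
  then show ?case using insert.hyps by (simp add: algebra_simps)
qed

section \<open>Convolutions of divisor sums\<close>

text \<open>The derivation q d/dq, which raises quasimodular weight by 2.\<close>

definition theta :: "'k::comm_ring_1 fps \<Rightarrow> 'k fps" where
  "theta f = fps_X * fps_deriv f"

lemma theta_nth [simp]: "theta f $ n = of_nat n * f $ n"
  by (cases n) (simp_all add: theta_def)

lemma theta_mult: "theta (f * g) = theta f * g + f * theta g"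
  by (simp add: theta_def algebra_simps)

lemma fps_numeral_mult_nth: "(numeral k * f) $ i = numeral k * (f $ i :: 'k::comm_ring_1)"
  by (simp add: numeral_fps_const)

text \<open>Two exponents are kept because the expansion of \<open>kron\<close> produces mixed sums
  over m = a b; with j = 0 these are the usual divisor power sums.\<close>

definition divisor_series :: "nat \<Rightarrow> nat \<Rightarrow> rat fps" where
  "divisor_series i j =
     Abs_fps (\<lambda>m. if m = 0 then 0 else \<Sum>a | a dvd m. of_nat a ^ i * of_nat (m div a) ^ j)"

lemma q_sum_kap_reg_nth_0:
  "q_sum UNIV (\<lambda>x. fps_const (c x) * kap_reg w x) $ 0 = c 0 * inverse (1 - w)"
proof -
  have "q_sum UNIV (\<lambda>x. fps_const (c x) * kap_reg w x) $ 0 = (\<Sum>x\<in>{0}. (fps_const (c x) * kap_reg w x) $ 0)"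
    by (rule q_sum_nth_superset) (auto simp: kap_reg_nth split: if_splits)
  then show ?thesis by (simp add: kap_reg_nth)
qed

lemma q_sum_kap_reg_nth:
  assumes "n > 0"
  shows "q_sum UNIV (\<lambda>x. fps_const (c x) * kap_reg w x) $ n
    = (\<Sum>a | a dvd n. c (int a) * w ^ (n div a) - c (- int a) * inverse w ^ (n div a))"
proof -
  let ?D = "{a. a dvd n}"
  let ?f = "\<lambda>x. (fps_const (c x) * kap_reg w x) $ n"
  have D: "finite ?D" "\<And>a. a \<in> ?D \<Longrightarrow> a > 0" using assms by (auto intro: dvd_pos_nat)
  have "q_sum UNIV (\<lambda>x. fps_const (c x) * kap_reg w x) $ n
      = (\<Sum>x\<in>int ` ?D \<union> (\<lambda>a. - int a) ` ?D. ?f x)"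
  proof (rule q_sum_nth_superset)
    fix x assume "?f x \<noteq> 0"
    then have x: "x \<noteq> 0" "x dvd int n" using assms by (auto simp: kap_reg_nth split: if_splits)
    have "nat \<bar>x\<bar> \<in> ?D" using x by (simp add: nat_abs_dvd_iff)
    moreover have "x = int (nat \<bar>x\<bar>) \<or> x = - int (nat \<bar>x\<bar>)" by auto
    ultimately show "x \<in> int ` ?D \<union> (\<lambda>a. - int a) ` ?D" by blast
  qed (use D in auto)
  also have "\<dots> = (\<Sum>x\<in>int ` ?D. ?f x) + (\<Sum>x\<in>(\<lambda>a. - int a) ` ?D. ?f x)"
    by (rule sum.union_disjoint) (use D in force)+
  also have "(\<Sum>x\<in>int ` ?D. ?f x) = (\<Sum>a\<in>?D. c (int a) * w ^ (n div a))"
  proof (subst sum.reindex)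
    show "sum (?f \<circ> int) ?D = (\<Sum>a\<in>?D. c (int a) * w ^ (n div a))"
    proof (rule sum.cong[OF refl])
      fix a assume "a \<in> ?D"
      then show "(?f \<circ> int) a = c (int a) * w ^ (n div a)" using D(2)[of a] assms by (simp add: kap_reg_nth)
    qed
  qed simp
  also have "(\<Sum>x\<in>(\<lambda>a. - int a) ` ?D. ?f x) = (\<Sum>a\<in>?D. - (c (- int a) * inverse w ^ (n div a)))"
  proof (subst sum.reindex)
    show "sum (?f \<circ> (\<lambda>a. - int a)) ?D = (\<Sum>a\<in>?D. - (c (- int a) * inverse w ^ (n div a)))"
    proof (rule sum.cong[OF refl])
      fix a assume "a \<in> ?D"
      then show "(?f \<circ> (\<lambda>a. - int a)) a = - (c (- int a) * inverse w ^ (n div a))"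
        using D(2)[of a] assms by (simp add: kap_reg_nth)
    qed
  qed (simp add: inj_on_def)
  finally show ?thesis by (simp add: sum_subtractf sum_negf)
qed

text \<open>The sum of x^k over all integers x against \<open>kap_reg 1\<close>: the contributions
  of x and -x are equal for odd k and cancel for even k.\<close>

definition moment :: "nat \<Rightarrow> rat fps" where
  "moment k = (if odd k then 2 * divisor_series k 0 else 0)"

lemma q_sum_kap_reg_power:
  assumes "k > 0"
  shows "q_sum UNIV (\<lambda>x. fps_const (of_int x ^ k) * kap_reg 1 x) = moment k"
proof (rule fps_ext)
  fix n
  show "q_sum UNIV (\<lambda>x. fps_const (of_int x ^ k) * kap_reg 1 x) $ n = moment k $ n"
  proof (cases "n = 0")
    case True
    then show ?thesis by (simp add: q_sum_kap_reg_nth_0 moment_def divisor_series_def)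
  next
    case False
    then show ?thesis
      by (auto simp: q_sum_kap_reg_nth moment_def divisor_series_def sum_distrib_left fps_numeral_mult_nth)
  qed
qed

lemma q_sum_kap_reg_polynomial:
  assumes "finite K" "0 \<notin> K"
  shows "q_sum UNIV (\<lambda>x. fps_const (\<Sum>k\<in>K. c k * of_int x ^ k) * kap_reg 1 x) = (\<Sum>k\<in>K. fps_const (c k) * moment k)"
  using assms
proof (induction K rule: finite_induct)
  case empty
  show ?case by (rule fps_ext) (simp add: q_sum_nth)
next
  case (insert k K)
  have "q_sum UNIV (\<lambda>x. fps_const (\<Sum>k\<in>insert k K. c k * of_int x ^ k) * kap_reg 1 x)
      = q_sum UNIV (\<lambda>x. fps_const (c k) * (fps_const (of_int x ^ k) * kap_reg 1 x)
          + fps_const (\<Sum>k\<in>K. c k * of_int x ^ k) * kap_reg 1 x)"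
    using insert.hyps by (intro q_sum_cong) (simp add: distrib_right mult.assoc flip: fps_const_add fps_const_mult)
  also have "\<dots> = fps_const (c k) * moment k + (\<Sum>k\<in>K. fps_const (c k) * moment k)"
    using insert by (simp add: q_sum_add q_summable_mult_left q_summable_kap_reg q_sum_mult_left q_sum_kap_reg_power)
  finally show ?case using insert.hyps by simp
qed

lemma theta_kap:
  assumes "x \<noteq> 0"
  shows "theta (kap 1 x) = fps_const (of_int x :: rat) * (kap 1 x * kap 1 x - kap 1 x)"
proof -
  have pos: "theta (kap 1 (int n)) = fps_const (of_nat n :: rat) * (kap 1 (int n) * kap 1 (int n) - kap 1 (int n))"
    if "n > 0" for n
  proof -
    let ?f = "1 - fps_X ^ n :: rat fps"
    have k: "kap 1 (int n) = inverse ?f" by (simp add: kap_def)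
    have nz: "?f $ 0 \<noteq> 0" using that by simp
    have XX: "fps_X * fps_X ^ (n - 1) = (fps_X ^ n :: rat fps)" using that by (simp flip: power_Suc)
    have "theta (inverse ?f) = fps_X * (- fps_deriv ?f * (inverse ?f)\<^sup>2)"
      unfolding theta_def by (subst fps_inverse_deriv[OF nz]) simp
    also have "\<dots> = of_nat n * (fps_X * fps_X ^ (n - 1)) * (inverse ?f)\<^sup>2"
      by (simp add: fps_deriv_power' mult_ac)
    also have "\<dots> = of_nat n * ((fps_X ^ n * inverse ?f) * inverse ?f)"
      unfolding XX by (simp add: power2_eq_square mult_ac)
    also have "fps_X ^ n * inverse ?f = inverse ?f - 1"
      using inverse_mult_eq_1'[OF nz] by (simp add: algebra_simps)
    finally show ?thesis unfolding k by (simp add: algebra_simps fps_of_nat)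
  qed
  show ?thesis
  proof (cases "x > 0")
    case True
    then show ?thesis using pos[of "nat x"] by simp
  next
    case False
    then have k: "(kap 1 x :: rat fps) = 1 - kap 1 (- x)" using kap_flip[of 1 x] assms by simp
    have "theta (kap 1 x) = - theta (kap 1 (- x) :: rat fps)"
      unfolding k by (rule fps_ext) (auto simp: fps_one_nth)
    also have "theta (kap 1 (- x)) = fps_const (of_int (- x) :: rat) * (kap 1 (- x) * kap 1 (- x) - kap 1 (- x))"
      using pos[of "nat (- x)"] False assms by simp
    finally show ?thesis unfolding k by (simp add: algebra_simps flip: fps_const_neg)
  qed
qed

text \<open>Convolution of the Fourier coefficients of two derivatives of the Weierstrass function.\<close>

definition kap_convolution :: "nat \<Rightarrow> int \<Rightarrow> rat fps" where
  "kap_convolution l j =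
     q_sum UNIV (\<lambda>x. fps_const (of_int x * of_int (j - x) ^ l) * (kap 1 x * kap 1 (j - x)))"

text \<open>Here \<open>kap_mult\<close> does not apply, as the arguments add up to 0 and w = 1.
  Instead, 1 / (1 - q^x) times 1 / (1 - q^(-x)) is -1 / x times the q d/dq derivative of the first
  factor, so the whole sum is a derivative.\<close>

lemma kap_convolution_0:
  assumes "odd l"
  shows "kap_convolution l 0 = theta (moment l)"
proof -
  have eq: "fps_const (of_int x * of_int (0 - x) ^ l) * (kap 1 x * kap 1 (0 - x))
      = theta (fps_const (of_int x ^ l) * kap_reg 1 x :: rat fps)" for x
  proof (cases "x = 0")
    case True
    then show ?thesis using assms by (auto simp: theta_def odd_pos)
  next
    case False
    then have k: "(kap 1 (0 - x) :: rat fps) = 1 - kap 1 x" using kap_flip[of 1 "- x"] by simp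
    \<comment> \<open>\<open>kap_reg\<close> differs from \<open>kap\<close> by a constant, which
      \<open>theta\<close> kills.\<close>
    have "theta (fps_const (of_int x ^ l) * kap_reg 1 x :: rat fps) = fps_const (of_int x ^ l) * theta (kap 1 x)"
      by (rule fps_ext) (auto simp: kap_reg_def of_bool_def fps_one_nth)
    also have "\<dots> = fps_const (of_int x ^ l * of_int x) * (kap 1 x * kap 1 x - kap 1 x)"
      unfolding theta_kap[OF False] by (simp add: mult.assoc flip: fps_const_mult)
    also have "\<dots> = fps_const (of_int x * of_int (0 - x) ^ l) * (kap 1 x * kap 1 (0 - x))"
      unfolding k using assms by (simp add: algebra_simps flip: fps_const_neg)
    finally show ?thesis by simp
  qed
  have "kap_convolution l 0 $ n = theta (moment l) $ n" for n
  proof -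
    have "kap_convolution l 0 $ n
        = (\<Sum>x\<in>{- int n..int n}. theta (fps_const (of_int x ^ l) * kap_reg 1 x :: rat fps) $ n)"
      unfolding kap_convolution_def eq
      by (rule q_sum_nth_superset) (use kap_reg_nth_nonzero[of "1 :: rat" _ n] in force)+
    also have "\<dots> = of_nat n * (\<Sum>x\<in>{- int n..int n}. (fps_const (of_int x ^ l) * kap_reg 1 x) $ n)"
      by (simp add: sum_distrib_left)
    also have "(\<Sum>x\<in>{- int n..int n}. (fps_const (of_int x ^ l :: rat) * kap_reg 1 x) $ n)
        = q_sum UNIV (\<lambda>x. fps_const (of_int x ^ l :: rat) * kap_reg 1 x) $ n"
    proof (rule q_sum_nth_superset[symmetric])
      fix x assume "(fps_const (of_int x ^ l) * kap_reg (1 :: rat) x) $ n \<noteq> 0"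
      then show "x \<in> {- int n..int n}" using kap_reg_nth_nonzero[of "1 :: rat" x n] by auto
    qed auto
    finally show ?thesis using assms by (simp add: q_sum_kap_reg_power odd_pos)
  qed
  then show ?thesis by (rule fps_ext)
qed

text \<open>The sum of \<open>x^k\<close> over \<open>0 \<le> x < y\<close>; the last case is meant for \<open>k = 6\<close> only.\<close>

definition faulhaber :: "nat \<Rightarrow> rat \<Rightarrow> rat" where
  "faulhaber k y =
    (if k = 1 then y ^ 2 / 2 - y / 2
     else if k = 2 then y ^ 3 / 3 - y ^ 2 / 2 + y / 6
     else if k = 3 then y ^ 4 / 4 - y ^ 3 / 2 + y ^ 2 / 4
     else if k = 4 then y ^ 5 / 5 - y ^ 4 / 2 + y ^ 3 / 3 - y / 30
     else if k = 5 then y ^ 6 / 6 - y ^ 5 / 2 + 5 * y ^ 4 / 12 - y ^ 2 / 12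
     else y ^ 7 / 7 - y ^ 6 / 2 + y ^ 5 / 2 - y ^ 3 / 6 + y / 42)"

lemma faulhaber_1: "faulhaber k 1 = 0"
  by (simp add: faulhaber_def)

lemma faulhaber_step:
  assumes "k \<in> {1..6}"
  shows "faulhaber k (y + 1) - faulhaber k y = y ^ k"
proof -
  have "k = 1 \<or> k = 2 \<or> k = 3 \<or> k = 4 \<or> k = 5 \<or> k = 6" using assms by auto
  then show ?thesis
    by (elim disjE) (simp_all add: faulhaber_def field_simps eval_nat_numeral)
qed

text \<open>The addition theorem extracts \<open>kap 1 j\<close>. What is left is the polynomial x
  (j - x)^l summed against \<open>kap_reg\<close> at x and at j - x, which gives moments, and
  against a difference of step functions, which gives power sums. \<open>K\<close> and
  \<open>K'\<close> index the expansions of the polynomial and of its reflection under x to j -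
  x.\<close>

lemma kap_convolution_nonzero:
  assumes j: "j \<noteq> 0" and l: "l > 0"
    and K: "finite K" "0 \<notin> K" "finite K'" "0 \<notin> K'"
    and p: "\<And>x. of_int x * of_int (j - x) ^ l = (\<Sum>k\<in>K. c k * of_int x ^ k)"
      "\<And>x. of_int (j - x) * of_int x ^ l = (\<Sum>k\<in>K'. c' k * of_int x ^ k)"
    and K6: "K \<subseteq> {1..6}"
  shows "kap_convolution l j = kap 1 j *
    ((\<Sum>k\<in>K. fps_const (c k) * moment k) + (\<Sum>k\<in>K'. fps_const (c' k) * moment k)
      + fps_const (\<Sum>k\<in>K. c k * faulhaber k (of_int j)))"
proof -
  let ?Q = "\<lambda>x :: int. \<Sum>k\<in>K. c k * faulhaber k (of_int x)"
  have Q: "?Q (x + 1) - ?Q x = of_int x * of_int (j - x) ^ l" for x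
    unfolding p(1) sum_subtractf[symmetric]
    by (intro sum.cong refl) (use K6 faulhaber_step in \<open>auto simp flip: right_diff_distrib\<close>)
  let ?p = "\<lambda>x. of_int x * of_int (j - x) ^ l :: rat"
  let ?f1 = "\<lambda>x. fps_const (?p x) * kap_reg 1 x"
  let ?f2 = "\<lambda>x. fps_const (?p x) * kap_reg 1 (j - x)"
  let ?f3 = "\<lambda>x. fps_const (?p x) * (of_bool (x > 0) - of_bool (x \<ge> j))"
  let ?g = "\<lambda>x. fps_const (of_int (j - x) * of_int x ^ l :: rat) * kap_reg 1 x"
  have f2: "?f2 = (\<lambda>x. ?g (j - x))" by (rule ext) simp
  have sf2: "q_summable UNIV ?f2"
  proof -
    have "q_summable UNIV (\<lambda>x. ?g (j - x))"
      by (rule q_summable_reindex[OF bij_int_reflect, THEN iffD1]) (rule q_summable_kap_reg)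
    then show ?thesis unfolding f2 .
  qed
  have term_eq: "fps_const (?p x) * (kap 1 x * kap 1 (j - x)) = kap 1 j * (?f1 x + ?f2 x + ?f3 x)" for x
  proof (cases "x = 0 \<or> x = j")
    case True
    then have "?p x = 0" using l by auto
    then show ?thesis by (simp only: fps_const_0_eq_0 mult_zero_left mult_zero_right add_0)
  next
    case False
    then have "kap 1 x * kap 1 (j - x) = kap (1 :: rat) j * (kap 1 x + kap 1 (j - x) - 1)"
      using kap_mult[of "1 :: rat" 1 x "j - x"] j by simp
    also have "kap 1 x + kap 1 (j - x) - 1 = kap_reg 1 x + kap_reg 1 (j - x) + (of_bool (x > 0) - of_bool (x \<ge> j) :: rat fps)"
      by (auto simp: kap_reg_def)
    finally show ?thesis by (simp only: distrib_left mult_ac add_ac)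
  qed
  have "kap_convolution l j = kap 1 j * (q_sum UNIV ?f1 + q_sum UNIV ?f2 + q_sum UNIV ?f3)"
    unfolding kap_convolution_def term_eq
    by (simp only: q_sum_mult_left q_sum_add q_summable_add q_summable_kap_reg sf2
        q_sum_step_difference(1)[of ?Q, OF Q])
  also have "q_sum UNIV ?f1 = (\<Sum>k\<in>K. fps_const (c k) * moment k)"
    unfolding p(1) by (rule q_sum_kap_reg_polynomial[OF K(1,2)])
  also have "q_sum UNIV ?f2 = q_sum UNIV ?g"
    unfolding f2 by (rule q_sum_reindex[OF bij_int_reflect, symmetric])
  also have "\<dots> = (\<Sum>k\<in>K'. fps_const (c' k) * moment k)"
    unfolding p(2) by (rule q_sum_kap_reg_polynomial[OF K(3,4)])
  also have "q_sum UNIV ?f3 = fps_const (?Q j - ?Q 1)"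
    by (rule q_sum_step_difference(2)[of ?Q, OF Q])
  also have "?Q 1 = 0" by (simp add: faulhaber_1)
  also have "?Q j - 0 = ?Q j" by simp
  finally show ?thesis .
qed

text \<open>Here and in the next two proofs \<open>?c\<close> lists the coefficients of x (j - x)^l,
  and \<open>?c'\<close>, where it occurs, those of the reflected polynomial. For positive j the
  polynomial in j is the sum of x (j - x)^l over 0 \<le> x < j.\<close>

lemma kap_convolution_1:
  assumes "j \<noteq> 0"
  shows "kap_convolution 1 j = kap 1 j * (4 * divisor_series 1 0 * fps_const (of_int j)
    + fps_const (of_int j ^ 3 / 6 - of_int j / 6))"
proof -
  let ?J = "of_int j :: rat"
  let ?c = "\<lambda>k :: nat. if k = 1 then ?J else - 1"
  have "kap_convolution 1 j = kap 1 j *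
    ((\<Sum>k\<in>{1, 2}. fps_const (?c k) * moment k) + (\<Sum>k\<in>{1, 2}. fps_const (?c k) * moment k)
      + fps_const (\<Sum>k\<in>{1, 2}. ?c k * faulhaber k ?J))"
    by (rule kap_convolution_nonzero) (use assms in \<open>simp_all add: algebra_simps eval_nat_numeral\<close>)
  also have "(\<Sum>k\<in>{1, 2}. ?c k * faulhaber k ?J) = ?J ^ 3 / 6 - ?J / 6"
    by (simp add: faulhaber_def field_simps eval_nat_numeral)
  finally show ?thesis by (simp add: moment_def algebra_simps)
qed

lemma kap_convolution_3:
  assumes "j \<noteq> 0"
  shows "kap_convolution 3 j = kap 1 j * (2 * divisor_series 1 0 * fps_const (of_int j ^ 3)
    + 8 * divisor_series 3 0 * fps_const (of_int j)
    + fps_const (of_int j ^ 5 / 20 - of_int j ^ 3 / 12 + of_int j / 30))"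
proof -
  let ?J = "of_int j :: rat"
  let ?c = "\<lambda>k :: nat. if k = 1 then ?J ^ 3 else if k = 2 then - 3 * ?J ^ 2 else if k = 3 then 3 * ?J else - 1"
  let ?c' = "\<lambda>k :: nat. if k = 3 then ?J else - 1"
  have "kap_convolution 3 j = kap 1 j *
    ((\<Sum>k\<in>{1, 2, 3, 4}. fps_const (?c k) * moment k) + (\<Sum>k\<in>{3, 4}. fps_const (?c' k) * moment k)
      + fps_const (\<Sum>k\<in>{1, 2, 3, 4}. ?c k * faulhaber k ?J))"
    by (rule kap_convolution_nonzero) (use assms in \<open>simp_all add: algebra_simps eval_nat_numeral\<close>)
  also have "(\<Sum>k\<in>{1, 2, 3, 4}. ?c k * faulhaber k ?J) = ?J ^ 5 / 20 - ?J ^ 3 / 12 + ?J / 30"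
    by (simp add: faulhaber_def field_simps eval_nat_numeral)
  also have "(\<Sum>k\<in>{1, 2, 3, 4}. fps_const (?c k) * moment k) + (\<Sum>k\<in>{3, 4}. fps_const (?c' k) * moment k)
      = 2 * divisor_series 1 0 * fps_const (?J ^ 3) + 8 * divisor_series 3 0 * fps_const ?J"
    by (rule fps_ext) (simp add: moment_def mult.assoc fps_numeral_mult_nth)
  finally show ?thesis .
qed

lemma kap_convolution_5:
  assumes "j \<noteq> 0"
  shows "kap_convolution 5 j = kap 1 j * (2 * divisor_series 1 0 * fps_const (of_int j ^ 5)
    + 20 * divisor_series 3 0 * fps_const (of_int j ^ 3) + 12 * divisor_series 5 0 * fps_const (of_int j)
    + fps_const (of_int j ^ 7 / 42 - of_int j ^ 5 / 12 + of_int j ^ 3 / 12 - of_int j / 42))"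
proof -
  let ?J = "of_int j :: rat"
  let ?c = "\<lambda>k :: nat. if k = 1 then ?J ^ 5 else if k = 2 then - 5 * ?J ^ 4 else if k = 3 then 10 * ?J ^ 3
    else if k = 4 then - 10 * ?J ^ 2 else if k = 5 then 5 * ?J else - 1"
  let ?c' = "\<lambda>k :: nat. if k = 5 then ?J else - 1"
  have "kap_convolution 5 j = kap 1 j *
    ((\<Sum>k\<in>{1, 2, 3, 4, 5, 6}. fps_const (?c k) * moment k) + (\<Sum>k\<in>{5, 6}. fps_const (?c' k) * moment k)
      + fps_const (\<Sum>k\<in>{1, 2, 3, 4, 5, 6}. ?c k * faulhaber k ?J))"
    by (rule kap_convolution_nonzero) (use assms in \<open>simp_all add: algebra_simps eval_nat_numeral\<close>)
  also have "(\<Sum>k\<in>{1, 2, 3, 4, 5, 6}. ?c k * faulhaber k ?J)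
      = ?J ^ 7 / 42 - ?J ^ 5 / 12 + ?J ^ 3 / 12 - ?J / 42"
    by (simp add: faulhaber_def field_simps eval_nat_numeral)
  also have "(\<Sum>k\<in>{1, 2, 3, 4, 5, 6}. fps_const (?c k) * moment k) + (\<Sum>k\<in>{5, 6}. fps_const (?c' k) * moment k)
      = 2 * divisor_series 1 0 * fps_const (?J ^ 5) + 20 * divisor_series 3 0 * fps_const (?J ^ 3)
        + 12 * divisor_series 5 0 * fps_const ?J"
    by (rule fps_ext) (simp add: moment_def mult.assoc fps_numeral_mult_nth)
  finally show ?thesis .
qed

section \<open>The Weierstrass function\<close>

definition poly_eval :: "rat poly \<Rightarrow> rat fls \<Rightarrow> rat fls" where
  "poly_eval p s = (\<Sum>i\<le>degree p. fls_const (coeff p i) * s ^ i)"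

lemma poly_eval_altdef:
  assumes "degree p \<le> n"
  shows "poly_eval p s = (\<Sum>i\<le>n. fls_const (coeff p i) * s ^ i)"
  unfolding poly_eval_def using assms
  by (intro sum.mono_neutral_left) (auto simp: coeff_eq_0)

lemma poly_eval_0 [simp]: "poly_eval 0 s = 0"
  by (simp add: poly_eval_def)

lemma poly_eval_pCons [simp]: "poly_eval (pCons a p) s = fls_const a + s * poly_eval p s"
proof -
  have "poly_eval (pCons a p) s = (\<Sum>i\<le>Suc (degree p). fls_const (coeff (pCons a p) i) * s ^ i)"
    by (rule poly_eval_altdef) (simp add: degree_pCons_le)
  then show ?thesis
    by (simp add: sum.atMost_Suc_shift poly_eval_def sum_distrib_left mult_ac del: sum.atMost_Suc)
qed

lemma poly_eval_add [simp]: "poly_eval (p + q) s = poly_eval p s + poly_eval q s"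
  by (induction p q rule: poly_induct2) (simp_all add: algebra_simps flip: fls_plus_const)

lemma poly_eval_smult [simp]: "poly_eval (smult a p) s = fls_const a * poly_eval p s"
  by (induction p) (simp_all add: algebra_simps flip: fls_const_mult_const)

lemma poly_eval_mult [simp]: "poly_eval (p * q) s = poly_eval p s * poly_eval q s"
  by (induction p) (simp_all add: algebra_simps)

lemma poly_eval_1 [simp]: "poly_eval 1 s = 1"
  by (simp add: one_pCons)

lemma poly_eval_power [simp]: "poly_eval (p ^ n) s = poly_eval p s ^ n"
  by (induction n) simp_all

lemma poly_eval_X_eq_0:
  assumes "poly_eval p fls_X = 0"
  shows "p = 0"
proof (rule poly_eqI)
  fix n
  have "poly_eval p fls_X $$ int n = (\<Sum>i\<le>max n (degree p). coeff p i * (if n = i then 1 else 0))"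
    by (subst poly_eval_altdef[of _ "max n (degree p)"]) (auto simp: fls_nth_sum intro!: sum.cong)
  also have "\<dots> = coeff p n" by (simp add: if_distrib[of "\<lambda>x. _ * x"] cong: if_cong)
  finally show "coeff p n = coeff 0 n" using assms by simp
qed

lemma fls_deriv_poly_eval: "fls_deriv (poly_eval p s) = poly_eval (pderiv p) s * fls_deriv s"
  by (induction p) (simp_all add: pderiv_pCons algebra_simps)

lemma fls_X_neq_1: "fls_X \<noteq> (1 :: rat fls)"
proof
  assume "fls_X = (1 :: rat fls)"
  then have "fls_X $$ 0 = (1 :: rat fls) $$ 0" by simp
  then show False by simp
qed

text \<open>
  An identity between rational functions with poles at \<open>0\<close> and \<open>1\<close> may be checked at the generic
  point \<open>fls_X\<close>, that is, by comparing Fourier coefficients.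
\<close>

definition rational_fun :: "(rat fls \<Rightarrow> rat fls) \<Rightarrow> bool" where
  "rational_fun h \<longleftrightarrow>
     (\<exists>p M N. \<forall>s. s \<noteq> 0 \<longrightarrow> s \<noteq> 1 \<longrightarrow> h s * s ^ M * (1 - s) ^ N = poly_eval p s)"

lemma rational_fun_zero:
  assumes "rational_fun h" "h fls_X = 0" "s \<noteq> 0" "s \<noteq> 1"
  shows "h s = 0"
proof -
  obtain p M N where p: "\<And>s. s \<noteq> 0 \<Longrightarrow> s \<noteq> 1 \<Longrightarrow> h s * s ^ M * (1 - s) ^ N = poly_eval p s"
    using assms(1) unfolding rational_fun_def by blast
  have "poly_eval p fls_X = 0" using p[of fls_X] assms(2) fls_X_neq_1 by simp
  then have "p = 0" by (rule poly_eval_X_eq_0)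
  then show ?thesis using p[OF assms(3,4)] assms(3,4) by simp
qed

lemma rational_fun_poly: "rational_fun (poly_eval p)"
  unfolding rational_fun_def by (intro exI[of _ p] exI[of _ 0]) simp

lemma rational_fun_const: "rational_fun (\<lambda>_. fls_const c)"
proof -
  have "poly_eval [:c:] = (\<lambda>_. fls_const c)" by (rule ext) simp
  then show ?thesis using rational_fun_poly[of "[:c:]"] by simp
qed

lemma rational_fun_add:
  assumes "rational_fun f" "rational_fun g"
  shows "rational_fun (\<lambda>s. f s + g s)"
proof -
  obtain p M N where p: "\<And>s. s \<noteq> 0 \<Longrightarrow> s \<noteq> 1 \<Longrightarrow> f s * s ^ M * (1 - s) ^ N = poly_eval p s"
    using assms(1) unfolding rational_fun_def by blast
  obtain q M' N' where q: "\<And>s. s \<noteq> 0 \<Longrightarrow> s \<noteq> 1 \<Longrightarrow> g s * s ^ M' * (1 - s) ^ N' = poly_eval q s"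
    using assms(2) unfolding rational_fun_def by blast
  let ?r = "p * [:0, 1:] ^ M' * [:1, -1:] ^ N' + q * [:0, 1:] ^ M * [:1, -1:] ^ N"
  have "(f s + g s) * s ^ (M + M') * (1 - s) ^ (N + N') = poly_eval ?r s" if "s \<noteq> 0" "s \<noteq> 1" for s
  proof -
    have "poly_eval [:0, 1:] s = s" "poly_eval [:1, -1:] s = 1 - s"
      by simp_all
    then have r: "poly_eval ?r s = f s * s ^ M * (1 - s) ^ N * s ^ M' * (1 - s) ^ N'
        + g s * s ^ M' * (1 - s) ^ N' * s ^ M * (1 - s) ^ N"
      by (simp only: poly_eval_add poly_eval_mult poly_eval_power p[OF that] q[OF that])
    show ?thesis unfolding r by (simp only: power_add distrib_right) (simp only: mult_ac)
  qed
  then show ?thesis unfolding rational_fun_def by blast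
qed

lemma rational_fun_mult:
  assumes "rational_fun f" "rational_fun g"
  shows "rational_fun (\<lambda>s. f s * g s)"
proof -
  obtain p M N where p: "\<And>s. s \<noteq> 0 \<Longrightarrow> s \<noteq> 1 \<Longrightarrow> f s * s ^ M * (1 - s) ^ N = poly_eval p s"
    using assms(1) unfolding rational_fun_def by blast
  obtain q M' N' where q: "\<And>s. s \<noteq> 0 \<Longrightarrow> s \<noteq> 1 \<Longrightarrow> g s * s ^ M' * (1 - s) ^ N' = poly_eval q s"
    using assms(2) unfolding rational_fun_def by blast
  have "(f s * g s) * s ^ (M + M') * (1 - s) ^ (N + N') = poly_eval (p * q) s" if "s \<noteq> 0" "s \<noteq> 1" for s
  proof -
    have "poly_eval (p * q) s = (f s * s ^ M * (1 - s) ^ N) * (g s * s ^ M' * (1 - s) ^ N')"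
      by (simp only: poly_eval_mult p[OF that] q[OF that])
    then show ?thesis by (simp add: power_add mult_ac)
  qed
  then show ?thesis unfolding rational_fun_def by blast
qed

lemma rational_fun_diff:
  assumes "rational_fun f" "rational_fun g"
  shows "rational_fun (\<lambda>s. f s - g s)"
proof -
  have "f s + fls_const (- 1) * g s = f s - g s" for s by simp
  then show ?thesis
    using rational_fun_add[OF assms(1) rational_fun_mult[OF rational_fun_const[of "- 1"] assms(2)]] by simp
qed

lemma rational_fun_sum:
  assumes "\<And>x. x \<in> A \<Longrightarrow> rational_fun (f x)"
  shows "rational_fun (\<lambda>s. \<Sum>x\<in>A. f x s)"
  using assms
proof (induction A rule: infinite_finite_induct)
  case (insert x A)
  have "rational_fun (\<lambda>s. f x s + (\<Sum>x\<in>A. f x s))"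
    by (rule rational_fun_add) (use insert in auto)
  then show ?case using insert.hyps by simp
qed (use rational_fun_const[of 0] in simp_all)

lemma rational_fun_power: "rational_fun (\<lambda>s. s ^ a)"
proof -
  have "poly_eval ([:0, 1:] ^ a) = (\<lambda>s. s ^ a)" by (rule ext) simp
  then show ?thesis using rational_fun_poly[of "[:0, 1:] ^ a"] by simp
qed

lemma rational_fun_inverse_power: "rational_fun (\<lambda>s. inverse s ^ a)"
proof -
  have "inverse s ^ a * s ^ a * (1 - s) ^ 0 = poly_eval 1 s" if "s \<noteq> 0" for s
    using that by (simp add: power_inverse)
  then show ?thesis unfolding rational_fun_def by blast
qed

lemma rational_fun_inverse_one_minus: "rational_fun (\<lambda>s. inverse (1 - s))"
proof -
  have "inverse (1 - s) * s ^ 0 * (1 - s) ^ 1 = poly_eval 1 s" if "s \<noteq> 1" for s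
    using that by simp
  then show ?thesis unfolding rational_fun_def by blast
qed

lemma rational_fun_compose_poly:
  assumes "rational_fun h"
  shows "rational_fun (\<lambda>s. poly_eval p (h s))"
proof (induction p)
  case 0
  show ?case using rational_fun_const[of 0] by simp
next
  case (pCons a p)
  then show ?case
    by (simp only: poly_eval_pCons) (intro rational_fun_add rational_fun_const rational_fun_mult assms)
qed

text \<open>
  The function \<open>\<Sum>a. a^l * s^a\<close> is a polynomial in \<open>y = 1 / (1 - s)\<close>, as the derivation
  \<open>s * d/ds\<close> maps \<open>y\<close> to \<open>y\<^sup>2 - y\<close>.
\<close>

fun eulerian_poly :: "nat \<Rightarrow> rat poly" where
  "eulerian_poly 0 = [:0, 1:]"
| "eulerian_poly (Suc l) = pderiv (eulerian_poly l) * [:0, -1, 1:]"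

definition polylog :: "nat \<Rightarrow> rat fls \<Rightarrow> rat fls" where
  "polylog l s = poly_eval (eulerian_poly l) (inverse (1 - s))"

lemma rational_fun_polylog: "rational_fun (polylog l)"
  unfolding polylog_def by (rule rational_fun_compose_poly[OF rational_fun_inverse_one_minus])

lemma polylog_0: "polylog 0 s = inverse (1 - s)"
  by (simp add: polylog_def)

text \<open>The factor c normalises the derivative of Laurent series to s d/ds: it is
  \<open>fls_X\<close> for s = \<open>fls_X\<close> and 1 for s = \<open>fexp 1\<close>.\<close>

lemma polylog_Suc:
  assumes "c * fls_deriv (inverse (1 - s)) = inverse (1 - s) ^ 2 - inverse (1 - s)"
  shows "polylog (Suc l) s = c * fls_deriv (polylog l s)"
proof -
  have "poly_eval [:0, -1, 1:] y = y ^ 2 - y" for y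
    by (simp add: algebra_simps power2_eq_square)
  then show ?thesis
    unfolding polylog_def fls_deriv_poly_eval eulerian_poly.simps poly_eval_mult
    by (simp only: assms[symmetric] mult.left_commute)
qed

lemma fls_deriv_inverse_one_minus:
  fixes s :: "rat fls"
  assumes "s \<noteq> 1"
  shows "fls_deriv (inverse (1 - s)) = fls_deriv s * inverse (1 - s) ^ 2"
proof -
  let ?y = "inverse (1 - s)"
  have y: "(1 - s) * ?y = 1" using assms by simp
  then have "fls_deriv ((1 - s) * ?y) = 0" by simp
  then have 1: "(1 - s) * fls_deriv ?y = fls_deriv s * ?y" by (simp add: algebra_simps)
  have "fls_deriv ?y = ((1 - s) * ?y) * fls_deriv ?y" by (simp add: y)
  also have "\<dots> = ?y * ((1 - s) * fls_deriv ?y)" by (simp add: mult_ac)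
  also have "\<dots> = fls_deriv s * ?y ^ 2" unfolding 1 by (simp add: power2_eq_square mult_ac)
  finally show ?thesis .
qed

lemma inverse_one_minus_identity:
  fixes s :: "rat fls"
  assumes "s \<noteq> 1"
  shows "s * inverse (1 - s) ^ 2 = inverse (1 - s) ^ 2 - inverse (1 - s)"
proof -
  have "inverse (1 - s) = (1 - s) * inverse (1 - s) ^ 2" using assms by (simp add: power2_eq_square)
  then show ?thesis by (simp add: algebra_simps)
qed

lemma polylog_X_nth: "polylog l fls_X $$ n = (if n \<ge> 0 then of_int n ^ l else 0)"
proof (induction l arbitrary: n)
  case 0
  have "(1 - fls_X) * fps_to_fls (Abs_fps (\<lambda>_. 1 :: rat)) = 1"
  proof (rule fls_eqI)
    fix k :: int
    have "k \<noteq> 0 \<Longrightarrow> k > 0 \<longleftrightarrow> k - 1 \<ge> 0" by auto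
    then show "((1 - fls_X) * fps_to_fls (Abs_fps (\<lambda>_. 1 :: rat))) $$ k = 1 $$ k"
      by (auto simp: left_diff_distrib fls_X_times_conv_shift)
  qed
  then have "inverse (1 - fls_X) = fps_to_fls (Abs_fps (\<lambda>_. 1 :: rat))" by (rule inverse_unique)
  then show ?case by (simp add: polylog_0)
next
  case (Suc l)
  have "polylog (Suc l) fls_X = fls_X * fls_deriv (polylog l fls_X)"
    by (rule polylog_Suc) (simp add: fls_deriv_inverse_one_minus[OF fls_X_neq_1] inverse_one_minus_identity[OF fls_X_neq_1])
  then show ?case by (simp add: fls_X_times_conv_shift Suc.IH)
qed

text \<open>For odd \<open>l\<close> the \<open>(l-1)\<close>-st derivative of the Weierstrass function, up to a constant.\<close>

definition weierstrass :: "nat \<Rightarrow> rat fls \<Rightarrow> rat fls fps" where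
  "weierstrass l s = Abs_fps (\<lambda>m. if m = 0 then polylog l s
     else \<Sum>a | a dvd m. fls_const (of_nat a ^ l) * (s ^ a + inverse s ^ a))"

lemma weierstrass_nth:
  "weierstrass l s $ m = (if m = 0 then polylog l s
     else \<Sum>a | a dvd m. fls_const (of_nat a ^ l) * (s ^ a + inverse s ^ a))"
  unfolding weierstrass_def by (rule fps_nth_Abs_fps)

lemma rational_fun_weierstrass: "rational_fun (\<lambda>s. weierstrass l s $ m)"
proof (cases "m = 0")
  case True
  then show ?thesis using rational_fun_polylog by (simp add: weierstrass_nth)
next
  case False
  have "rational_fun (\<lambda>s. \<Sum>a | a dvd m. fls_const (of_nat a ^ l) * (s ^ a + inverse s ^ a))"
    by (intro rational_fun_sum rational_fun_mult rational_fun_const rational_fun_add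
        rational_fun_power rational_fun_inverse_power)
  then show ?thesis using False by (simp add: weierstrass_nth)
qed

text \<open>At s = \<open>fls_X\<close> the Laurent variable is the Fourier variable itself, so
  \<open>eps_coeff\<close> extracts Fourier coefficients. Odd l is what makes the sign of j^l match
  that of \<open>kap\<close> for negative j.\<close>

lemma eps_coeff_weierstrass_X:
  assumes "odd l"
  shows "eps_coeff j (weierstrass l fls_X) = fps_const (of_int j ^ l) * kap 1 j"
proof (rule fps_ext)
  fix m
  have l: "l > 0" using assms by (simp add: odd_pos)
  show "eps_coeff j (weierstrass l fls_X) $ m = (fps_const (of_int j ^ l) * kap 1 j) $ m"
  proof (cases "m = 0")
    case True
    then show ?thesis using l
      by (cases j "0 :: int" rule: linorder_cases) (simp_all add: weierstrass_nth polylog_X_nth kap_pos_nth kap_neg_nth)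
  next
    case False
    have D: "finite {a. a dvd m}" "\<And>a. a dvd m \<Longrightarrow> a > 0" using False by (auto intro: dvd_pos_nat)
    have "eps_coeff j (weierstrass l fls_X) $ m
        = (\<Sum>a | a dvd m. of_nat a ^ l * ((if j = int a then 1 else 0) + (if j = - int a then 1 else 0)))"
    proof -
      have "(fls_X ^ a + inverse fls_X ^ a :: rat fls) $$ j = (if j = int a then 1 else 0) + (if j = - int a then 1 else 0)" for a
        by (auto simp: fls_inverse_X fls_X_inv_power_conv_shift_1)
      then show ?thesis using False by (simp add: weierstrass_nth fls_nth_sum)
    qed
    also have "\<dots> = (\<Sum>a\<in>{nat \<bar>j\<bar>} \<inter> {a. a dvd m}. of_nat a ^ l * ((if j = int a then 1 else 0) + (if j = - int a then 1 else 0)))"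
    proof (rule sum.mono_neutral_right)
      show "\<forall>a\<in>{a. a dvd m} - {nat \<bar>j\<bar>} \<inter> {a. a dvd m}.
          of_nat a ^ l * ((if j = int a then 1 else 0) + (if j = - int a then 1 else 0)) = (0 :: rat)"
        by auto
    qed (use D(1) in auto)
    also have "\<dots> = (fps_const (of_int j ^ l) * kap 1 j) $ m"
    proof (cases j "0 :: int" rule: linorder_cases)
      case equal
      then show ?thesis using l False by auto
    next
      case less
      then have "{nat \<bar>j\<bar>} \<inter> {a. a dvd m} = (if nat (- j) dvd m then {nat (- j)} else {})" by auto
      then show ?thesis using less False assms by (simp add: kap_neg_nth)
    next
      case greater
      then have "{nat \<bar>j\<bar>} \<inter> {a. a dvd m} = (if nat j dvd m then {nat j} else {})" by auto
      then show ?thesis using greater False by (simp add: kap_pos_nth)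
    qed
    finally show ?thesis .
  qed
qed

lemma eps_coeff_weierstrass_product_X:
  assumes "odd l"
  shows "eps_coeff j (weierstrass 1 fls_X * weierstrass l fls_X) = kap_convolution l j"
proof (rule fps_ext)
  fix m
  let ?H = "weierstrass 1 fls_X" and ?G = "weierstrass l fls_X"
  let ?B = "{- int m..j + int m}"
  have nth: "weierstrass k fls_X $ i $$ x = of_int x ^ k * kap 1 x $ i" if "odd k" for k i x
    using arg_cong[OF eps_coeff_weierstrass_X[OF that, of x], of "\<lambda>f. f $ i"] by simp
  have low: "x \<ge> - int i" if "kap (1 :: rat) x $ i \<noteq> 0" for x i
    using phi_nth_nonzero[of 1 "1 :: rat" False x i] that by (simp add: phi_def)
  have "eps_coeff j (?H * ?G) $ m = (\<Sum>i=0..m. (?H $ i * ?G $ (m - i)) $$ j)"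
    by (simp add: fps_mult_nth fls_nth_sum)
  also have "\<dots> = (\<Sum>i=0..m. \<Sum>x\<in>?B. ?H $ i $$ x * ?G $ (m - i) $$ (j - x))"
  proof (intro sum.cong refl fls_times_nth_superset)
    fix i x assume i: "i \<in> {0..m}" "?H $ i $$ x \<noteq> 0" "?G $ (m - i) $$ (j - x) \<noteq> 0"
    then have "kap (1 :: rat) x $ i \<noteq> 0" "kap (1 :: rat) (j - x) $ (m - i) \<noteq> 0"
      using nth[OF assms] nth[of 1] by auto
    then have "x \<ge> - int i" "j - x \<ge> - int (m - i)" using low by blast+
    then show "x \<in> ?B" using i(1) by auto
  qed auto
  also have "\<dots> = (\<Sum>x\<in>?B. \<Sum>i=0..m. ?H $ i $$ x * ?G $ (m - i) $$ (j - x))"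
    by (rule sum.swap)
  also have "\<dots> = (\<Sum>x\<in>?B. (fps_const (of_int x * of_int (j - x) ^ l) * (kap 1 x * kap 1 (j - x))) $ m)"
  proof (rule sum.cong[OF refl])
    fix x
    have "(\<Sum>i=0..m. ?H $ i $$ x * ?G $ (m - i) $$ (j - x))
        = of_int x * of_int (j - x) ^ l * (\<Sum>i=0..m. kap 1 x $ i * kap 1 (j - x) $ (m - i))"
      unfolding sum_distrib_left by (rule sum.cong) (simp_all add: nth assms)
    then show "(\<Sum>i=0..m. ?H $ i $$ x * ?G $ (m - i) $$ (j - x))
        = (fps_const (of_int x * of_int (j - x) ^ l) * (kap 1 x * kap 1 (j - x))) $ m"
      unfolding fps_mult_left_const_nth fps_mult_nth[of "kap 1 x"] .
  qed
  also have "\<dots> = kap_convolution l j $ m"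
    unfolding kap_convolution_def
  proof (rule q_sum_nth_superset[symmetric])
    fix x assume "(fps_const (of_int x * of_int (j - x) ^ l) * (kap 1 x * kap (1 :: rat) (j - x))) $ m \<noteq> 0"
    then have "(kap 1 x * kap (1 :: rat) (j - x)) $ m \<noteq> 0" by auto
    then have "\<exists>i\<in>{0..m}. kap (1 :: rat) x $ i * kap 1 (j - x) $ (m - i) \<noteq> 0"
      unfolding fps_mult_nth by (meson sum.neutral)
    then obtain i where "i \<le> m" "kap (1 :: rat) x $ i \<noteq> 0" "kap (1 :: rat) (j - x) $ (m - i) \<noteq> 0" by auto
    then show "x \<in> ?B" using low[of x i] low[of "j - x" "m - i"] by auto
  qed auto
  finally show "eps_coeff j (?H * ?G) $ m = kap_convolution l j $ m" .
qed

text \<open>For each m the coefficients of q^m on both sides are rational functions of s, so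
  agreement at the generic point gives agreement at every s.\<close>

lemma weierstrass_transfer:
  assumes "weierstrass 1 fls_X * weierstrass l fls_X
      = fps_const (fls_const c) * weierstrass (l + 2) fls_X + (\<Sum>k\<in>K. fps_lift (f k) * weierstrass k fls_X) + fps_lift g"
    and s: "s \<noteq> 0" "s \<noteq> 1"
  shows "weierstrass 1 s * weierstrass l s
      = fps_const (fls_const c) * weierstrass (l + 2) s + (\<Sum>k\<in>K. fps_lift (f k) * weierstrass k s) + fps_lift g"
proof (rule fps_ext)
  fix m
  let ?h = "\<lambda>s. (\<Sum>i=0..m. weierstrass 1 s $ i * weierstrass l s $ (m - i))
      - (fls_const c * weierstrass (l + 2) s $ m
        + (\<Sum>k\<in>K. \<Sum>i=0..m. fls_const (f k $ i) * weierstrass k s $ (m - i)) + fls_const (g $ m))"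
  have h: "?h s = (weierstrass 1 s * weierstrass l s) $ m
    - (fps_const (fls_const c) * weierstrass (l + 2) s + (\<Sum>k\<in>K. fps_lift (f k) * weierstrass k s) + fps_lift g) $ m" for s
  proof -
    have lift: "(fps_lift (f k) * weierstrass k s) $ m = (\<Sum>i=0..m. fls_const (f k $ i) * weierstrass k s $ (m - i))" for k
      by (simp add: fps_mult_nth)
    show ?thesis
      unfolding fps_add_nth fps_sum_nth fps_mult_left_const_nth lift fps_lift_nth fps_mult_nth[of "weierstrass 1 s"] ..
  qed
  have "rational_fun ?h"
    by (intro rational_fun_diff rational_fun_add rational_fun_sum rational_fun_mult
        rational_fun_weierstrass rational_fun_const)
  moreover have "?h fls_X = 0" unfolding h assms(1) by (rule diff_self)
  ultimately have "?h s = 0" using s by (rule rational_fun_zero)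
  then show "(weierstrass 1 s * weierstrass l s) $ m =
      (fps_const (fls_const c) * weierstrass (l + 2) s + (\<Sum>k\<in>K. fps_lift (f k) * weierstrass k s) + fps_lift g) $ m"
    unfolding h by simp
qed

text \<open>\<open>weierstrass 1\<close> is the Weierstrass function plus a multiple of E2, so its
  differential equation acquires a linear term. The constant 1 / 24 here and 1 / 240, 1 / 504 below
  complete divisor sums to Eisenstein series; the last summand is the Fourier coefficient at j =
  0.\<close>

lemma weierstrass_product_X_1:
  "weierstrass 1 fls_X * weierstrass 1 fls_X
    = fps_const (fls_const (1 / 6)) * weierstrass (1 + 2) fls_X
      + (\<Sum>k\<in>{1}. fps_lift (4 * (divisor_series 1 0 - fps_const (1 / 24))) * weierstrass k fls_X)
      + fps_lift (theta (moment 1))" (is "?L = ?R")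
proof (rule eps_coeff_eqI)
  fix j
  show "eps_coeff j ?L = eps_coeff j ?R"
  proof (cases "j = 0")
    case True
    then show ?thesis
      using eps_coeff_weierstrass_product_X[of 1 0] kap_convolution_0[of 1]
      by (simp add: eps_coeff_add eps_coeff_const_mult eps_coeff_lift_mult eps_coeff_lift
          eps_coeff_weierstrass_X del: One_nat_def)
  next
    case False
    have c: "fps_const (of_int j ^ 3 / 6 - of_int j / 6) = fps_const (1 / 6) * fps_const (of_int j ^ 3)
        - 4 * fps_const (1 / 24) * fps_const (of_int j :: rat)"
      by (simp add: numeral_fps_const)
    have "eps_coeff j ?R = fps_const (1 / 6) * (fps_const (of_int j ^ 3) * kap 1 j)
        + 4 * (divisor_series 1 0 - fps_const (1 / 24)) * (fps_const (of_int j) * kap 1 j)"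
    proof -
      have "weierstrass (1 + 2) fls_X = weierstrass 3 fls_X" by (simp add: numeral_3_eq_3)
      then show ?thesis using False eps_coeff_weierstrass_X[of 1 j] eps_coeff_weierstrass_X[of 3 j]
        by (simp add: eps_coeff_add eps_coeff_const_mult eps_coeff_lift_mult eps_coeff_lift del: One_nat_def)
    qed
    also have "\<dots> = kap_convolution 1 j"
      unfolding kap_convolution_1[OF False] c by (simp only: algebra_simps)
    finally show ?thesis using eps_coeff_weierstrass_product_X[of 1 j] by simp
  qed
qed

lemma weierstrass_product_X_3:
  "weierstrass 1 fls_X * weierstrass 3 fls_X
    = fps_const (fls_const (1 / 20)) * weierstrass (3 + 2) fls_X
      + (\<Sum>k\<in>{1, 3}. fps_lift (if k = 3 then 2 * (divisor_series 1 0 - fps_const (1 / 24))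
          else 8 * (divisor_series 3 0 + fps_const (1 / 240))) * weierstrass k fls_X)
      + fps_lift (theta (moment 3))" (is "?L = ?R")
proof (rule eps_coeff_eqI)
  fix j
  show "eps_coeff j ?L = eps_coeff j ?R"
  proof (cases "j = 0")
    case True
    then show ?thesis
      using eps_coeff_weierstrass_product_X[of 3 0] kap_convolution_0[of 3] eps_coeff_weierstrass_X[of 1 0]
      by (simp add: eps_coeff_add eps_coeff_const_mult eps_coeff_lift_mult eps_coeff_lift
          eps_coeff_weierstrass_X)
  next
    case False
    have c: "fps_const (of_int j ^ 5 / 20 - of_int j ^ 3 / 12 + of_int j / 30)
      = fps_const (1 / 20) * fps_const (of_int j ^ 5) - 2 * fps_const (1 / 24) * fps_const (of_int j ^ 3)
        + 8 * fps_const (1 / 240) * fps_const (of_int j :: rat)"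
      by (simp add: numeral_fps_const)
    have "eps_coeff j ?R = fps_const (1 / 20) * (fps_const (of_int j ^ 5) * kap 1 j)
        + 2 * (divisor_series 1 0 - fps_const (1 / 24)) * (fps_const (of_int j ^ 3) * kap 1 j)
        + 8 * (divisor_series 3 0 + fps_const (1 / 240)) * (fps_const (of_int j) * kap 1 j)"
      using False eps_coeff_weierstrass_X[of 1 j]
      by (simp add: eps_coeff_add eps_coeff_const_mult eps_coeff_lift_mult eps_coeff_lift eps_coeff_sum
          eps_coeff_weierstrass_X)
    also have "\<dots> = kap_convolution 3 j"
      unfolding kap_convolution_3[OF False] c by (simp only: algebra_simps)
    finally show ?thesis using eps_coeff_weierstrass_product_X[of 3 j] by simp
  qed
qed

lemma weierstrass_product_X_5:
  "weierstrass 1 fls_X * weierstrass 5 fls_X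
    = fps_const (fls_const (1 / 42)) * weierstrass (5 + 2) fls_X
      + (\<Sum>k\<in>{1, 3, 5}. fps_lift (if k = 5 then 2 * (divisor_series 1 0 - fps_const (1 / 24))
          else if k = 3 then 20 * (divisor_series 3 0 + fps_const (1 / 240))
          else 12 * (divisor_series 5 0 - fps_const (1 / 504))) * weierstrass k fls_X)
      + fps_lift (theta (moment 5))" (is "?L = ?R")
proof (rule eps_coeff_eqI)
  fix j
  show "eps_coeff j ?L = eps_coeff j ?R"
  proof (cases "j = 0")
    case True
    then show ?thesis
      using eps_coeff_weierstrass_product_X[of 5 0] kap_convolution_0[of 5] eps_coeff_weierstrass_X[of 1 0]
      by (simp add: eps_coeff_add eps_coeff_const_mult eps_coeff_lift_mult eps_coeff_lift
          eps_coeff_weierstrass_X)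
  next
    case False
    have c: "fps_const (of_int j ^ 7 / 42 - of_int j ^ 5 / 12 + of_int j ^ 3 / 12 - of_int j / 42)
      = fps_const (1 / 42) * fps_const (of_int j ^ 7) - 2 * fps_const (1 / 24) * fps_const (of_int j ^ 5)
        + 20 * fps_const (1 / 240) * fps_const (of_int j ^ 3) - 12 * fps_const (1 / 504) * fps_const (of_int j :: rat)"
      by (simp add: numeral_fps_const)
    have "eps_coeff j ?R = fps_const (1 / 42) * (fps_const (of_int j ^ 7) * kap 1 j)
        + 2 * (divisor_series 1 0 - fps_const (1 / 24)) * (fps_const (of_int j ^ 5) * kap 1 j)
        + 20 * (divisor_series 3 0 + fps_const (1 / 240)) * (fps_const (of_int j ^ 3) * kap 1 j)
        + 12 * (divisor_series 5 0 - fps_const (1 / 504)) * (fps_const (of_int j) * kap 1 j)"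
      using False eps_coeff_weierstrass_X[of 1 j]
      by (simp add: eps_coeff_add eps_coeff_const_mult eps_coeff_lift_mult eps_coeff_lift eps_coeff_sum
          eps_coeff_weierstrass_X)
    also have "\<dots> = kap_convolution 5 j"
      unfolding kap_convolution_5[OF False] c by (simp only: algebra_simps)
    finally show ?thesis using eps_coeff_weierstrass_product_X[of 5 j] by simp
  qed
qed

section \<open>Eisenstein series and their derivatives\<close>

definition fexp :: "'k::field_char_0 \<Rightarrow> 'k fls" where
  "fexp c = fps_to_fls (fps_exp c)"

lemma fexp_nth: "fexp c $$ n = (if n < 0 then 0 else c ^ nat n / fact (nat n))"
  by (simp add: fexp_def)

lemma fexp_0 [simp]: "fexp 0 = 1"
  by (simp add: fexp_def)

lemma fexp_add: "fexp (a + b) = fexp a * fexp b"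
  by (simp add: fexp_def fps_exp_add_mult fls_times_fps_to_fls)

lemma fexp_minus: "fexp (- a) = inverse (fexp a)"
proof -
  have "fexp a * fexp (- a) = 1" using fexp_add[of a "- a"] by simp
  then show ?thesis by (rule inverse_unique[symmetric])
qed

lemma fexp_diff: "fexp (a - b) = fexp a / fexp b"
  using fexp_add[of a "- b"] by (simp add: fexp_minus divide_inverse)

lemma fexp_eq_iff [simp]: "fexp a = fexp b \<longleftrightarrow> a = b"
  by (simp add: fexp_def)

lemma fexp_neq_0 [simp]: "fexp a \<noteq> 0"
  by (simp add: fexp_def)

lemma fexp_eq_1_iff [simp]: "fexp a = 1 \<longleftrightarrow> a = 0"
  using fexp_eq_iff[of a 0] by (simp del: fexp_eq_iff)

lemma fexp_power: "fexp a ^ n = fexp (of_nat n * a)"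
  by (induction n) (simp_all add: fexp_add algebra_simps)

lemma fexp_power_int: "fexp a powi n = fexp (of_int n * a)"
  by (cases n rule: int_cases2) (simp_all add: fexp_power power_int_minus fexp_minus power_inverse)

lemma fls_deriv_fexp: "fls_deriv (fexp a) = fls_const a * fexp a"
  by (simp only: fexp_def fls_deriv_fps_to_fls fps_exp_deriv fls_times_fps_to_fls fps_const_to_fls)

text \<open>\<open>bern k\<close> is the Bernoulli number \<open>B k / fact k\<close>.\<close>

definition bern :: "nat \<Rightarrow> rat" where
  "bern k = inverse (Abs_fps (\<lambda>n. 1 / fact (n + 1))) $ k"

lemma bern_recurrence: "(\<Sum>i=0..n. bern (n - i) / fact (i + 1)) = (if n = 0 then 1 else 0)"
proof -
  let ?h = "Abs_fps (\<lambda>n. 1 / fact (n + 1)) :: rat fps"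
  have "?h * inverse ?h = 1" by (rule inverse_mult_eq_1') simp
  then have "(?h * inverse ?h) $ n = (if n = 0 then 1 else 0)" by (simp only: fps_one_nth)
  then have "(\<Sum>i=0..n. ?h $ i * bern (n - i)) = (if n = 0 then 1 else 0)"
    unfolding fps_mult_nth bern_def .
  then show ?thesis by (simp add: mult.commute del: fact_Suc)
qed

text \<open>The generating function x / (exp(x) - 1) of the Bernoulli numbers at x = c \<epsilon>,
  divided by -x. The power c^n is written as c^(n+1) / c to include the pole n = -1.\<close>

lemma inverse_one_minus_fexp_nth:
  assumes "c \<noteq> 0"
  shows "inverse (1 - fexp c) $$ n = (if n < - 1 then 0 else - (c ^ nat (n + 1) / c) * bern (nat (n + 1)))"
proof -
  let ?H = "Abs_fps (\<lambda>n. c ^ n / fact (n + 1))" and ?B = "Abs_fps (\<lambda>n. c ^ n * bern n)"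
  have HB: "?H * ?B = 1"
  proof (rule fps_ext)
    fix n
    have "(?H * ?B) $ n = (\<Sum>i=0..n. c ^ n * (bern (n - i) / fact (i + 1)))"
      unfolding fps_mult_nth by (intro sum.cong refl) (simp flip: power_add del: fact_Suc)
    also have "\<dots> = 1 $ n" unfolding sum_distrib_left[symmetric] bern_recurrence by simp
    finally show "(?H * ?B) $ n = 1 $ n" .
  qed
  have "1 - fps_exp c = fps_const (- c) * fps_X * ?H"
  proof (rule fps_ext)
    fix n show "(1 - fps_exp c) $ n = (fps_const (- c) * fps_X * ?H) $ n"
      by (cases n) (simp_all add: mult.assoc del: fact_Suc)
  qed
  then have "(1 - fps_exp c) * (fps_const (- 1 / c) * ?B) = fps_X * (fps_const (- c) * fps_const (- 1 / c)) * (?H * ?B)"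
    by (simp only: mult_ac)
  moreover have "fps_const (- c) * fps_const (- 1 / c) = 1" using assms by simp
  ultimately have 1: "(1 - fps_exp c) * (fps_const (- 1 / c) * ?B) = fps_X"
    by (simp only: HB mult_1_right)
  have "(1 - fexp c) * (fps_to_fls (fps_const (- 1 / c) * ?B) * fls_X_inv)
      = fps_to_fls ((1 - fps_exp c) * (fps_const (- 1 / c) * ?B)) * fls_X_inv"
    by (simp only: fexp_def fls_times_fps_to_fls fps_to_fls_minus fps_one_to_fls mult.assoc)
  also have "\<dots> = 1" unfolding 1 fps_X_to_fls by (simp add: fls_X_times_conv_shift fls_X_inv_times_conv_shift)
  finally have "inverse (1 - fexp c) = fps_to_fls (fps_const (- 1 / c) * ?B) * fls_X_inv"
    by (rule inverse_unique)
  then show ?thesis by (auto simp: fls_X_inv_times_conv_shift)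
qed

text \<open>Compare coefficients in 1 / (1 - w) + 1 / (1 - 1 / w) = 1 at w =
  exp(\<epsilon>).\<close>

lemma bern_odd: "bern k * ((- 1) ^ k - 1) = (if k = 1 then 1 else 0)"
proof -
  have "inverse (1 - w) + inverse (1 - inverse w) = 1" if "w \<noteq> 0" "w \<noteq> 1" for w :: "rat fls"
  proof -
    have "inverse (1 - w) = 1 - inverse (1 - inverse w)" using that by (simp add: field_simps)
    then show ?thesis by simp
  qed
  then have "inverse (1 - fexp (1 :: rat)) + inverse (1 - fexp (- 1)) = 1"
    by (simp add: fexp_minus)
  then have "(inverse (1 - fexp (1 :: rat)) + inverse (1 - fexp (- 1))) $$ (int k - 1) = 1 $$ (int k - 1)"
    by simp
  then show ?thesis by (auto simp: inverse_one_minus_fexp_nth algebra_simps split: if_splits)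
qed

lemma bern_odd_eq_0: "odd k \<Longrightarrow> k \<noteq> 1 \<Longrightarrow> bern k = 0"
  using bern_odd[of k] by simp

lemma bern_values: "bern 0 = 1" "bern 1 = - 1 / 2" "bern 2 = 1 / 12" "bern 4 = - 1 / 720" "bern 6 = 1 / 30240"
proof -
  have odd: "bern 3 = 0" "bern 5 = 0" by (rule bern_odd_eq_0; simp)+
  show 0: "bern 0 = 1" using bern_recurrence[of 0] by simp
  show 1: "bern 1 = - 1 / 2" using bern_odd[of 1] by simp
  have "{0..2} = {0, 1, 2 :: nat}" "{0..4} = {0, 1, 2, 3, 4 :: nat}" "{0..6} = {0, 1, 2, 3, 4, 5, 6 :: nat}"
    by auto
  note sets = this
  show 2: "bern 2 = 1 / 12" using bern_recurrence[of 2] 0 1 unfolding sets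
    by (simp add: fact_numeral)
  show 4: "bern 4 = - 1 / 720" using bern_recurrence[of 4] 0 1 2 odd unfolding sets
    by (simp add: fact_numeral)
  show "bern 6 = 1 / 30240" using bern_recurrence[of 6] 0 1 2 4 odd unfolding sets
    by (simp add: fact_numeral)
qed

text \<open>The Eisenstein series scaled so that its higher coefficients are plain divisor sums; the
  constant term is -B / (2k), where B is the k-th Bernoulli number.\<close>

definition eisenstein :: "nat \<Rightarrow> rat fps" where
  "eisenstein k = fps_const (- bern k * fact (k - 1) / 2) + divisor_series (k - 1) 0"

lemma eisenstein_values:
  "eisenstein 2 = divisor_series 1 0 - fps_const (1 / 24)"
  "eisenstein 4 = divisor_series 3 0 + fps_const (1 / 240)"
  "eisenstein 6 = divisor_series 5 0 - fps_const (1 / 504)"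
  unfolding eisenstein_def bern_values by (simp_all add: fact_numeral flip: fps_const_neg)

lemma divisor_series_nth_power_sum:
  "divisor_series k 0 $ n = (if n = 0 then 0 else of_nat (divisor_power_sum k n))"
  by (simp add: divisor_series_def divisor_power_sum_def)

lemma E_eisenstein:
  "E2 = fps_const (- 24) * eisenstein 2" "E4 = fps_const 240 * eisenstein 4"
  "E6 = fps_const (- 504) * eisenstein 6"
  unfolding eisenstein_values E2_def E4_def E6_def
  by (rule fps_ext; simp add: divisor_series_nth_power_sum)+

lemma quasimodular_form_eisenstein_246:
  "quasimodular_form 2 (eisenstein 2)" "quasimodular_form 4 (eisenstein 4)" "quasimodular_form 6 (eisenstein 6)"
  using quasimodular_form_const_mult[OF quasimodular_form_E2, of "- 1 / 24"]
    quasimodular_form_const_mult[OF quasimodular_form_E4, of "1 / 240"]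
    quasimodular_form_const_mult[OF quasimodular_form_E6, of "- 1 / 504"]
  unfolding E_eisenstein by (simp_all flip: mult.assoc)

text \<open>At s = exp(\<epsilon>) the derivation s d/ds is d/d\<epsilon>; differentiating l times
  produces the rising factorial.\<close>

lemma polylog_exp_nth:
  "polylog l (fexp 1) $$ n = pochhammer (of_int n + 1) l * inverse (1 - fexp (1 :: rat)) $$ (n + int l)"
proof (induction l arbitrary: n)
  case 0
  show ?case by (simp add: polylog_0)
next
  case (Suc l)
  have ne: "fexp (1 :: rat) \<noteq> 1" by simp
  have "polylog (Suc l) (fexp 1) = 1 * fls_deriv (polylog l (fexp 1))"
    by (rule polylog_Suc)
       (simp add: fls_deriv_inverse_one_minus[OF ne] fls_deriv_fexp inverse_one_minus_identity[OF ne])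
  then show ?case by (simp add: Suc.IH pochhammer_rec algebra_simps)
qed

lemma pochhammer_fact_quotient: "pochhammer (of_nat n + 1) l = (fact (n + l) / fact n :: rat)"
proof -
  have "fact n * pochhammer (of_nat n + 1) l = (fact (n + l) :: rat)"
  proof (induction l)
    case (Suc l)
    have "fact n * pochhammer (of_nat n + 1) (Suc l)
        = (fact n * pochhammer (of_nat n + 1) l) * (of_nat n + 1 + of_nat l :: rat)"
      by (simp only: pochhammer_Suc mult_ac)
    also have "\<dots> = fact (n + Suc l)" unfolding Suc.IH by (simp add: algebra_simps)
    finally show ?case .
  qed simp
  then show ?thesis by (simp add: field_simps)
qed

lemma eps_coeff_weierstrass_exp:
  assumes "odd l"
  shows "eps_coeff n (weierstrass l (fexp 1)) =
    (if n = - int (l + 1) then fps_const (fact l)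
     else if n \<ge> 0 \<and> even n then fps_const (2 / fact (nat n)) * eisenstein (nat n + l + 1) else 0)"
proof (rule fps_ext)
  fix m
  have l: "l > 0" using assms by (simp add: odd_pos)
  have const: "polylog l (fexp 1) $$ n = (if n = - int (l + 1) then fact l
     else if n \<ge> 0 \<and> even n then - (fact (nat n + l) / fact (nat n)) * bern (nat n + l + 1) else 0)"
  proof (cases "n \<ge> 0")
    case True
    \<comment> \<open>For odd n the index is odd and larger than 1.\<close>
    have b: "bern (nat n + l + 1) = 0" if "odd n"
      by (rule bern_odd_eq_0) (use that assms True l in \<open>auto simp: even_nat_iff\<close>)
    have "pochhammer (of_int n + 1) l = (fact (nat n + l) / fact (nat n) :: rat)"
      using pochhammer_fact_quotient[of "nat n" l] True by simp
    moreover have "nat (n + int l + 1) = nat n + l + 1" using True by simp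
    ultimately show ?thesis using True b unfolding polylog_exp_nth
      by (auto simp: inverse_one_minus_fexp_nth)
  next
    case neg: False
    show ?thesis
    proof (cases "n \<ge> - int l")
      case True
      \<comment> \<open>For -l \<le> n < 0 the rising factorial contains the factor 0, so the only
        polar term is the one at -l - 1.\<close>
      then have "(of_int n + 1 :: rat) = - of_nat (nat (- n - 1))" using neg by simp
      moreover have "nat (- n - 1) < l" using True neg by simp
      ultimately have "pochhammer (of_int n + 1 :: rat) l = 0" by (simp only: pochhammer_of_nat_eq_0_iff)
      then show ?thesis using True neg unfolding polylog_exp_nth by simp
    next
      case False
      show ?thesis
      proof (cases "n = - int (l + 1)")
        case True
        then have "(of_int n + 1 :: rat) = - of_nat l" by simp
        moreover have "n + int l = - 1" using True by simp
        ultimately show ?thesis using True assms unfolding polylog_exp_nth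
          by (simp add: pochhammer_same inverse_one_minus_fexp_nth bern_values)
      next
        case ne: False
        then have "n + int l < - 1" using False by simp
        then show ?thesis using ne neg unfolding polylog_exp_nth by (simp add: inverse_one_minus_fexp_nth)
      qed
    qed
  qed
  show "eps_coeff n (weierstrass l (fexp 1)) $ m =
    (if n = - int (l + 1) then fps_const (fact l)
     else if n \<ge> 0 \<and> even n then fps_const (2 / fact (nat n)) * eisenstein (nat n + l + 1) else 0) $ m"
  proof (cases "m = 0")
    case True
    then show ?thesis by (simp add: weierstrass_nth const eisenstein_def divisor_series_def)
  next
    case False
    have "eps_coeff n (weierstrass l (fexp 1)) $ m
      = (\<Sum>a | a dvd m. of_nat a ^ l * (fexp (of_nat a) $$ n + fexp (- of_nat a) $$ n))"
      using False by (simp add: weierstrass_nth fls_nth_sum fexp_power flip: power_inverse fexp_minus)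
    also have "\<dots> = (if n \<ge> 0 \<and> even n then 2 / fact (nat n) * (\<Sum>a | a dvd m. of_nat a ^ (nat n + l)) else 0)"
      by (auto simp: fexp_nth sum_distrib_left even_nat_iff power_add power_minus_odd intro!: sum.cong sum.neutral)
    finally show ?thesis using False
      by (auto simp: eisenstein_def divisor_series_def)
  qed
qed

lemma fexp_1: "fexp (1 :: rat) \<noteq> 0" "fexp (1 :: rat) \<noteq> 1"
  by simp_all

lemmas weierstrass_product_1 = weierstrass_transfer[OF weierstrass_product_X_1 fexp_1]
lemmas weierstrass_product_3 = weierstrass_transfer[OF weierstrass_product_X_3 fexp_1]
lemmas weierstrass_product_5 = weierstrass_transfer[OF weierstrass_product_X_5 fexp_1]

text \<open>
  The coefficients of the differential equation \<open>\<wp>'' = 6 * \<wp>^2 - g2 / 2\<close>; they express all Eisenstein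
  series by those of weight 4 and 6.
\<close>

lemma eisenstein_recurrence:
  assumes n: "n \<ge> 4" "even n"
  defines "w \<equiv> \<lambda>x. eps_coeff (int x) (weierstrass 1 (fexp 1))"
  shows "fps_const (1 / (3 * fact n) - 4 / fact (n + 2)) * eisenstein (n + 4) = (\<Sum>x=1..<n. w x * w (n - x))"
proof -
  define W where "W = weierstrass 1 (fexp 1)"
  let ?W3 = "weierstrass 3 (fexp 1)"
  let ?w = "\<lambda>x. eps_coeff x W"
  have ec: "eps_coeff x W = (if x = - 2 then 1
     else if x \<ge> 0 \<and> even x then fps_const (2 / fact (nat x)) * eisenstein (nat x + 2) else 0)" for x
  proof -
    have "- int (1 + 1) = - 2" "nat x + 1 + 1 = nat x + 2" by simp_all
    then show ?thesis using eps_coeff_weierstrass_exp[of 1 x] unfolding W_def by (simp only:) simp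
  qed
  have "eps_coeff (int n) (W * W) = (\<Sum>x\<in>{-2..int n - (-2)}. ?w x * ?w (int n - x))"
    by (rule eps_coeff_mult) (auto simp: ec)
  \<comment> \<open>The pole pairs with \<epsilon>^(n+2) and the constant term
    \<open>2 * eisenstein 2\<close> with \<epsilon>^n, each twice. The latter contribution will
    cancel against the linear term of the differential equation.\<close>
  also have "{-2..int n - (-2)} = {-2, -1, 0, int n, int n + 1, int n + 2} \<union> int ` {1..<n}"
  proof -
    have "int ` {1..<n} = {1..<int n}" by (simp add: image_int_atLeastLessThan)
    then show ?thesis using n by auto
  qed
  also have "(\<Sum>x\<in>\<dots>. ?w x * ?w (int n - x)) = (\<Sum>x\<in>{-2, -1, 0, int n, int n + 1, int n + 2}. ?w x * ?w (int n - x))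
      + (\<Sum>x\<in>int ` {1..<n}. ?w x * ?w (int n - x))"
    by (rule sum.union_disjoint) auto
  also have "(\<Sum>x\<in>int ` {1..<n}. ?w x * ?w (int n - x)) = (\<Sum>x=1..<n. w x * w (n - x))"
    by (subst sum.reindex) (auto simp: w_def W_def of_nat_diff intro!: sum.cong)
  also have "(\<Sum>x\<in>{-2, -1, 0, int n, int n + 1, int n + 2}. ?w x * ?w (int n - x))
      = 2 * ?w (int n + 2) + 2 * (?w 0 * ?w (int n))"
    using n by (simp add: ec[of "- 2"] ec[of "- 1"])
  also have "?w 0 = 2 * eisenstein 2" using ec[of 0] by (simp add: numeral_fps_const flip: numeral_2_eq_2)
  finally have lhs: "eps_coeff (int n) (W * W)
      = 2 * ?w (int n + 2) + 4 * (eisenstein 2 * ?w (int n)) + (\<Sum>x=1..<n. w x * w (n - x))"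
    by simp
  have "eps_coeff (int n) (W * W) = fps_const (1 / 6) * eps_coeff (int n) ?W3 + 4 * (eisenstein 2 * ?w (int n))"
  proof -
    have "weierstrass (1 + 2) (fexp 1) = ?W3" by (simp add: numeral_3_eq_3)
    then have "W * W = fps_const (fls_const (1 / 6)) * ?W3 + fps_lift (4 * eisenstein 2) * W + fps_lift (theta (moment 1))"
      using weierstrass_product_1 unfolding eisenstein_values W_def by simp
    then show ?thesis using n
      by (simp add: eps_coeff_add eps_coeff_const_mult eps_coeff_lift_mult eps_coeff_lift mult.assoc)
  qed
  also have "eps_coeff (int n) ?W3 = fps_const (2 / fact n) * eisenstein (n + 4)"
  proof -
    have "nat (int n) + 3 + 1 = n + 4" by simp
    then show ?thesis using eps_coeff_weierstrass_exp[of 3 "int n"] n by (simp only:) simp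
  qed
  finally have rhs: "eps_coeff (int n) (W * W)
      = fps_const (1 / 6) * (fps_const (2 / fact n) * eisenstein (n + 4)) + 4 * (eisenstein 2 * ?w (int n))" .
  have wn2: "?w (int n + 2) = fps_const (2 / fact (n + 2)) * eisenstein (n + 4)"
  proof -
    have "nat (int n + 2) = n + 2" by simp
    then show ?thesis using ec[of "int n + 2"] n by (simp only:) (simp add: eval_nat_numeral)
  qed
  have "(\<Sum>x=1..<n. w x * w (n - x)) = fps_const (1 / 6) * (fps_const (2 / fact n) * eisenstein (n + 4))
      - 2 * (fps_const (2 / fact (n + 2)) * eisenstein (n + 4))"
    using lhs rhs unfolding wn2 by (simp add: algebra_simps)
  also have "\<dots> = (fps_const (1 / 6) * fps_const (2 / fact n) - 2 * fps_const (2 / fact (n + 2))) * eisenstein (n + 4)"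
    by (simp only: left_diff_distrib mult.assoc)
  also have "fps_const (1 / 6) * fps_const (2 / fact n) - 2 * fps_const (2 / fact (n + 2))
      = fps_const (1 / (3 * fact n) - 4 / fact (n + 2) :: rat)"
    by (simp add: numeral_fps_const del: fact_Suc)
  finally show ?thesis by simp
qed

lemma quasimodular_form_eisenstein:
  "k \<ge> 2 \<Longrightarrow> even k \<Longrightarrow> quasimodular_form k (eisenstein k)"
proof (induction k rule: less_induct)
  case (less k)
  show ?case
  proof (cases "k < 8")
    case True
    then have "k = 2 \<or> k = 4 \<or> k = 6" using less.prems by (auto elim!: evenE)
    then show ?thesis using quasimodular_form_eisenstein_246 by auto
  next
    case False
    define n where "n = k - 4"
    have n: "n \<ge> 4" "even n" "k = n + 4" using False less.prems by (auto simp: n_def)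
    let ?w = "\<lambda>x. eps_coeff (int x) (weierstrass 1 (fexp 1))"
    have w: "quasimodular_form (x + 2) (?w x)" if "x < n" for x
    proof (cases "even x")
      case True
      have "quasimodular_form (x + 2) (eisenstein (x + 2))"
        by (rule less.IH) (use that n True in auto)
      then show ?thesis using True
        by (simp add: eps_coeff_weierstrass_exp quasimodular_form_const_mult)
    next
      case False
      then show ?thesis by (simp add: eps_coeff_weierstrass_exp quasimodular_form_0)
    qed
    have "quasimodular_form k (\<Sum>x=1..<n. ?w x * ?w (n - x))"
    proof (rule quasimodular_form_sum)
      fix x assume x: "x \<in> {1..<n}"
      have "quasimodular_form ((x + 2) + (n - x + 2)) (?w x * ?w (n - x))"
        by (intro quasimodular_form_mult w) (use x in auto)
      moreover have "(x + 2) + (n - x + 2) = k" using x n(3) by simp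
      ultimately show "quasimodular_form k (?w x * ?w (n - x))" by simp
    qed
    then have *: "quasimodular_form k (fps_const (1 / (3 * fact n) - 4 / fact (n + 2)) * eisenstein k)"
      using eisenstein_recurrence[OF n(1,2)] n(3) by (simp only:)
    have f: "fact (n + 2) = (of_nat (n + 2) * of_nat (n + 1) * fact n :: rat)"
      by (simp add: algebra_simps)
    \<comment> \<open>The factor in the recurrence vanishes only for (n + 2) (n + 1) = 12, that is
      for n = 2 and weight 6, where E6 is itself a generator.\<close>
    have "(of_nat ((n + 2) * (n + 1)) :: rat) \<noteq> of_nat 12"
    proof -
      have "6 * 5 \<le> (n + 2) * (n + 1)" by (rule mult_le_mono) (use n(1) in auto)
      then show ?thesis unfolding of_nat_eq_iff by simp
    qed
    then have ne: "of_nat (n + 2) * of_nat (n + 1) \<noteq> (12 :: rat)" by (simp only: of_nat_mult of_nat_numeral not_False_eq_True)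
    have nz: "1 / (3 * fact n) - 4 / fact (n + 2) \<noteq> (0 :: rat)"
    proof
      assume "1 / (3 * fact n) - 4 / fact (n + 2) = (0 :: rat)"
      then have "fact (n + 2) = (12 * fact n :: rat)" by (simp add: frac_eq_eq del: fact_Suc)
      then have "of_nat (n + 2) * of_nat (n + 1) * fact n = (12 * fact n :: rat)" unfolding f .
      then have "of_nat (n + 2) * of_nat (n + 1) = (12 :: rat)"
        by (rule mult_right_cancel[OF fact_nonzero, THEN iffD1])
      then show False using ne by contradiction
    qed
    show ?thesis
      using quasimodular_form_const_mult[OF *, of "inverse (1 / (3 * fact n) - 4 / fact (n + 2))"] nz
      by (simp add: mult.assoc[symmetric] del: fact_Suc)
  qed
qed

lemma homogeneous_weierstrass:
  assumes "odd l"
  shows "homogeneous (- int (l + 1)) (weierstrass l (fexp 1))"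
  unfolding homogeneous_def
proof (intro conjI allI impI)
  show "eps_coeff k (weierstrass l (fexp 1)) = 0" if "k < - int (l + 1)" for k
    using that assms by (simp add: eps_coeff_weierstrass_exp)
  fix k
  show "quasimodular_form k (eps_coeff (- int (l + 1) + int k) (weierstrass l (fexp 1)))"
  proof (cases "k \<ge> l + 1 \<and> even (- int (l + 1) + int k)")
    case True
    then have k: "nat (- int (l + 1) + int k) + l + 1 = k" by linarith
    have "even k" using True assms by simp
    moreover have "k \<ge> 2" using True odd_pos[OF assms] by simp
    ultimately have "quasimodular_form k (eisenstein k)" by (rule quasimodular_form_eisenstein[rotated])
    then show ?thesis using True
      unfolding eps_coeff_weierstrass_exp[OF assms] k by (simp add: quasimodular_form_const_mult)
  next
    case False
    then show ?thesis
      using assms by (cases "k = 0") (auto simp: eps_coeff_weierstrass_exp quasimodular_form_0 quasimodular_form_const)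
  qed
qed

text \<open>In the product identity for \<open>weierstrass 1\<close> and
  \<open>weierstrass l\<close> all other terms are known to be homogeneous, so the remaining one,
  \<open>theta (moment l)\<close>, is too. Being independent of \<epsilon>, it sits at \<epsilon>^0,
  and the starting exponent -(l + 3) gives its weight.\<close>

lemma quasimodular_form_theta_moment:
  assumes "l \<in> {1, 3, 5}"
  shows "quasimodular_form (l + 3) (theta (moment l))"
proof -
  have lift: "homogeneous (- int (l + 3)) (fps_lift (fps_const c * eisenstein k) * weierstrass l' (fexp 1))"
    if "odd l'" "k \<ge> 2" "even k" "k + l' + 1 = l + 3" for c k l'
  proof -
    have "homogeneous (- int k + - int (l' + 1)) (fps_lift (fps_const c * eisenstein k) * weierstrass l' (fexp 1))"
      using that by (intro homogeneous_mult homogeneous_lift quasimodular_form_const_mult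
          quasimodular_form_eisenstein homogeneous_weierstrass)
    moreover have "- int k + - int (l' + 1) = - int (l + 3)" using that by linarith
    ultimately show ?thesis by (simp only:)
  qed
  have main: "homogeneous (- int (l + 3)) (weierstrass 1 (fexp 1) * weierstrass l (fexp 1)
      - fps_const (fls_const c) * weierstrass (l + 2) (fexp 1))" for c
  proof (rule homogeneous_diff)
    have "homogeneous (- int (1 + 1) + - int (l + 1)) (weierstrass 1 (fexp 1) * weierstrass l (fexp 1))"
      by (intro homogeneous_mult homogeneous_weierstrass) (use assms in auto)
    moreover have "- int (1 + 1) + - int (l + 1) = - int (l + 3)" by simp
    ultimately show "homogeneous (- int (l + 3)) (weierstrass 1 (fexp 1) * weierstrass l (fexp 1))"
      by (simp only:)
    have "homogeneous (- int (l + 2 + 1)) (weierstrass (l + 2) (fexp 1))"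
      by (rule homogeneous_weierstrass) (use assms in auto)
    moreover have "l + 2 + 1 = l + 3" by simp
    ultimately show "homogeneous (- int (l + 3)) (fps_const (fls_const c) * weierstrass (l + 2) (fexp 1))"
      by (intro homogeneous_const_mult) (simp only:)
  qed
  have "homogeneous (- int (l + 3)) (fps_lift (theta (moment l)))"
  proof -
    consider "l = 1" | "l = 3" | "l = 5" using assms by auto
    then show ?thesis
    proof cases
      case 1
      have "homogeneous (- int (l + 3)) (weierstrass 1 (fexp 1) * weierstrass l (fexp 1)
          - fps_const (fls_const (1 / 6)) * weierstrass (l + 2) (fexp 1)
          - fps_lift (fps_const 4 * eisenstein 2) * weierstrass 1 (fexp 1))"
        by (intro homogeneous_diff[OF main lift]) (use 1 in auto)
      then show ?thesis using weierstrass_product_1 unfolding 1 eisenstein_values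
        by (simp add: numeral_fps_const)
    next
      case 2
      have "homogeneous (- int (l + 3)) (weierstrass 1 (fexp 1) * weierstrass l (fexp 1)
          - fps_const (fls_const (1 / 20)) * weierstrass (l + 2) (fexp 1)
          - fps_lift (fps_const 8 * eisenstein 4) * weierstrass 1 (fexp 1)
          - fps_lift (fps_const 2 * eisenstein 2) * weierstrass 3 (fexp 1))"
        by (intro homogeneous_diff[OF homogeneous_diff[OF main lift] lift]) (use 2 in auto)
      then show ?thesis using weierstrass_product_3 unfolding 2 eisenstein_values
        by (simp add: numeral_fps_const algebra_simps)
    next
      case 3
      have "homogeneous (- int (l + 3)) (weierstrass 1 (fexp 1) * weierstrass l (fexp 1)
          - fps_const (fls_const (1 / 42)) * weierstrass (l + 2) (fexp 1)
          - fps_lift (fps_const 12 * eisenstein 6) * weierstrass 1 (fexp 1)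
          - fps_lift (fps_const 20 * eisenstein 4) * weierstrass 3 (fexp 1)
          - fps_lift (fps_const 2 * eisenstein 2) * weierstrass 5 (fexp 1))"
        by (intro homogeneous_diff[OF homogeneous_diff[OF homogeneous_diff[OF main lift] lift] lift]) (use 3 in auto)
      then show ?thesis using weierstrass_product_5 unfolding 3 eisenstein_values
        by (simp add: numeral_fps_const algebra_simps)
    qed
  qed
  then have "quasimodular_form (l + 3) (eps_coeff (- int (l + 3) + int (l + 3)) (fps_lift (theta (moment l))))"
    unfolding homogeneous_def by blast
  then show ?thesis by (simp add: eps_coeff_lift)
qed

section \<open>Closure under q d/dq\<close>

lemma theta_const_mult: "theta (fps_const c * f) = fps_const c * theta f"
  by (rule fps_ext) simp

lemma theta_eisenstein: "theta (eisenstein (Suc k)) = theta (divisor_series k 0)"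
  by (rule fps_ext) (simp add: eisenstein_def)

text \<open>Ramanujan's differential equations, up to explicit coefficients: for k = 1, 3, 5,
  \<open>moment k\<close> is twice the nonconstant part of
  \<open>eisenstein (k + 1)\<close>.\<close>

lemma quasimodular_form_theta_E:
  "quasimodular_form 4 (theta E2)" "quasimodular_form 6 (theta E4)" "quasimodular_form 8 (theta E6)"
proof -
  have *: "quasimodular_form (k + 3) (theta (fps_const c * eisenstein (Suc k)))" if "k \<in> {1, 3, 5}" for k c
  proof -
    have "moment k = fps_const 2 * divisor_series k 0" using that by (auto simp: moment_def numeral_fps_const)
    then have "theta (fps_const c * eisenstein (Suc k)) = fps_const (c / 2) * theta (moment k)"
      by (simp add: theta_const_mult theta_eisenstein flip: mult.assoc)
    then show ?thesis using quasimodular_form_theta_moment[OF that] quasimodular_form_const_mult by simp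
  qed
  show "quasimodular_form 4 (theta E2)" "quasimodular_form 6 (theta E4)" "quasimodular_form 8 (theta E6)"
    using *[of 1 "- 24"] *[of 3 240] *[of 5 "- 504"] unfolding E_eisenstein by (simp_all add: eval_nat_numeral)
qed

lemma quasimodular_form_theta_mult:
  assumes "quasimodular_form v f" "quasimodular_form w g"
    "quasimodular_form (v + 2) (theta f)" "quasimodular_form (w + 2) (theta g)"
  shows "quasimodular_form (v + w + 2) (theta (f * g))"
proof -
  have "quasimodular_form (v + 2 + w) (theta f * g)" "quasimodular_form (v + (w + 2)) (f * theta g)"
    by (intro quasimodular_form_mult assms)+
  moreover have "v + 2 + w = v + w + 2" "v + (w + 2) = v + w + 2" by simp_all
  ultimately show ?thesis unfolding theta_mult by (simp only: quasimodular_form_add)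
qed

lemma quasimodular_form_theta_power:
  assumes "quasimodular_form w f" "quasimodular_form (w + 2) (theta f)"
  shows "quasimodular_form (n * w + 2) (theta (f ^ n))"
proof (induction n)
  case 0
  have "theta (1 :: rat fps) = 0" by (rule fps_ext) (simp add: fps_one_nth)
  then show ?case by (simp add: quasimodular_form_0)
next
  case (Suc n)
  have "quasimodular_form (w + n * w + 2) (theta (f * f ^ n))"
    by (intro quasimodular_form_theta_mult assms quasimodular_form_power Suc.IH)
  then show ?case by simp
qed

lemma quasimodular_form_theta:
  assumes "quasimodular_form w f"
  shows "quasimodular_form (w + 2) (theta f)"
proof -
  obtain c where f:
    "f = (\<Sum>(i, j, k) | 2 * i + 4 * j + 6 * k = w. fps_const (c i j k) * E2 ^ i * E4 ^ j * E6 ^ k)"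
    using assms unfolding quasimodular_form_def by blast
  have theta_sum: "theta (sum g A) = (\<Sum>x\<in>A. theta (g x))" for g :: "'a \<Rightarrow> rat fps" and A
    by (rule fps_ext) (simp add: fps_sum_nth sum_distrib_left)
  have "quasimodular_form (w + 2) (theta (fps_const (c i j k) * E2 ^ i * E4 ^ j * E6 ^ k))"
    if "2 * i + 4 * j + 6 * k = w" for i j k
  proof -
    have p: "quasimodular_form (i * 2 + 2) (theta (E2 ^ i))" "quasimodular_form (j * 4 + 2) (theta (E4 ^ j))"
      "quasimodular_form (k * 6 + 2) (theta (E6 ^ k))"
      by (rule quasimodular_form_theta_power;
          simp add: quasimodular_form_E2 quasimodular_form_E4 quasimodular_form_E6 quasimodular_form_theta_E)+
    have "quasimodular_form (i * 2 + j * 4 + k * 6 + 2) (theta (E2 ^ i * E4 ^ j * E6 ^ k))"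
      by (intro quasimodular_form_theta_mult quasimodular_form_mult quasimodular_form_power p
          quasimodular_form_E2 quasimodular_form_E4 quasimodular_form_E6)
    moreover have "i * 2 + j * 4 + k * 6 + 2 = w + 2" using that by simp
    ultimately show ?thesis by (simp add: mult.assoc theta_const_mult quasimodular_form_const_mult)
  qed
  then show ?thesis unfolding f theta_sum by (intro quasimodular_form_sum) auto
qed

lemma theta_divisor_series: "theta (divisor_series i j) = divisor_series (Suc i) (Suc j)"
proof (rule fps_ext)
  fix m
  show "theta (divisor_series i j) $ m = divisor_series (Suc i) (Suc j) $ m"
  proof (cases "m = 0")
    case False
    have "of_nat m * (\<Sum>a | a dvd m. of_nat a ^ i * of_nat (m div a) ^ j)
        = (\<Sum>a | a dvd m. of_nat a ^ Suc i * of_nat (m div a) ^ Suc j :: rat)"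
      unfolding sum_distrib_left
    proof (rule sum.cong[OF refl])
      fix a assume "a \<in> {a. a dvd m}"
      then have "of_nat m = of_nat a * (of_nat (m div a) :: rat)" by (simp flip: of_nat_mult)
      then show "of_nat m * (of_nat a ^ i * of_nat (m div a) ^ j) = (of_nat a ^ Suc i * of_nat (m div a) ^ Suc j :: rat)"
        by (simp add: mult_ac)
    qed
    then show ?thesis using False by (simp add: divisor_series_def)
  qed (simp add: divisor_series_def)
qed

lemma divisor_series_swap: "divisor_series i j = divisor_series j i"
proof (rule fps_ext)
  fix m
  show "divisor_series i j $ m = divisor_series j i $ m"
  proof (cases "m = 0")
    case False
    have "bij_betw (\<lambda>a. m div a) {a. a dvd m} {a. a dvd m}"
      by (rule bij_betw_byWitness[of _ "\<lambda>a. m div a"]) (use False in \<open>auto simp: dvd_div_eq_mult\<close>)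
    then have "(\<Sum>a | a dvd m. of_nat a ^ i * of_nat (m div a) ^ j)
        = (\<Sum>a | a dvd m. of_nat (m div a) ^ i * of_nat (m div (m div a)) ^ j :: rat)"
      by (rule sum.reindex_bij_betw[symmetric])
    also have "\<dots> = (\<Sum>a | a dvd m. of_nat a ^ j * of_nat (m div a) ^ i)"
      by (intro sum.cong refl) (use False in auto)
    finally show ?thesis using False by (simp add: divisor_series_def)
  qed (simp add: divisor_series_def)
qed

text \<open>Each application of \<open>theta\<close> raises both exponents by 1 and the weight by 2,
  so a mixed divisor series is an iterated derivative of an Eisenstein series, whose weight is even
  because i + j is odd.\<close>

lemma quasimodular_form_divisor_series:
  "odd (i + j) \<Longrightarrow> quasimodular_form (i + j + 3) (divisor_series (Suc i) (Suc j))"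
proof (induction i arbitrary: j)
  case 0
  have "quasimodular_form (Suc j + 2) (theta (eisenstein (Suc j)))"
    by (intro quasimodular_form_theta quasimodular_form_eisenstein) (use 0 in \<open>auto elim: oddE\<close>)
  moreover have "theta (eisenstein (Suc j)) = divisor_series (Suc 0) (Suc j)"
    by (simp add: theta_eisenstein theta_divisor_series divisor_series_swap)
  ultimately show ?case by (simp add: eval_nat_numeral)
next
  case (Suc i)
  show ?case
  proof (cases j)
    case 0
    have "quasimodular_form (Suc (Suc i) + 2) (theta (eisenstein (Suc (Suc i))))"
      by (intro quasimodular_form_theta quasimodular_form_eisenstein) (use Suc.prems 0 in auto)
    then show ?thesis using 0
      by (simp add: theta_eisenstein theta_divisor_series eval_nat_numeral)
  next
    case (Suc j')
    have "quasimodular_form (i + j' + 3 + 2) (theta (divisor_series (Suc i) (Suc j')))"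
      by (intro quasimodular_form_theta Suc.IH) (use Suc.prems Suc in auto)
    then show ?thesis using Suc by (simp add: theta_divisor_series eval_nat_numeral)
  qed
qed

text \<open>For m > 0 the coefficient of q^m is the sum of exp(x) - exp(-x) over m = a b, with x =
  (a \<sigma> + b \<alpha>) \<epsilon>, so only odd powers survive. In the binomial expansion the
  two outer terms combine with the Bernoulli constants to Eisenstein series; the inner ones are
  mixed divisor series.\<close>

lemma eps_coeff_kron:
  assumes "\<sigma> \<noteq> 0" "\<alpha> \<noteq> 0"
  shows "eps_coeff n (kron (fexp \<sigma>) (fexp \<alpha>)) =
    (if n = - 1 then fps_const (- 1 / \<sigma> - 1 / \<alpha>)
     else if n > 0 \<and> odd n then fps_const (2 / fact (nat n)) *
       (fps_const (\<sigma> ^ nat n + \<alpha> ^ nat n) * eisenstein (nat n + 1)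
        + (\<Sum>i=1..<nat n. fps_const (of_nat (nat n choose i) * \<sigma> ^ i * \<alpha> ^ (nat n - i)) * divisor_series i (nat n - i)))
     else 0)" (is "_ = ?R")
proof (rule fps_ext)
  fix m
  have bo: "n \<ge> 0 \<Longrightarrow> even n \<Longrightarrow> n \<noteq> 0 \<Longrightarrow> bern (nat (n + 1)) = 0"
    by (rule bern_odd_eq_0) (auto simp: even_nat_iff)
  show "eps_coeff n (kron (fexp \<sigma>) (fexp \<alpha>)) $ m = ?R $ m"
  proof (cases "m = 0")
    case True
    have "fexp \<sigma> / (1 - fexp \<sigma>) = inverse (1 - fexp \<sigma>) - 1"
      using assms by (simp add: field_simps)
    then have "eps_coeff n (kron (fexp \<sigma>) (fexp \<alpha>)) $ 0
        = inverse (1 - fexp \<alpha>) $$ n + inverse (1 - fexp \<sigma>) $$ n - (if n = 0 then 1 else 0)"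
      by (simp add: kron_def q_sum_kap_reg_nth_0)
    also have "\<dots> = ?R $ 0"
    proof -
      consider "n < - 1" | "n = - 1" | "n = 0" | "n > 0" "even n" | "n > 0" "odd n" by linarith
      then show ?thesis
      proof cases
        case 3
        then show ?thesis using assms by (simp add: inverse_one_minus_fexp_nth bern_values[unfolded One_nat_def])
      next
        case 4
        then show ?thesis using assms bo by (simp add: inverse_one_minus_fexp_nth)
      next
        case 5
        have "nat (n + 1) = Suc (nat n)" using 5 by simp
        then show ?thesis using assms 5
          by (simp add: inverse_one_minus_fexp_nth eisenstein_def divisor_series_def fps_sum_nth algebra_simps)
      qed (use assms in \<open>simp_all add: inverse_one_minus_fexp_nth bern_values\<close>)
    qed
    finally show ?thesis using True by simp
  next
    case False
    have "eps_coeff n (kron (fexp \<sigma>) (fexp \<alpha>)) $ m = (\<Sum>a | a dvd m.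
        fexp (of_nat a * \<sigma> + of_nat (m div a) * \<alpha>) $$ n - fexp (- (of_nat a * \<sigma> + of_nat (m div a) * \<alpha>)) $$ n)"
      using False
      by (simp add: kron_def q_sum_kap_reg_nth fls_nth_sum fexp_power fexp_power_int fexp_add[symmetric]
          flip: power_inverse fexp_minus)
    also have "\<dots> = (if n > 0 \<and> odd n then
        2 / fact (nat n) * (\<Sum>a | a dvd m. (of_nat a * \<sigma> + of_nat (m div a) * \<alpha>) ^ nat n) else 0)"
    proof -
      have neg: "(- x) ^ nat n = (if even n then x ^ nat n else - (x ^ nat n))" if "n \<ge> 0" for x :: rat
        using that by (auto simp: even_nat_iff power_minus_odd)
      have "n \<ge> 0 \<and> odd n \<longleftrightarrow> n > 0 \<and> odd n" by (cases "n = 0") auto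
      then show ?thesis
        unfolding fexp_nth sum_distrib_left
        by (cases "n < 0") (auto simp: neg simp del: minus_add_distrib intro!: sum.cong sum.neutral)
    qed
    finally have lhs: "eps_coeff n (kron (fexp \<sigma>) (fexp \<alpha>)) $ m = (if n > 0 \<and> odd n then
        2 / fact (nat n) * (\<Sum>a | a dvd m. (of_nat a * \<sigma> + of_nat (m div a) * \<alpha>) ^ nat n) else 0)" .
    show ?thesis
    proof (cases "n > 0 \<and> odd n")
      case True
      define N where "N = nat n"
      have N: "N > 0" using True by (simp add: N_def)
      have "(\<Sum>a | a dvd m. (of_nat a * \<sigma> + of_nat (m div a) * \<alpha>) ^ N)
          = (\<Sum>a | a dvd m. \<Sum>i\<le>N. of_nat (N choose i) * \<sigma> ^ i * \<alpha> ^ (N - i) * (of_nat a ^ i * of_nat (m div a) ^ (N - i)))"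
        by (simp add: binomial_ring power_mult_distrib mult_ac)
      also have "\<dots> = (\<Sum>i\<le>N. of_nat (N choose i) * \<sigma> ^ i * \<alpha> ^ (N - i) * divisor_series i (N - i) $ m)"
        using False by (subst sum.swap) (simp add: divisor_series_def sum_distrib_left)
      also have "{..N} = insert 0 (insert N {1..<N})" using N by auto
      also have "(\<Sum>i\<in>insert 0 (insert N {1..<N}). of_nat (N choose i) * \<sigma> ^ i * \<alpha> ^ (N - i) * divisor_series i (N - i) $ m)
          = \<alpha> ^ N * divisor_series 0 N $ m + \<sigma> ^ N * divisor_series N 0 $ m
            + (\<Sum>i=1..<N. of_nat (N choose i) * \<sigma> ^ i * \<alpha> ^ (N - i) * divisor_series i (N - i) $ m)"
        using N by simp
      finally show ?thesis using True False unfolding lhs N_def[symmetric]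
        by (simp add: divisor_series_swap[of 0 N] eisenstein_def fps_sum_nth algebra_simps)
    next
      case nodd: False
      then show ?thesis unfolding lhs using False by auto
    qed
  qed
qed

lemma homogeneous_kron:
  assumes "\<sigma> \<noteq> 0" "\<alpha> \<noteq> 0"
  shows "homogeneous (- 1) (kron (fexp \<sigma>) (fexp \<alpha>))"
  unfolding homogeneous_def
proof (intro conjI allI impI)
  show "eps_coeff k (kron (fexp \<sigma>) (fexp \<alpha>)) = 0" if "k < - 1" for k
    using that by (simp add: eps_coeff_kron[OF assms])
  fix k
  show "quasimodular_form k (eps_coeff (- 1 + int k) (kron (fexp \<sigma>) (fexp \<alpha>)))"
  proof (cases "k \<ge> 2 \<and> even k")
    case True
    define n where "n = k - 1"
    have n: "- 1 + int k = int n" "k = n + 1" "n > 0" "odd n" using True by (auto simp: n_def)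
    have "quasimodular_form k (divisor_series i (n - i))" if i: "i \<in> {1..<n}" for i
    proof -
      have "quasimodular_form ((i - 1) + (n - i - 1) + 3) (divisor_series (Suc (i - 1)) (Suc (n - i - 1)))"
        by (rule quasimodular_form_divisor_series) (use i n(4) in auto)
      moreover have "(i - 1) + (n - i - 1) + 3 = k" "Suc (i - 1) = i" "Suc (n - i - 1) = n - i"
        using i n by auto
      ultimately show ?thesis by simp
    qed
    moreover have "quasimodular_form k (eisenstein (n + 1))"
      using quasimodular_form_eisenstein[of k] True n(2) by simp
    ultimately have "quasimodular_form k (fps_const (2 / fact n) *
       (fps_const (\<sigma> ^ n + \<alpha> ^ n) * eisenstein (n + 1)
        + (\<Sum>i=1..<n. fps_const (of_nat (n choose i) * \<sigma> ^ i * \<alpha> ^ (n - i)) * divisor_series i (n - i))))"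
      by (intro quasimodular_form_const_mult quasimodular_form_add quasimodular_form_sum)
    then show ?thesis using n(3,4) unfolding eps_coeff_kron[OF assms] n(1) by simp
  next
    case False
    then show ?thesis
      by (cases "k = 0") (auto simp: eps_coeff_kron[OF assms] quasimodular_form_0 quasimodular_form_const)
  qed
qed

section \<open>Averaging over the orders of the vertices\<close>

text \<open>The integrand of the simplex weight is the product over the edges of
  \<open>exp (\<alpha> e * (t (src e) - t (tgt e)))\<close>. As outflows are invariant under moving
  an edge, all graphs in Fay's identity share the same weight.\<close>

definition ordered_sum :: "'v set \<Rightarrow> ('e \<Rightarrow> 'v) \<Rightarrow> ('e \<Rightarrow> 'v) \<Rightarrow> ('e \<Rightarrow> rat) \<Rightarrow> ('e \<Rightarrow> rat) \<Rightarrow> 'e set \<Rightarrow> rat fls fps" where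
  "ordered_sum V src tgt \<sigma> \<alpha> E = (\<Sum>xs\<in>permutations_of_set V.
     fps_const (fps_to_fls (simplex_exp (outflow E src tgt \<alpha>) xs)) *
     flow_sum (list_pos xs) src tgt (\<lambda>e. fexp (\<sigma> e)) (\<lambda>e. fexp (\<alpha> e)) E)"

text \<open>
  Linear independence over the integers of bounded height. Full independence is impossible for two
  rational numbers, and it is not needed, as each step of the reduction at most doubles the height.
\<close>

definition independent_upto :: "nat \<Rightarrow> 'e set \<Rightarrow> ('e \<Rightarrow> rat) \<Rightarrow> bool" where
  "independent_upto H E \<sigma> \<longleftrightarrow>
     (\<forall>\<eta> :: 'e \<Rightarrow> int. (\<forall>e\<in>E. \<bar>\<eta> e\<bar> \<le> int H) \<longrightarrow> (\<Sum>e\<in>E. of_int (\<eta> e) * \<sigma> e) = 0 \<longrightarrow> (\<forall>e\<in>E. \<eta> e = 0))"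

lemma independent_uptoD:
  "independent_upto H E \<sigma> \<Longrightarrow> (\<And>e. e \<in> E \<Longrightarrow> \<bar>\<eta> e\<bar> \<le> int H) \<Longrightarrow>
    (\<Sum>e\<in>E. of_int (\<eta> e) * \<sigma> e) = 0 \<Longrightarrow> e \<in> E \<Longrightarrow> \<eta> e = 0"
  unfolding independent_upto_def by blast

lemma independent_upto_mono: "independent_upto H E \<sigma> \<Longrightarrow> H' \<le> H \<Longrightarrow> independent_upto H' E \<sigma>"
  unfolding independent_upto_def by (meson of_nat_mono order_trans)

lemma independent_upto_subset:
  assumes "independent_upto H E \<sigma>" "finite E" "E' \<subseteq> E"
  shows "independent_upto H E' \<sigma>"
  unfolding independent_upto_def
proof (intro allI impI ballI)
  fix \<eta> :: "'a \<Rightarrow> int" and e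
  assume \<eta>: "\<forall>e\<in>E'. \<bar>\<eta> e\<bar> \<le> int H" "(\<Sum>e\<in>E'. of_int (\<eta> e) * \<sigma> e) = 0" "e \<in> E'"
  define \<eta>' where "\<eta>' e = (if e \<in> E' then \<eta> e else 0)" for e
  have "(\<Sum>e\<in>E. of_int (\<eta>' e) * \<sigma> e) = (\<Sum>e\<in>E'. of_int (\<eta>' e) * \<sigma> e)"
    by (rule sum.mono_neutral_right) (use assms in \<open>auto simp: \<eta>'_def\<close>)
  also have "\<dots> = 0" using \<eta>(2) by (simp add: \<eta>'_def)
  finally have "\<eta>' e = 0"
    by (intro independent_uptoD[OF assms(1)]) (use \<eta> assms in \<open>auto simp: \<eta>'_def\<close>)
  then show "\<eta> e = 0" using \<eta>(3) by (simp add: \<eta>'_def)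
qed

lemma sum_weights_two:
  fixes \<sigma> :: "'e \<Rightarrow> rat"
  assumes "finite E" "e1 \<in> E" "e2 \<in> E" "e1 \<noteq> e2"
  shows "(\<Sum>e\<in>E. f e * \<sigma> e) = f e1 * \<sigma> e1 + f e2 * \<sigma> e2 + (\<Sum>e\<in>E - {e1, e2}. f e * \<sigma> e)"
proof -
  have "E = insert e1 (insert e2 (E - {e1, e2}))" using assms by auto
  then have "(\<Sum>e\<in>E. f e * \<sigma> e) = (\<Sum>e\<in>insert e1 (insert e2 (E - {e1, e2})). f e * \<sigma> e)" by simp
  also have "\<dots> = f e1 * \<sigma> e1 + f e2 * \<sigma> e2 + (\<Sum>e\<in>E - {e1, e2}. f e * \<sigma> e)"
    using assms by (subst sum.insert, simp, simp, subst sum.insert) simp_all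
  finally show ?thesis .
qed

text \<open>A relation \<eta> between the new values is a relation between the old ones with
  coefficient \<eta> e1 + c \<eta> e2 at e1, so its height at most doubles.\<close>

lemma independent_upto_shear:
  assumes "independent_upto (2 * H) E \<sigma>" "finite E" "e1 \<in> E" "e2 \<in> E" "e1 \<noteq> e2" "\<bar>c\<bar> \<le> (1 :: int)"
  shows "independent_upto H E (\<sigma>(e2 := \<sigma> e2 + of_int c * \<sigma> e1))"
  unfolding independent_upto_def
proof (intro allI impI)
  fix \<eta> :: "'a \<Rightarrow> int"
  let ?\<sigma> = "\<sigma>(e2 := \<sigma> e2 + of_int c * \<sigma> e1)"
  assume \<eta>: "\<forall>e\<in>E. \<bar>\<eta> e\<bar> \<le> int H" "(\<Sum>e\<in>E. of_int (\<eta> e) * ?\<sigma> e) = 0"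
  let ?\<eta> = "\<eta>(e1 := \<eta> e1 + c * \<eta> e2)"
  have "(\<Sum>e\<in>E - {e1, e2}. of_int (\<eta> e) * ?\<sigma> e) = (\<Sum>e\<in>E - {e1, e2}. of_int (?\<eta> e) * \<sigma> e)"
    by (rule sum.cong) auto
  then have "(\<Sum>e\<in>E. of_int (?\<eta> e) * \<sigma> e) = (\<Sum>e\<in>E. of_int (\<eta> e) * ?\<sigma> e)"
    unfolding sum_weights_two[OF assms(2-5)] using assms(5) by (simp add: algebra_simps)
  then have 0: "(\<Sum>e\<in>E. of_int (?\<eta> e) * \<sigma> e) = 0" using \<eta>(2) by simp
  have "\<bar>c * \<eta> e2\<bar> \<le> \<bar>\<eta> e2\<bar>" unfolding abs_mult using assms(6) by (simp add: mult_left_le_one_le)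
  moreover have "\<bar>\<eta> e1 + c * \<eta> e2\<bar> \<le> \<bar>\<eta> e1\<bar> + \<bar>c * \<eta> e2\<bar>" by (rule abs_triangle_ineq)
  moreover have "\<bar>\<eta> e1\<bar> \<le> int H" "\<bar>\<eta> e2\<bar> \<le> int H" using \<eta>(1) assms(3,4) by auto
  ultimately have "\<bar>\<eta> e1 + c * \<eta> e2\<bar> \<le> int (2 * H)" by linarith
  then have "\<bar>?\<eta> e\<bar> \<le> int (2 * H)" if "e \<in> E" for e using \<eta>(1) that by fastforce
  then have z: "?\<eta> e = 0" if "e \<in> E" for e using independent_uptoD[OF assms(1) _ 0 that] by blast
  then have "\<eta> e2 = 0" using assms(4,5) by (metis fun_upd_other)
  then show "\<forall>e\<in>E. \<eta> e = 0" using z by (metis add.right_neutral fun_upd_apply mult_zero_right)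
qed

lemma independent_upto_flip:
  assumes "independent_upto H E \<sigma>"
  shows "independent_upto H E (\<lambda>e. if e \<in> F then - \<sigma> e else \<sigma> e)"
  unfolding independent_upto_def
proof (intro allI impI ballI)
  fix \<eta> :: "'a \<Rightarrow> int" and e
  assume \<eta>: "\<forall>e\<in>E. \<bar>\<eta> e\<bar> \<le> int H" "(\<Sum>e\<in>E. of_int (\<eta> e) * (if e \<in> F then - \<sigma> e else \<sigma> e)) = 0" "e \<in> E"
  let ?\<eta> = "\<lambda>e. if e \<in> F then - \<eta> e else \<eta> e"
  have "(\<Sum>e\<in>E. of_int (?\<eta> e) * \<sigma> e) = 0"
    unfolding \<eta>(2)[symmetric] by (rule sum.cong) auto
  then have "?\<eta> e = 0" by (intro independent_uptoD[OF assms]) (use \<eta> in auto)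
  then show "\<eta> e = 0" by (simp split: if_splits)
qed

lemma independent_upto_nonzero:
  assumes "independent_upto H E \<sigma>" "H \<ge> 1" "finite E" "e \<in> E"
  shows "\<sigma> e \<noteq> 0"
proof
  assume "\<sigma> e = 0"
  then have "(\<Sum>x\<in>E. of_int (of_bool (x = e)) * \<sigma> x) = 0" by (intro sum.neutral) auto
  then have "of_bool (e = e) = (0 :: int)"
    by (rule independent_uptoD[OF assms(1), rotated]) (use assms in auto)
  then show False by simp
qed

lemma independent_upto_two:
  assumes "independent_upto H E \<sigma>" "H \<ge> 1" "finite E" "e1 \<in> E" "e2 \<in> E" "e1 \<noteq> e2"
  shows "\<sigma> e1 \<noteq> \<sigma> e2" "\<sigma> e1 + \<sigma> e2 \<noteq> 0"
proof -
  have *: "\<sigma> e1 + of_int c * \<sigma> e2 \<noteq> 0" if "\<bar>c\<bar> \<le> 1" for c :: int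
  proof
    assume 0: "\<sigma> e1 + of_int c * \<sigma> e2 = 0"
    let ?\<eta> = "\<lambda>x. if x = e1 then 1 else if x = e2 then c else 0 :: int"
    have "(\<Sum>x\<in>E. of_int (?\<eta> x) * \<sigma> x) = 0"
      unfolding sum_weights_two[OF assms(3-6)] using assms(6) 0 by (auto intro: sum.neutral)
    then have "?\<eta> e1 = 0"
      by (rule independent_uptoD[OF assms(1), rotated]) (use assms that in auto)
    then show False by simp
  qed
  show "\<sigma> e1 \<noteq> \<sigma> e2" "\<sigma> e1 + \<sigma> e2 \<noteq> 0" using *[of "- 1"] *[of 1] by auto
qed

lemma inj_on_list_pos_permutation: "xs \<in> permutations_of_set V \<Longrightarrow> inj_on (list_pos xs) V"
  using inj_on_list_pos[of xs] by (simp add: permutations_of_set_def)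

lemma fexp_fun_upd: "(\<lambda>e. fexp ((f(x := y)) e)) = (\<lambda>e. fexp (f e))(x := fexp y)"
  by auto

lemma ordered_sum_flip:
  assumes "finite E" "e \<in> E" "src e \<noteq> tgt e" "src e \<in> V" "tgt e \<in> V" "\<alpha> e \<noteq> 0"
  shows "ordered_sum V (src(e := tgt e)) (tgt(e := src e)) (\<sigma>(e := - \<sigma> e)) (\<alpha>(e := - \<alpha> e)) E
    = - ordered_sum V src tgt \<sigma> \<alpha> E"
proof -
  have of: "outflow E (src(e := tgt e)) (tgt(e := src e)) (\<alpha>(e := - \<alpha> e)) = outflow E src tgt \<alpha>"
    unfolding outflow_def by (intro ext sum.cong refl) auto
  have "flow_sum (list_pos xs) (src(e := tgt e)) (tgt(e := src e)) (\<lambda>x. fexp ((\<sigma>(e := - \<sigma> e)) x)) (\<lambda>x. fexp ((\<alpha>(e := - \<alpha> e)) x)) E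
      = - flow_sum (list_pos xs) src tgt (\<lambda>x. fexp (\<sigma> x)) (\<lambda>x. fexp (\<alpha> x)) E"
    if "xs \<in> permutations_of_set V" for xs
    unfolding fexp_fun_upd fexp_minus
    by (rule flow_sum_flip) (use assms inj_on_list_pos_permutation[OF that] in \<open>auto dest: inj_onD\<close>)
  then show ?thesis unfolding ordered_sum_def of by (simp add: sum_negf)
qed

lemma ordered_sum_flip_set:
  assumes fin: "finite E" and F: "finite F" "F \<subseteq> {e \<in> E. src e \<noteq> tgt e}"
    and V: "\<And>e. e \<in> E \<Longrightarrow> src e \<noteq> tgt e \<Longrightarrow> src e \<in> V \<and> tgt e \<in> V" and \<alpha>: "\<And>e. e \<in> E \<Longrightarrow> \<alpha> e \<noteq> 0"
  shows "ordered_sum V (\<lambda>e. if e \<in> F then tgt e else src e) (\<lambda>e. if e \<in> F then src e else tgt e)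
      (\<lambda>e. if e \<in> F then - \<sigma> e else \<sigma> e) (\<lambda>e. if e \<in> F then - \<alpha> e else \<alpha> e) E
    \<in> {ordered_sum V src tgt \<sigma> \<alpha> E, - ordered_sum V src tgt \<sigma> \<alpha> E}"
  using F
proof (induction F rule: finite_induct)
  case (insert f F)
  let ?src = "\<lambda>e. if e \<in> F then tgt e else src e" and ?tgt = "\<lambda>e. if e \<in> F then src e else tgt e"
  let ?\<sigma> = "\<lambda>e. if e \<in> F then - \<sigma> e else \<sigma> e" and ?\<alpha> = "\<lambda>e. if e \<in> F then - \<alpha> e else \<alpha> e"
  have f: "f \<in> E" "src f \<noteq> tgt f" using insert.prems by auto
  have "ordered_sum V (?src(f := ?tgt f)) (?tgt(f := ?src f)) (?\<sigma>(f := - ?\<sigma> f)) (?\<alpha>(f := - ?\<alpha> f)) E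
      = - ordered_sum V ?src ?tgt ?\<sigma> ?\<alpha> E"
    by (rule ordered_sum_flip) (use fin f insert.hyps V[OF f] \<alpha>[OF f(1)] in auto)
  moreover have "?src(f := ?tgt f) = (\<lambda>e. if e \<in> insert f F then tgt e else src e)"
    "?tgt(f := ?src f) = (\<lambda>e. if e \<in> insert f F then src e else tgt e)"
    "?\<sigma>(f := - ?\<sigma> f) = (\<lambda>e. if e \<in> insert f F then - \<sigma> e else \<sigma> e)"
    "?\<alpha>(f := - ?\<alpha> f) = (\<lambda>e. if e \<in> insert f F then - \<alpha> e else \<alpha> e)"
    using insert.hyps by auto
  ultimately show ?case using insert.IH insert.prems by auto
qed simp

lemma ordered_sum_fay:
  assumes fin: "finite E" and e: "e1 \<in> E" "e2 \<in> E" "e1 \<noteq> e2" and src: "src e1 = src e2"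
    and tgt: "tgt e1 \<noteq> src e1" "tgt e2 \<noteq> src e1"
    and V: "\<And>e. e \<in> E \<Longrightarrow> src e \<noteq> tgt e \<Longrightarrow> src e \<in> V \<and> tgt e \<in> V"
    and \<sigma>: "\<sigma> e1 \<noteq> \<sigma> e2" and \<alpha>: "\<alpha> e1 \<noteq> 0" "\<alpha> e2 \<noteq> 0" "\<alpha> e1 + \<alpha> e2 \<noteq> 0"
  shows "ordered_sum V src tgt \<sigma> \<alpha> E
    = ordered_sum V (src(e2 := tgt e1)) tgt (\<sigma>(e2 := \<sigma> e2 - \<sigma> e1)) (\<alpha>(e1 := \<alpha> e1 + \<alpha> e2)) E
      + ordered_sum V (src(e1 := tgt e2)) tgt (\<sigma>(e1 := \<sigma> e1 - \<sigma> e2)) (\<alpha>(e2 := \<alpha> e1 + \<alpha> e2)) E"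
proof -
  have of1: "outflow E (src(e2 := tgt e1)) tgt (\<alpha>(e1 := \<alpha> e1 + \<alpha> e2)) = outflow E src tgt \<alpha>"
    by (rule outflow_absorb) (use fin e src in auto)
  have of2: "outflow E (src(e1 := tgt e2)) tgt (\<alpha>(e2 := \<alpha> e1 + \<alpha> e2)) = outflow E src tgt \<alpha>"
    using outflow_absorb[of E e2 e1 src tgt \<alpha>] fin e src by (simp add: add.commute)
  have "flow_sum (list_pos xs) src tgt (\<lambda>x. fexp (\<sigma> x)) (\<lambda>x. fexp (\<alpha> x)) E
      = flow_sum (list_pos xs) (src(e2 := tgt e1)) tgt (\<lambda>x. fexp ((\<sigma>(e2 := \<sigma> e2 - \<sigma> e1)) x)) (\<lambda>x. fexp ((\<alpha>(e1 := \<alpha> e1 + \<alpha> e2)) x)) E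
      + flow_sum (list_pos xs) (src(e1 := tgt e2)) tgt (\<lambda>x. fexp ((\<sigma>(e1 := \<sigma> e1 - \<sigma> e2)) x)) (\<lambda>x. fexp ((\<alpha>(e2 := \<alpha> e1 + \<alpha> e2)) x)) E"
    if xs: "xs \<in> permutations_of_set V" for xs
    unfolding fexp_fun_upd fexp_diff fexp_add
    by (rule flow_sum_fay[OF fin e src tgt inj_on_list_pos_permutation[OF xs] V])
       (use \<sigma> \<alpha> in \<open>simp_all flip: fexp_add\<close>)
  then show ?thesis unfolding ordered_sum_def of1 of2 by (simp add: sum.distrib distrib_left)
qed

lemma flow_sum_order_cong:
  assumes "\<And>e. e \<in> E \<Longrightarrow> src e \<noteq> tgt e \<Longrightarrow> r (tgt e) < r (src e) \<longleftrightarrow> r' (tgt e) < r' (src e)"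
  shows "flow_sum r src tgt s w E = flow_sum r' src tgt s w E"
proof -
  have "flow_weight r src tgt s w E = flow_weight r' src tgt s w E"
    unfolding flow_weight_def using assms by (intro ext prod.cong) auto
  then show ?thesis by (simp add: flow_sum_def)
qed

lemma flow_sum_insert_at:
  assumes "v \<notin> set xs" "i \<le> length xs" "\<And>e. e \<in> E \<Longrightarrow> src e \<noteq> tgt e \<Longrightarrow> src e \<in> set xs \<and> tgt e \<in> set xs"
  shows "flow_sum (list_pos (insert_at i v xs)) src tgt s w E = flow_sum (list_pos xs) src tgt s w E"
  by (rule flow_sum_order_cong) (use assms(3) in \<open>auto simp: list_pos_insert_at[OF assms(1,2)]\<close>)

lemma sum_fps_const: "(\<Sum>x\<in>A. fps_const (f x)) = fps_const (\<Sum>x\<in>A. f x)"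
  by (rule fps_ext) (simp add: fps_sum_nth)

lemma fps_to_fls_sum: "fps_to_fls (\<Sum>x\<in>A. f x) = (\<Sum>x\<in>A. fps_to_fls (f x))"
  by (induction A rule: infinite_finite_induct) auto

text \<open>The outflow at v is 0, so \<open>t v\<close> is integrated with constant integrand over
  the whole interval, which gives the factor \<epsilon>.\<close>

lemma ordered_sum_isolated:
  assumes fin: "finite V" and v: "v \<notin> V"
    and V: "\<And>e. e \<in> E \<Longrightarrow> src e \<noteq> tgt e \<Longrightarrow> src e \<in> V \<and> tgt e \<in> V"
  shows "ordered_sum (insert v V) src tgt \<sigma> \<alpha> E = fps_const fls_X * ordered_sum V src tgt \<sigma> \<alpha> E"
proof -
  let ?u = "outflow E src tgt \<alpha>" and ?Z = "\<lambda>xs. flow_sum (list_pos xs) src tgt (\<lambda>x. fexp (\<sigma> x)) (\<lambda>x. fexp (\<alpha> x)) E"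
  have uv: "?u v = 0" unfolding outflow_def
  proof (rule sum.neutral, rule ballI)
    fix e assume "e \<in> E"
    then show "(of_bool (src e = v) - of_bool (tgt e = v)) * \<alpha> e = 0"
      using V[of e] v by (cases "src e = tgt e") auto
  qed
  have X: "simplex_exp ?u [v] = fps_X" by (simp add: uv fps_integral0_one)
  have "(\<Sum>i\<le>length xs. fps_const (fps_to_fls (simplex_exp ?u (insert_at i v xs))) * ?Z (insert_at i v xs))
      = fps_const fls_X * (fps_const (fps_to_fls (simplex_exp ?u xs)) * ?Z xs)"
    if "xs \<in> permutations_of_set V" for xs
  proof -
    have xs: "set xs = V" "v \<notin> set xs" using that v by (auto simp: permutations_of_set_def)
    have "(\<Sum>i\<le>length xs. fps_const (fps_to_fls (simplex_exp ?u (insert_at i v xs))) * ?Z (insert_at i v xs))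
        = (\<Sum>i\<le>length xs. fps_const (fps_to_fls (simplex_exp ?u (insert_at i v xs)))) * ?Z xs"
      unfolding sum_distrib_right
    proof (rule sum.cong[OF refl])
      fix i assume "i \<in> {..length xs}"
      then have "?Z (insert_at i v xs) = ?Z xs"
        by (intro flow_sum_insert_at[OF xs(2)]) (use V xs in auto)
      then show "fps_const (fps_to_fls (simplex_exp ?u (insert_at i v xs))) * ?Z (insert_at i v xs)
        = fps_const (fps_to_fls (simplex_exp ?u (insert_at i v xs))) * ?Z xs" by simp
    qed
    also have "(\<Sum>i\<le>length xs. fps_const (fps_to_fls (simplex_exp ?u (insert_at i v xs))))
        = fps_const (fps_to_fls (\<Sum>i\<le>length xs. simplex_exp ?u (insert_at i v xs)))"
      by (simp only: sum_fps_const fps_to_fls_sum)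
    also have "\<dots> = fps_const fls_X * fps_const (fps_to_fls (simplex_exp ?u xs))"
      unfolding simplex_exp_shuffle X by (simp add: fls_times_fps_to_fls)
    finally show ?thesis by (simp add: mult.assoc)
  qed
  then show ?thesis
    unfolding ordered_sum_def sum_permutations_of_set_insert[OF fin v] sum_distrib_left by (intro sum.cong) auto
qed

text \<open>The numerators 1 and w of the leaf factor, chosen by the position of v, are the weights
  in \<open>simplex_exp_insert\<close>; the resulting w - 1 cancels the denominator 1 - w. The
  exponent absorbed by the neighbour turns its outflow into that of the graph without e.\<close>

lemma ordered_sum_leaf:
  assumes fin: "finite V" "finite E" and v: "v \<notin> V"
    and e: "e \<in> E" "src e = v" "tgt e \<in> V" and \<alpha>: "\<alpha> e \<noteq> 0"
    and V: "\<And>x. x \<in> E - {e} \<Longrightarrow> src x \<noteq> tgt x \<Longrightarrow> src x \<in> V \<and> tgt x \<in> V"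
  shows "ordered_sum (insert v V) src tgt \<sigma> \<alpha> E
    = fps_const (fls_const (- 1 / \<alpha> e)) * ordered_sum V src tgt \<sigma> \<alpha> (E - {e})"
proof -
  let ?u = "outflow E src tgt \<alpha>" and ?u' = "outflow (E - {e}) src tgt \<alpha>" and ?j = "tgt e"
  let ?Z = "\<lambda>xs E. flow_sum (list_pos xs) src tgt (\<lambda>x. fexp (\<sigma> x)) (\<lambda>x. fexp (\<alpha> x)) E"
  have jv: "?j \<noteq> v" using e v by auto
  have u: "?u x = ?u' x + (of_bool (x = v) - of_bool (x = ?j)) * \<alpha> e" for x
    unfolding outflow_def using fin e by (subst sum.remove[of _ e]) auto
  have "?u' v = 0" unfolding outflow_def
  proof (rule sum.neutral, rule ballI)
    fix x assume "x \<in> E - {e}"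
    then show "(of_bool (src x = v) - of_bool (tgt x = v)) * \<alpha> x = 0"
      using V[of x] v by (cases "src x = tgt x") auto
  qed
  note u'v = this
  then have uv: "?u v = \<alpha> e" using jv by (simp add: u)
  have "(\<Sum>i\<le>length xs. fps_const (fps_to_fls (simplex_exp ?u (insert_at i v xs))) * ?Z (insert_at i v xs) E)
      = fps_const (fls_const (- 1 / \<alpha> e)) * (fps_const (fps_to_fls (simplex_exp ?u' xs)) * ?Z xs (E - {e}))"
    if xs: "xs \<in> permutations_of_set V" for xs
  proof -
    have s: "set xs = V" "v \<notin> set xs" "distinct xs" using xs v by (auto simp: permutations_of_set_def)
    obtain ys zs where yz: "xs = ys @ ?j # zs" using e(3) s(1) by (meson split_list)
    have posj: "list_pos xs ?j = length ys"
      using s(3) unfolding yz by (auto simp: list_pos_append list_pos_Cons)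
    let ?c = "\<lambda>i. if length ys < i then fps_exp (\<alpha> e) else 1"
    have Z: "?Z (insert_at i v xs) E = fps_const (fps_to_fls (?c i) / (1 - fexp (\<alpha> e))) * ?Z xs (E - {e})"
      if i: "i \<le> length xs" for i
    proof -
      let ?r = "list_pos (insert_at i v xs)"
      have inj: "inj_on ?r (insert v V)" using inj_on_list_pos[of "insert_at i v xs"] s(1) by simp
      have r: "?r (src x) \<noteq> ?r (tgt x)" if "x \<in> E" "src x \<noteq> tgt x" for x
        using that V[of x] e inj by (cases "x = e") (auto dest: inj_onD)
      have leaf: "src x \<noteq> src e \<and> tgt x \<noteq> src e" if "x \<in> E - {e}" "src x \<noteq> tgt x" for x
        using V[OF that] e(2) v by auto
      have ne: "src e \<noteq> tgt e" "fexp (\<alpha> e) \<noteq> 1" using e(2) jv \<alpha> by auto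
      have "?Z (insert_at i v xs) E = fps_const ((if ?r (tgt e) < ?r (src e) then fexp (\<alpha> e) else 1) / (1 - fexp (\<alpha> e)))
          * ?Z (insert_at i v xs) (E - {e})"
        by (rule flow_sum_leaf) (use fin(2) e(1) ne leaf r in auto)
      also have "?Z (insert_at i v xs) (E - {e}) = ?Z xs (E - {e})"
        by (rule flow_sum_insert_at[OF s(2) i]) (use V s in auto)
      also have "?r (tgt e) < ?r (src e) \<longleftrightarrow> length ys < i"
        using list_pos_insert_at[OF s(2) i, of ?j] list_pos_insert_at_self[OF s(2) i] e s(1) posj by auto
      finally show ?thesis by (simp add: fexp_def if_distrib cong: if_cong)
    qed
    have M: "simplex_exp (?u(?j := ?u ?j + ?u v)) xs = simplex_exp ?u' xs"
      by (rule simplex_exp_cong) (use s v jv in \<open>auto simp: u u'v\<close>)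
    have "fps_const (\<alpha> e) * (\<Sum>i\<le>length xs. ?c i * simplex_exp ?u (insert_at i v xs))
        = (fps_exp (\<alpha> e) - 1) * simplex_exp ?u' xs"
      using simplex_exp_insert[of ys ?j zs ?u v] s(3) M unfolding uv yz by simp
    then have "fps_to_fls (fps_const (\<alpha> e) * (\<Sum>i\<le>length xs. ?c i * simplex_exp ?u (insert_at i v xs)))
        = fps_to_fls ((fps_exp (\<alpha> e) - 1) * simplex_exp ?u' xs)" by simp
    then have M': "fls_const (\<alpha> e) * (\<Sum>i\<le>length xs. fps_to_fls (?c i) * fps_to_fls (simplex_exp ?u (insert_at i v xs)))
        = (fexp (\<alpha> e) - 1) * fps_to_fls (simplex_exp ?u' xs)"
      by (simp only: fls_times_fps_to_fls fps_to_fls_sum fps_const_to_fls fps_to_fls_minus fps_one_to_fls fexp_def)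
    have "(\<Sum>i\<le>length xs. fps_to_fls (?c i) * fps_to_fls (simplex_exp ?u (insert_at i v xs))) / (1 - fexp (\<alpha> e))
        = fls_const (- 1 / \<alpha> e) * fps_to_fls (simplex_exp ?u' xs)"
    proof -
      have "A / (1 - w) = (- 1 / a) * B" if "a * A = (w - 1) * B" "a \<noteq> 0" "w \<noteq> 1" for a A w B :: "rat fls"
      proof -
        have "a * A * 1 = - ((1 - w) * B)" using that(1) by (simp add: algebra_simps)
        then show ?thesis using that(2,3) by (simp add: field_simps)
      qed
      from this[OF M'] show ?thesis using \<alpha> by (simp add: fls_const_divide_const[symmetric])
    qed
    note A = this
    have "(\<Sum>i\<le>length xs. fps_const (fps_to_fls (simplex_exp ?u (insert_at i v xs))) * ?Z (insert_at i v xs) E)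
        = (\<Sum>i\<le>length xs. fps_const (fps_to_fls (?c i) * fps_to_fls (simplex_exp ?u (insert_at i v xs)) / (1 - fexp (\<alpha> e)))) * ?Z xs (E - {e})"
      unfolding sum_distrib_right
      by (intro sum.cong refl) (simp add: Z mult_ac flip: mult.assoc)
    also have "(\<Sum>i\<le>length xs. fps_const (fps_to_fls (?c i) * fps_to_fls (simplex_exp ?u (insert_at i v xs)) / (1 - fexp (\<alpha> e))))
        = fps_const (fls_const (- 1 / \<alpha> e) * fps_to_fls (simplex_exp ?u' xs))"
      unfolding sum_fps_const sum_divide_distrib[symmetric] A ..
    finally show ?thesis by (simp add: mult.assoc flip: fps_const_mult)
  qed
  then show ?thesis
    unfolding ordered_sum_def sum_permutations_of_set_insert[OF fin(1) v] sum_distrib_left by (intro sum.cong) auto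
qed

lemma ordered_sum_empty:
  assumes "\<And>e. e \<in> E \<Longrightarrow> src e = tgt e"
  shows "ordered_sum {} src tgt \<sigma> \<alpha> E = (\<Prod>e\<in>E. kron (fexp (\<sigma> e)) (fexp (\<alpha> e)))"
proof -
  have "flows E src tgt = {\<lambda>_. 0}"
    using assms by (auto simp: flows_def outflow_def fun_eq_iff)
  note flows = this
  have E: "{e \<in> E. src e = tgt e} = E" "{e \<in> E. src e \<noteq> tgt e} = {}" using assms by auto
  show ?thesis
    unfolding ordered_sum_def flow_sum_def flow_weight_def flows E by (simp add: q_sum_finite)
qed

text \<open>
  With all edges at \<open>v\<close> pointing away from it, Fay's identity removes them from \<open>v\<close> one at a time. The
  last one carries no flow; the sum over the positions of \<open>v\<close> in the order turns its inhomogeneous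
  factor \<open>1 / (1 - fexp \<alpha>)\<close> into \<open>- 1 / \<alpha>\<close>.
\<close>

lemma homogeneous_ordered_sum_oriented:
  fixes E :: "'e set"
  assumes IH: "\<And>(E :: 'e set) src tgt \<sigma> \<alpha>. finite E \<Longrightarrow>
      (\<And>e. e \<in> E \<Longrightarrow> src e \<noteq> tgt e \<Longrightarrow> src e \<in> V \<and> tgt e \<in> V) \<Longrightarrow>
      independent_upto (2 ^ (card V * card E)) E \<sigma> \<Longrightarrow> independent_upto (2 ^ (card V * card E)) E \<alpha> \<Longrightarrow>
      homogeneous (int (card V) - int (card E)) (ordered_sum V src tgt \<sigma> \<alpha> E)"
    and V: "finite V" "v \<notin> V" and fin: "finite E"
  shows "(\<And>e. e \<in> E \<Longrightarrow> src e \<noteq> tgt e \<Longrightarrow> src e \<in> insert v V \<and> tgt e \<in> V) \<Longrightarrow>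
    card {e \<in> E. src e = v \<and> tgt e \<noteq> v} = d \<Longrightarrow>
    independent_upto (2 ^ (card V * card E + d)) E \<sigma> \<Longrightarrow> independent_upto (2 ^ (card V * card E + d)) E \<alpha> \<Longrightarrow>
    homogeneous (int (card V) + 1 - int (card E)) (ordered_sum (insert v V) src tgt \<sigma> \<alpha> E)"
proof (induction d arbitrary: src \<sigma> \<alpha>)
  case 0
  then have none: "src e = v \<Longrightarrow> tgt e = v" if "e \<in> E" for e using fin that by auto
  have ends: "src e \<in> V \<and> tgt e \<in> V" if "e \<in> E" "src e \<noteq> tgt e" for e
    using 0(1)[OF that] none[OF that(1)] V(2) by auto
  have "homogeneous (int (card V) - int (card E)) (ordered_sum V src tgt \<sigma> \<alpha> E)"
    by (rule IH[where src = src and tgt = tgt]) (use 0 fin ends in auto)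
  then have "homogeneous (int (card V) - int (card E) + 1) (fps_const fls_X * ordered_sum V src tgt \<sigma> \<alpha> E)"
    by (rule homogeneous_X_mult)
  moreover have "ordered_sum (insert v V) src tgt \<sigma> \<alpha> E = fps_const fls_X * ordered_sum V src tgt \<sigma> \<alpha> E"
    by (rule ordered_sum_isolated) (use V ends in auto)
  moreover have "int (card V) - int (card E) + 1 = int (card V) + 1 - int (card E)" by simp
  ultimately show ?case by (simp only:)
next
  case (Suc d)
  let ?I = "{e \<in> E. src e = v \<and> tgt e \<noteq> v}"
  have H1: "(1 :: nat) \<le> 2 ^ (card V * card E + Suc d)" by simp
  have \<alpha>0: "\<alpha> e \<noteq> 0" if "e \<in> E" for e by (rule independent_upto_nonzero[OF Suc.prems(4) H1 fin that])
  show ?case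
  proof (cases d)
    case 0
    then obtain e where I: "?I = {e}" using Suc.prems(2) by (auto simp: card_1_singleton_iff)
    then have e: "e \<in> E" "src e = v" "tgt e \<noteq> v" by auto
    have eV: "tgt e \<in> V" using Suc.prems(1)[OF e(1)] e by auto
    have ends: "src x \<in> V \<and> tgt x \<in> V" if x: "x \<in> E - {e}" "src x \<noteq> tgt x" for x
    proof -
      have "x \<notin> ?I" using I x by auto
      then show ?thesis using Suc.prems(1)[of x] x V(2) by auto
    qed
    have le: "(2 :: nat) ^ (card V * card (E - {e})) \<le> 2 ^ (card V * card E + Suc d)"
    proof (rule power_increasing)
      have "card (E - {e}) \<le> card E" using fin by (intro card_mono) auto
      then have "card V * card (E - {e}) \<le> card V * card E" by (rule mult_le_mono2)
      then show "card V * card (E - {e}) \<le> card V * card E + Suc d" by linarith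
    qed simp
    have sub: "independent_upto (2 ^ (card V * card (E - {e}))) (E - {e}) f"
      if "independent_upto (2 ^ (card V * card E + Suc d)) E f" for f
      by (rule independent_upto_subset[OF independent_upto_mono[OF that le] fin]) auto
    have "homogeneous (int (card V) - int (card (E - {e}))) (ordered_sum V src tgt \<sigma> \<alpha> (E - {e}))"
      by (rule IH[where src = src and tgt = tgt]) (use fin sub Suc.prems ends in auto)
    moreover have "int (card (E - {e})) = int (card E) - 1"
    proof -
      have "card E > 0" using e(1) fin by (auto simp: card_gt_0_iff)
      then show ?thesis using e(1) fin by simp
    qed
    ultimately have "homogeneous (int (card V) + 1 - int (card E)) (ordered_sum V src tgt \<sigma> \<alpha> (E - {e}))"
      by (simp add: algebra_simps)
    moreover have "ordered_sum (insert v V) src tgt \<sigma> \<alpha> E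
        = fps_const (fls_const (- 1 / \<alpha> e)) * ordered_sum V src tgt \<sigma> \<alpha> (E - {e})"
      by (rule ordered_sum_leaf) (use V fin e eV \<alpha>0[OF e(1)] ends in auto)
    ultimately show ?thesis by (simp only: homogeneous_const_mult)
  next
    case (Suc d')
    then have "card ?I \<ge> 2" using Suc.prems(2) by simp
    then obtain e1 e2 where "e1 \<in> ?I" "e2 \<in> ?I" "e1 \<noteq> e2"
      by (metis (no_types, lifting) card_le_Suc0_iff_eq not_less_eq_eq numeral_2_eq_2 card.infinite zero_le)
    then have e: "e1 \<in> E" "e2 \<in> E" "e1 \<noteq> e2" "src e1 = v" "src e2 = v" "tgt e1 \<noteq> v" "tgt e2 \<noteq> v" by auto
    have step: "homogeneous (int (card V) + 1 - int (card E))
        (ordered_sum (insert v V) (src(f2 := tgt f1)) tgt (\<sigma>(f2 := \<sigma> f2 - \<sigma> f1)) (\<alpha>(f1 := \<alpha> f1 + \<alpha> f2)) E)"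
      if f: "f1 \<in> E" "f2 \<in> E" "f1 \<noteq> f2" "src f1 = v" "src f2 = v" "tgt f1 \<noteq> v" "tgt f2 \<noteq> v" for f1 f2
    proof (rule Suc.IH)
      have f1V: "tgt f1 \<in> V" "tgt f2 \<in> V" using Suc.prems(1)[of f1] Suc.prems(1)[of f2] f by auto
      show "(src(f2 := tgt f1)) e \<in> insert v V \<and> tgt e \<in> V" if "e \<in> E" "(src(f2 := tgt f1)) e \<noteq> tgt e" for e
        using that Suc.prems(1)[of e] f1V by (auto split: if_splits)
      have "{e \<in> E. (src(f2 := tgt f1)) e = v \<and> tgt e \<noteq> v} = ?I - {f2}" using f by auto
      moreover have "f2 \<in> ?I" using f by auto
      ultimately show "card {e \<in> E. (src(f2 := tgt f1)) e = v \<and> tgt e \<noteq> v} = d"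
        using Suc.prems(2) by simp
      have pow: "2 ^ (card V * card E + Suc d) = 2 * (2 :: nat) ^ (card V * card E + d)" by simp
      show "independent_upto (2 ^ (card V * card E + d)) E (\<sigma>(f2 := \<sigma> f2 - \<sigma> f1))"
        using independent_upto_shear[OF Suc.prems(3)[unfolded pow] fin f(1,2,3), of "- 1"] by simp
      show "independent_upto (2 ^ (card V * card E + d)) E (\<alpha>(f1 := \<alpha> f1 + \<alpha> f2))"
        using independent_upto_shear[OF Suc.prems(4)[unfolded pow] fin f(2,1) f(3)[symmetric], of 1] by simp
    qed
    have "homogeneous (int (card V) + 1 - int (card E))
        (ordered_sum (insert v V) (src(e2 := tgt e1)) tgt (\<sigma>(e2 := \<sigma> e2 - \<sigma> e1)) (\<alpha>(e1 := \<alpha> e1 + \<alpha> e2)) E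
        + ordered_sum (insert v V) (src(e1 := tgt e2)) tgt (\<sigma>(e1 := \<sigma> e1 - \<sigma> e2)) (\<alpha>(e2 := \<alpha> e1 + \<alpha> e2)) E)"
      by (rule homogeneous_add[OF step]) (use step[of e2 e1] e in \<open>auto simp: add.commute\<close>)
    moreover have "ordered_sum (insert v V) src tgt \<sigma> \<alpha> E
        = ordered_sum (insert v V) (src(e2 := tgt e1)) tgt (\<sigma>(e2 := \<sigma> e2 - \<sigma> e1)) (\<alpha>(e1 := \<alpha> e1 + \<alpha> e2)) E
        + ordered_sum (insert v V) (src(e1 := tgt e2)) tgt (\<sigma>(e1 := \<sigma> e1 - \<sigma> e2)) (\<alpha>(e2 := \<alpha> e1 + \<alpha> e2)) E"
    proof (rule ordered_sum_fay[OF fin e(1-3)])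
      show "src e \<in> insert v V \<and> tgt e \<in> insert v V" if "e \<in> E" "src e \<noteq> tgt e" for e
        using Suc.prems(1)[OF that] by auto
    qed (use e \<alpha>0 independent_upto_two[OF Suc.prems(3) H1 fin e(1-3)]
        independent_upto_two[OF Suc.prems(4) H1 fin e(1-3)] in auto)
    ultimately show ?thesis by simp
  qed
qed

text \<open>Without vertices every edge is a loop, which gives |E| simple poles. A vertex that ends
  up isolated adds 1 to the exponent; one that ends up as a leaf removes an edge instead, which has
  the same effect.\<close>

lemma homogeneous_ordered_sum:
  assumes "finite V" "finite E" "\<And>e. e \<in> E \<Longrightarrow> src e \<noteq> tgt e \<Longrightarrow> src e \<in> V \<and> tgt e \<in> V"
    "independent_upto (2 ^ (card V * card E)) E \<sigma>" "independent_upto (2 ^ (card V * card E)) E \<alpha>"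
  shows "homogeneous (int (card V) - int (card E)) (ordered_sum V src tgt \<sigma> \<alpha> E)"
  using assms
proof (induction V arbitrary: E src tgt \<sigma> \<alpha> rule: finite_induct)
  case empty
  have "homogeneous (int (card E) * - 1) (\<Prod>e\<in>E. kron (fexp (\<sigma> e)) (fexp (\<alpha> e)))"
    by (rule homogeneous_prod[OF empty.prems(1)], rule homogeneous_kron)
       (use empty.prems independent_upto_nonzero[of 1 E] in auto)
  moreover have "ordered_sum {} src tgt \<sigma> \<alpha> E = (\<Prod>e\<in>E. kron (fexp (\<sigma> e)) (fexp (\<alpha> e)))"
    by (rule ordered_sum_empty) (use empty.prems(2) in auto)
  ultimately show ?case by simp
next
  case (insert v V)
  note fin = insert.prems(1)
  \<comment> \<open>Reversing the edges that enter v makes v a source and changes the sum at most by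
    a sign.\<close>
  define F where "F = {e \<in> E. src e \<noteq> tgt e \<and> tgt e = v}"
  let ?src = "\<lambda>e. if e \<in> F then tgt e else src e" and ?tgt = "\<lambda>e. if e \<in> F then src e else tgt e"
  let ?\<sigma> = "\<lambda>e. if e \<in> F then - \<sigma> e else \<sigma> e" and ?\<alpha> = "\<lambda>e. if e \<in> F then - \<alpha> e else \<alpha> e"
  let ?d = "card {e \<in> E. ?src e = v \<and> ?tgt e \<noteq> v}"
  \<comment> \<open>Clearing one vertex takes at most \<open>card E\<close> moves, each halving the
    admissible height; this is the origin of the exponent \<open>card V * card E\<close>.\<close>
  have le: "(2 :: nat) ^ (card V * card E + ?d) \<le> 2 ^ (card (insert v V) * card E)"
  proof (rule power_increasing)
    have "?d \<le> card E" using fin by (intro card_mono) auto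
    then show "card V * card E + ?d \<le> card (insert v V) * card E" using insert.hyps by simp
  qed simp
  have ind: "independent_upto (2 ^ (card V * card E + ?d)) E (\<lambda>e. if e \<in> F then - f e else f e)"
    if "independent_upto (2 ^ (card (insert v V) * card E)) E f" for f
    by (rule independent_upto_flip[OF independent_upto_mono[OF that le]])
  have "homogeneous (int (card V) + 1 - int (card E)) (ordered_sum (insert v V) ?src ?tgt ?\<sigma> ?\<alpha> E)"
  proof (rule homogeneous_ordered_sum_oriented[OF insert.IH insert.hyps fin _ refl])
    fix e assume e: "e \<in> E" "?src e \<noteq> ?tgt e"
    have "src e \<noteq> tgt e" using e by (auto split: if_splits)
    then show "?src e \<in> insert v V \<and> ?tgt e \<in> V"
      using insert.prems(2)[OF e(1)] e(1) by (auto simp: F_def)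
  qed (use ind insert.prems in auto)
  moreover have "ordered_sum (insert v V) ?src ?tgt ?\<sigma> ?\<alpha> E
      \<in> {ordered_sum (insert v V) src tgt \<sigma> \<alpha> E, - ordered_sum (insert v V) src tgt \<sigma> \<alpha> E}"
  proof (rule ordered_sum_flip_set[OF fin])
    show "\<alpha> e \<noteq> 0" if "e \<in> E" for e
      by (rule independent_upto_nonzero[OF insert.prems(4) _ fin that]) simp
  qed (use fin insert.prems in \<open>auto simp: F_def\<close>)
  ultimately have "homogeneous (int (card V) + 1 - int (card E)) (ordered_sum (insert v V) src tgt \<sigma> \<alpha> E)"
    using homogeneous_uminus by fastforce
  then show ?case using insert.hyps by (simp add: algebra_simps)
qed

section \<open>Leading coefficients\<close>

text \<open>L may be 0: the condition is only that no power of \<epsilon> below k occurs.\<close>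

definition leading_coeff :: "int \<Rightarrow> 'k::comm_ring_1 fls fps \<Rightarrow> 'k fps \<Rightarrow> bool" where
  "leading_coeff k H L \<longleftrightarrow> (\<forall>j<k. eps_coeff j H = 0) \<and> eps_coeff k H = L"

lemma leading_coeff_mult:
  assumes "leading_coeff k H L" "leading_coeff l G M"
  shows "leading_coeff (k + l) (H * G) (L * M)"
proof -
  have "eps_coeff n (H * G) = (\<Sum>x\<in>{k..n - l}. eps_coeff x H * eps_coeff (n - x) G)" for n
    by (rule eps_coeff_mult) (use assms in \<open>auto simp: leading_coeff_def\<close>)
  then show ?thesis using assms by (auto simp: leading_coeff_def)
qed

lemma leading_coeff_1: "leading_coeff 0 1 1"
  by (auto simp: leading_coeff_def fps_eq_iff fps_one_nth)

lemma leading_coeff_prod: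
  "finite A \<Longrightarrow> (\<And>x. x \<in> A \<Longrightarrow> leading_coeff k (f x) (g x)) \<Longrightarrow>
    leading_coeff (int (card A) * k) (prod f A) (prod g A)"
proof (induction A rule: finite_induct)
  case (insert x A)
  have "leading_coeff (k + int (card A) * k) (f x * prod f A) (g x * prod g A)"
    by (intro leading_coeff_mult) (use insert in auto)
  then show ?case using insert.hyps by (simp add: algebra_simps)
qed (simp add: leading_coeff_1)

lemma leading_coeff_sum:
  "(\<And>x. x \<in> A \<Longrightarrow> leading_coeff k (f x) (g x)) \<Longrightarrow> leading_coeff k (sum f A) (sum g A)"
  by (auto simp: leading_coeff_def eps_coeff_sum intro!: sum.cong sum.neutral)

lemma leading_coeff_q_sum:
  assumes "\<And>i. i \<in> A \<Longrightarrow> leading_coeff k (f i) (g i)" "q_summable A f"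
  shows "leading_coeff k (q_sum A f) (q_sum A g)"
proof -
  have f: "q_sum A f $ m $$ j = (\<Sum>i | i \<in> A \<and> f i $ m \<noteq> 0. f i $ m $$ j)" for m j
    by (simp add: q_sum_nth fls_nth_sum)
  have low: "f i $ m $$ j = 0" if "i \<in> A" "j < k" for i m j
    using assms(1)[OF that(1)] that(2) by (metis eps_coeff_nth fps_zero_nth leading_coeff_def)
  have lead: "f i $ m $$ k = g i $ m" if "i \<in> A" for i m
    using assms(1)[OF that] by (metis eps_coeff_nth leading_coeff_def)
  have g: "q_sum A g $ m = (\<Sum>i | i \<in> A \<and> f i $ m \<noteq> 0. g i $ m)" for m
  proof (rule q_sum_nth_superset)
    show "finite {i \<in> A. f i $ m \<noteq> 0}" using assms(2) by (simp add: q_summable_def)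
    show "i \<in> {i \<in> A. f i $ m \<noteq> 0}" if "i \<in> A" "g i $ m \<noteq> 0" for i
      using that lead[OF that(1), of m] by auto
  qed auto
  show ?thesis unfolding leading_coeff_def
    by (auto simp: fps_eq_iff f g low lead intro!: sum.neutral sum.cong)
qed

text \<open>To leading order the exponentials are 1 and the integral is the volume of the
  simplex.\<close>

lemma simplex_exp_leading:
  "(\<forall>j<length xs. simplex_exp u xs $ j = 0) \<and> simplex_exp u xs $ length xs = 1 / fact (length xs)"
proof (induction xs)
  case (Cons x xs)
  have nth: "(fps_exp (u x) * simplex_exp u xs) $ k = simplex_exp u xs $ k" if "k \<le> length xs" for k
  proof -
    have "(fps_exp (u x) * simplex_exp u xs) $ k = (\<Sum>i\<in>{0}. fps_exp (u x) $ i * simplex_exp u xs $ (k - i))"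
      unfolding fps_mult_nth
    proof (rule sum.mono_neutral_right)
      show "\<forall>i\<in>{0..k} - {0}. fps_exp (u x) $ i * simplex_exp u xs $ (k - i) = 0"
      proof
        fix i assume "i \<in> {0..k} - {0}"
        then have "k - i < length xs" using that by auto
        then show "fps_exp (u x) $ i * simplex_exp u xs $ (k - i) = 0" using Cons by simp
      qed
    qed auto
    then show ?thesis by simp
  qed
  show ?case
  proof (intro conjI allI impI)
    fix j assume "j < length (x # xs)"
    then show "simplex_exp u (x # xs) $ j = 0" using Cons nth by (cases j) auto
  next
    have "(fps_exp (u x) * simplex_exp u xs) $ length xs = 1 / fact (length xs)" using Cons nth by simp
    then show "simplex_exp u (x # xs) $ length (x # xs) = 1 / fact (length (x # xs))"
      by (simp add: inverse_eq_divide)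
  qed
qed simp

lemma leading_coeff_simplex_exp:
  "leading_coeff (int (length xs)) (fps_const (fps_to_fls (simplex_exp u xs))) (fps_const (1 / fact (length xs)))"
  using simplex_exp_leading[of xs u] by (auto simp: leading_coeff_def fps_eq_iff)

text \<open>For nonzero a, \<open>kap\<close> is regular at w = 1 and can be replaced by its value
  there. For a = 0 the difference is identically 0, so the pole at w = 1 never enters.\<close>

lemma leading_coeff_phi_difference:
  assumes "\<alpha> \<noteq> 0"
  shows "leading_coeff 1 (phi (fexp c) (fexp \<alpha>) \<delta> a - phi (fexp (- c)) (fexp \<alpha>) \<delta> a)
    (fps_const (2 * c * of_int a) * (kap 1 a - of_bool \<delta>))"
proof -
  have eq: "phi (fexp c) (fexp \<alpha>) \<delta> a - phi (fexp (- c)) (fexp \<alpha>) \<delta> a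
      = fps_const (fexp (of_int a * c) - fexp (- (of_int a * c))) * (kap (fexp \<alpha>) a - of_bool \<delta>)"
    unfolding phi_def fexp_power_int by (simp add: left_diff_distrib flip: fps_const_sub)
  show ?thesis
  proof (cases "a = 0")
    case True
    then show ?thesis unfolding eq by (simp add: leading_coeff_def)
  next
    case False
    have 1: "leading_coeff 1 (fps_const (fexp (of_int a * c) - fexp (- (of_int a * c)))) (fps_const (2 * c * of_int a))"
      by (auto simp: leading_coeff_def fps_eq_iff fexp_nth)
    have 2: "leading_coeff 0 (kap (fexp \<alpha>) a) (kap 1 a)"
      using False by (cases a "0 :: int" rule: linorder_cases)
        (auto simp: leading_coeff_def fps_eq_iff kap_pos_nth kap_neg_nth fexp_power fexp_nth
          simp flip: fexp_minus power_inverse)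
    have 3: "leading_coeff 0 (of_bool \<delta>) (of_bool \<delta>)"
      using leading_coeff_1 by (cases \<delta>) (auto simp: leading_coeff_def)
    have "leading_coeff 0 (kap (fexp \<alpha>) a - of_bool \<delta>) (kap 1 a - of_bool \<delta>)"
      using 2 3 by (auto simp: leading_coeff_def eps_coeff_diff)
    from leading_coeff_mult[OF 1 this] show ?thesis unfolding eq by simp
  qed
qed

lemma q_summable_sum:
  "finite K \<Longrightarrow> (\<And>k. k \<in> K \<Longrightarrow> q_summable A (f k)) \<Longrightarrow> q_summable A (\<lambda>i. \<Sum>k\<in>K. f k i)"
proof (induction K rule: finite_induct)
  case (insert k K)
  then show ?case by (simp add: q_summable_add)
qed (simp add: q_summable_def)

lemma q_sum_sum:
  "finite K \<Longrightarrow> (\<And>k. k \<in> K \<Longrightarrow> q_summable A (f k)) \<Longrightarrow> q_sum A (\<lambda>i. \<Sum>k\<in>K. f k i) = (\<Sum>k\<in>K. q_sum A (f k))"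
proof (induction K rule: finite_induct)
  case empty
  show ?case by (rule fps_ext) (simp add: q_sum_nth)
next
  case (insert k K)
  then show ?case by (simp add: q_sum_add q_summable_sum)
qed

lemma prod_diff_expand:
  fixes p m :: "'e \<Rightarrow> 'k::comm_ring_1"
  assumes "finite E"
  shows "(\<Prod>e\<in>E. p e - m e) = (\<Sum>X\<in>Pow E. (- 1) ^ card X * (\<Prod>e\<in>E. if e \<in> X then m e else p e))"
proof -
  have "(\<Prod>e\<in>E. p e - m e) = (\<Prod>e\<in>E. - m e + p e)" by simp
  also have "\<dots> = (\<Sum>X\<in>Pow E. (\<Prod>e\<in>X. - m e) * (\<Prod>e\<in>E - X. p e))"
    by (rule prod_add[OF assms])
  also have "\<dots> = (\<Sum>X\<in>Pow E. (- 1) ^ card X * (\<Prod>e\<in>E. if e \<in> X then m e else p e))"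
  proof (rule sum.cong[OF refl])
    fix X assume X: "X \<in> Pow E"
    then have "(\<Prod>e\<in>E. if e \<in> X then m e else p e) = (\<Prod>e\<in>X. m e) * (\<Prod>e\<in>E - X. p e)"
      using assms by (subst prod.If_cases) (auto simp: Int_absorb1 Diff_eq)
    then show "(\<Prod>e\<in>X. - m e) * (\<Prod>e\<in>E - X. p e) = (- 1) ^ card X * (\<Prod>e\<in>E. if e \<in> X then m e else p e)"
      by (simp add: prod_uminus mult.assoc)
  qed
  finally show ?thesis .
qed

text \<open>The coefficient series of the Feynman integral, with the orientation of the graph as reference.\<close>

definition circulation_sum :: "'v list \<Rightarrow> ('e \<Rightarrow> 'v) \<Rightarrow> ('e \<Rightarrow> 'v) \<Rightarrow> 'e set \<Rightarrow> rat fps" where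
  "circulation_sum xs src tgt E = q_sum (flows E src tgt) (\<lambda>a. \<Prod>e\<in>E.
     fps_const (- of_int (a e)) * (kap 1 (a e) - of_bool (list_pos xs (tgt e) < list_pos xs (src e))))"

text \<open>Each new value exceeds H times the sum of the absolute values of the earlier ones, so in
  a relation of height H its coefficient has to be 0.\<close>

lemma exists_independent_upto:
  assumes "finite E"
  shows "\<exists>f. independent_upto H E f"
  using assms
proof (induction E rule: finite_induct)
  case empty
  show ?case by (simp add: independent_upto_def)
next
  case (insert e E)
  then obtain f where f: "independent_upto H E f" by blast
  define N where "N = 1 + of_nat H * (\<Sum>x\<in>E. \<bar>f x\<bar>)"
  have N: "N > 0" unfolding N_def by (intro add_pos_nonneg mult_nonneg_nonneg sum_nonneg) auto
  let ?f = "f(e := N)"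
  have "independent_upto H (insert e E) ?f"
    unfolding independent_upto_def
  proof (intro allI impI)
    fix \<eta> :: "'a \<Rightarrow> int"
    assume \<eta>: "\<forall>x\<in>insert e E. \<bar>\<eta> x\<bar> \<le> int H" "(\<Sum>x\<in>insert e E. of_int (\<eta> x) * ?f x) = 0"
    have "(\<Sum>x\<in>E. of_int (\<eta> x) * ?f x) = (\<Sum>x\<in>E. of_int (\<eta> x) * f x)"
      by (rule sum.cong) (use insert.hyps in auto)
    then have s: "of_int (\<eta> e) * N = - (\<Sum>x\<in>E. of_int (\<eta> x) * f x)" using \<eta>(2) insert.hyps by simp
    have "\<bar>of_int (\<eta> e) * N\<bar> \<le> (\<Sum>x\<in>E. \<bar>of_int (\<eta> x) * f x\<bar>)" unfolding s by simp
    also have "\<dots> \<le> (\<Sum>x\<in>E. of_nat H * \<bar>f x\<bar>)"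
    proof (rule sum_mono)
      fix x assume "x \<in> E"
      then have "\<bar>of_int (\<eta> x)\<bar> \<le> (of_nat H :: rat)" proof -
        have "of_int \<bar>\<eta> x\<bar> \<le> (of_int (int H) :: rat)" using \<eta>(1) \<open>x \<in> E\<close> by (simp only: of_int_le_iff) simp
        then show ?thesis by simp
      qed
      then show "\<bar>of_int (\<eta> x) * f x\<bar> \<le> of_nat H * \<bar>f x\<bar>" by (simp add: abs_mult mult_right_mono)
    qed
    also have "\<dots> < N" by (simp add: N_def sum_distrib_left)
    finally have "\<bar>of_int (\<eta> e)\<bar> * N < 1 * N" using N by (simp add: abs_mult)
    then have "\<bar>of_int (\<eta> e)\<bar> < (1 :: rat)" using N by (simp only: mult_less_cancel_right_pos)
    then have "\<eta> e = 0" by linarith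
    moreover have "\<eta> x = 0" if "x \<in> E" for x
      by (rule independent_uptoD[OF f _ _ that]) (use \<eta>(1) s \<open>\<eta> e = 0\<close> in auto)
    ultimately show "\<forall>x\<in>insert e E. \<eta> x = 0" by auto
  qed
  then show ?case by blast
qed

text \<open>
  Replacing each \<open>phi (fexp c)\<close> by the difference of its values at \<open>c\<close> and \<open>-c\<close> turns the
  generating series into the Feynman integral to leading order, and kills the poles at \<open>a = 0\<close>.
\<close>

lemma quasimodular_form_circulation_sum:
  assumes fin: "finite V" "finite E"
    and V: "\<And>e. e \<in> E \<Longrightarrow> src e \<in> V \<and> tgt e \<in> V \<and> src e \<noteq> tgt e"
  shows "quasimodular_form (2 * card E) (\<Sum>xs\<in>permutations_of_set V. circulation_sum xs src tgt E)"
proof -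
  obtain c where c: "independent_upto (2 ^ (card V * card E)) E c"
    using exists_independent_upto[OF fin(2)] by blast
  have c0: "c e \<noteq> 0" if "e \<in> E" for e
    by (rule independent_upto_nonzero[OF c _ fin(2) that]) simp
  let ?\<sigma> = "\<lambda>X e. if e \<in> X then - c e else c e"
  let ?u = "outflow E src tgt c"
  let ?F = "\<lambda>xs X. flow_sum (list_pos xs) src tgt (\<lambda>e. fexp (?\<sigma> X e)) (\<lambda>e. fexp (c e)) E"
  define D where "D = (\<Sum>X\<in>Pow E. (- 1) ^ card X * ordered_sum V src tgt (?\<sigma> X) c E)"
  have hom: "homogeneous (int (card V) - int (card E)) D"
    unfolding D_def
  proof (rule homogeneous_sum)
    fix X
    have "homogeneous (int (card V) - int (card E)) (ordered_sum V src tgt (?\<sigma> X) c E)"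
      by (rule homogeneous_ordered_sum[OF fin _ independent_upto_flip[OF c] c]) (use V in auto)
    then show "homogeneous (int (card V) - int (card E)) ((- 1) ^ card X * ordered_sum V src tgt (?\<sigma> X) c E)"
      by (cases "even (card X)") (auto simp: homogeneous_uminus)
  qed
  have nl: "{e \<in> E. src e = tgt e} = {}" "{e \<in> E. src e \<noteq> tgt e} = E" using V by auto
  let ?\<delta> = "\<lambda>xs e. list_pos xs (tgt e) < list_pos xs (src e)"
  \<comment> \<open>The first-order factor of an edge is 2 c a, while \<open>circulation_sum\<close>
    carries -a.\<close>
  let ?K = "\<Prod>e\<in>E. - 2 * c e"
  have lead: "leading_coeff (int (card E)) (\<Sum>X\<in>Pow E. (- 1) ^ card X * ?F xs X) (fps_const ?K * circulation_sum xs src tgt E)"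
    if xs: "xs \<in> permutations_of_set V" for xs
  proof -
    let ?w = "\<lambda>X. flow_weight (list_pos xs) src tgt (\<lambda>e. fexp (?\<sigma> X e)) (\<lambda>e. fexp (c e)) E"
    let ?p = "\<lambda>a e. phi (fexp (c e)) (fexp (c e)) (?\<delta> xs e) (a e) - phi (fexp (- c e)) (fexp (c e)) (?\<delta> xs e) (a e)"
    have r: "list_pos xs (src e) \<noteq> list_pos xs (tgt e)" if "e \<in> E" for e
      using V[OF that] inj_on_list_pos_permutation[OF xs] by (meson inj_onD)
    have sw: "q_summable (flows E src tgt) (?w X)" for X
      by (rule q_summable_flow_weight[OF fin(2)]) (use r in auto)
    have sw': "q_summable (flows E src tgt) (\<lambda>a. (- 1) ^ card X * ?w X a)" for X
      by (rule q_summable_mult_left[OF sw])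
    have expand: "(\<Prod>e\<in>E. ?p a e) = (\<Sum>X\<in>Pow E. (- 1) ^ card X * ?w X a)" for a
      unfolding prod_diff_expand[OF fin(2)] flow_weight_def nl
      by (intro sum.cong refl arg_cong2[where f = "(*)"] prod.cong) auto
    have "(\<Sum>X\<in>Pow E. (- 1) ^ card X * ?F xs X) = (\<Sum>X\<in>Pow E. q_sum (flows E src tgt) (\<lambda>a. (- 1) ^ card X * ?w X a))"
      unfolding flow_sum_def nl by (intro sum.cong refl) (simp add: q_sum_mult_left[OF sw])
    also have "\<dots> = q_sum (flows E src tgt) (\<lambda>a. \<Sum>X\<in>Pow E. (- 1) ^ card X * ?w X a)"
      by (rule q_sum_sum[symmetric]) (use fin sw' in auto)
    finally have F: "(\<Sum>X\<in>Pow E. (- 1) ^ card X * ?F xs X) = q_sum (flows E src tgt) (\<lambda>a. \<Prod>e\<in>E. ?p a e)"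
      unfolding expand .
    let ?g = "\<lambda>a e. fps_const (- of_int (a e)) * (kap 1 (a e) - of_bool (?\<delta> xs e)) :: rat fps"
    have sp: "q_summable (flows E src tgt) (\<lambda>a. \<Prod>e\<in>E. ?p a e)"
      unfolding expand by (rule q_summable_sum) (use fin sw' in auto)
    have L: "leading_coeff (int (card E) * 1) (\<Prod>e\<in>E. ?p a e) (fps_const ?K * (\<Prod>e\<in>E. ?g a e))" for a
    proof -
      have "leading_coeff (int (card E) * 1) (\<Prod>e\<in>E. ?p a e)
          (\<Prod>e\<in>E. fps_const (2 * c e * of_int (a e)) * (kap 1 (a e) - of_bool (?\<delta> xs e)))"
        by (rule leading_coeff_prod[OF fin(2)]) (rule leading_coeff_phi_difference[OF c0])
      also have "(\<Prod>e\<in>E. fps_const (2 * c e * of_int (a e)) * (kap 1 (a e) - of_bool (?\<delta> xs e)))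
          = (\<Prod>e\<in>E. fps_const (- 2 * c e) * ?g a e)"
        by (intro prod.cong refl) (simp flip: mult.assoc)
      also have "\<dots> = fps_const ?K * (\<Prod>e\<in>E. ?g a e)"
      proof -
        have "(\<Prod>e\<in>E. fps_const (- 2 * c e)) = fps_const ?K"
          using fin(2) by (induction E rule: finite_induct) auto
        then show ?thesis by (simp only: prod.distrib)
      qed
      finally show ?thesis .
    qed
    have "leading_coeff (int (card E) * 1) (q_sum (flows E src tgt) (\<lambda>a. \<Prod>e\<in>E. ?p a e))
        (q_sum (flows E src tgt) (\<lambda>a. fps_const ?K * (\<Prod>e\<in>E. ?g a e)))"
      by (rule leading_coeff_q_sum[OF L sp])
    moreover have "q_sum (flows E src tgt) (\<lambda>a. fps_const ?K * (\<Prod>e\<in>E. ?g a e)) = fps_const ?K * circulation_sum xs src tgt E"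
    proof -
      have K0: "?K \<noteq> 0" using c0 fin(2) by simp
      \<comment> \<open>Summability is inherited: up to the nonzero constant \<open>?K\<close> these
        products are coefficients in \<epsilon> of a summable family.\<close>
      have "q_summable (flows E src tgt) (\<lambda>a. \<Prod>e\<in>E. ?g a e)"
        unfolding q_summable_def
      proof
        fix m
        have ec: "eps_coeff (int (card E)) (\<Prod>e\<in>E. ?p a e) = fps_const ?K * (\<Prod>e\<in>E. ?g a e)" for a
          using L[of a] by (simp add: leading_coeff_def)
        have nz: "(\<Prod>e\<in>E. ?p a e) $ m \<noteq> 0" if "(\<Prod>e\<in>E. ?g a e) $ m \<noteq> 0" for a
        proof
          assume "(\<Prod>e\<in>E. ?p a e) $ m = 0"
          then have "eps_coeff (int (card E)) (\<Prod>e\<in>E. ?p a e) $ m = 0"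
            by (simp only: eps_coeff_nth fls_zero_nth)
          then have "?K * (\<Prod>e\<in>E. ?g a e) $ m = 0"
            unfolding ec fps_mult_left_const_nth .
          then show False using that K0 no_zero_divisors by blast
        qed
        show "finite {a \<in> flows E src tgt. (\<Prod>e\<in>E. ?g a e) $ m \<noteq> 0}"
          by (rule finite_subset[OF _ sp[unfolded q_summable_def, rule_format, of m]]) (use nz in blast)
      qed
      then show ?thesis unfolding circulation_sum_def by (rule q_sum_mult_left)
    qed
    ultimately show ?thesis unfolding F by simp
  qed
  have D: "D = (\<Sum>xs\<in>permutations_of_set V. fps_const (fps_to_fls (simplex_exp ?u xs)) * (\<Sum>X\<in>Pow E. (- 1) ^ card X * ?F xs X))"
    unfolding D_def ordered_sum_def sum_distrib_left by (subst sum.swap) (simp add: mult_ac)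
  have "leading_coeff (int (card V) + int (card E)) D
      (\<Sum>xs\<in>permutations_of_set V. fps_const (1 / fact (card V)) * (fps_const ?K * circulation_sum xs src tgt E))"
    unfolding D
  proof (rule leading_coeff_sum)
    fix xs assume xs: "xs \<in> permutations_of_set V"
    then have "length xs = card V" by (auto simp: permutations_of_set_def distinct_card)
    then show "leading_coeff (int (card V) + int (card E))
        (fps_const (fps_to_fls (simplex_exp ?u xs)) * (\<Sum>X\<in>Pow E. (- 1) ^ card X * ?F xs X))
        (fps_const (1 / fact (card V)) * (fps_const ?K * circulation_sum xs src tgt E))"
      using leading_coeff_mult[OF leading_coeff_simplex_exp[of xs ?u] lead[OF xs]] by simp
  qed
  moreover have "(\<Sum>xs\<in>permutations_of_set V. fps_const (1 / fact (card V)) * (fps_const ?K * circulation_sum xs src tgt E))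
      = fps_const (?K / fact (card V)) * (\<Sum>xs\<in>permutations_of_set V. circulation_sum xs src tgt E)"
    unfolding sum_distrib_left by (rule sum.cong) (simp_all flip: mult.assoc)
  ultimately have "eps_coeff (int (card V) + int (card E)) D
      = fps_const (?K / fact (card V)) * (\<Sum>xs\<in>permutations_of_set V. circulation_sum xs src tgt E)"
    unfolding leading_coeff_def by simp
  \<comment> \<open>The weight is the distance from the starting exponent |V| - |E| to |V| +
    |E|.\<close>
  moreover have "quasimodular_form (2 * card E) (eps_coeff (int (card V) - int (card E) + int (2 * card E)) D)"
    using hom unfolding homogeneous_def by blast
  moreover have "int (card V) - int (card E) + int (2 * card E) = int (card V) + int (card E)" by simp
  ultimately have *: "quasimodular_form (2 * card E)
      (fps_const (?K / fact (card V)) * (\<Sum>xs\<in>permutations_of_set V. circulation_sum xs src tgt E))"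
    by (simp only:)
  have "?K / fact (card V) \<noteq> 0" using c0 fin(2) by simp
  then have "inverse (?K / fact (card V)) * (?K / fact (card V)) = 1" by (rule left_inverse)
  then show ?thesis
    using quasimodular_form_const_mult[OF *, of "inverse (?K / fact (card V))"]
    by (simp only: mult.assoc[symmetric] fps_const_mult fps_const_1_eq_1 mult_1_left)
qed

section \<open>Feynman integrals\<close>

lemma fps_prod_nth_extensional:
  fixes f :: "'k \<Rightarrow> 'a::comm_ring_1 fps"
  assumes "finite K"
  shows "finite {\<mu> \<in> extensional K. (\<Sum>k\<in>K. \<mu> k) = (m :: nat)}"
    and "(\<Prod>k\<in>K. f k) $ m = (\<Sum>\<mu> | \<mu> \<in> extensional K \<and> (\<Sum>k\<in>K. \<mu> k) = m. \<Prod>k\<in>K. f k $ \<mu> k)"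
proof -
  show fin: "finite {\<mu> \<in> extensional K. (\<Sum>k\<in>K. \<mu> k) = (m :: nat)}"
  proof (rule finite_subset)
    show "{\<mu> \<in> extensional K. (\<Sum>k\<in>K. \<mu> k) = m} \<subseteq> PiE K (\<lambda>_. {..m})"
      using assms by (auto simp: PiE_def intro: member_le_sum)
    show "finite (PiE K (\<lambda>_. {..m}))" using assms by (intro finite_PiE) auto
  qed
  show "(\<Prod>k\<in>K. f k) $ m = (\<Sum>\<mu> | \<mu> \<in> extensional K \<and> (\<Sum>k\<in>K. \<mu> k) = m. \<Prod>k\<in>K. f k $ \<mu> k)"
    using assms
  proof (induction K arbitrary: m rule: finite_induct)
    case empty
    have "{\<mu> \<in> extensional {}. (\<Sum>k\<in>{}. \<mu> k) = m} = (if m = 0 then {\<lambda>_. undefined} else {})"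
      by (auto simp: extensional_def)
    then show ?case by (auto simp: fps_one_nth)
  next
    case (insert x K)
    let ?S = "\<lambda>K m. {\<mu> \<in> extensional K. (\<Sum>k\<in>K. \<mu> k) = (m :: nat)}"
    let ?P = "SIGMA i:{0..m}. ?S K (m - i)"
    have restr: "(\<Sum>k\<in>K. (\<nu>(x := y)) k) = (\<Sum>k\<in>K. \<nu> k)" for \<nu> :: "'k \<Rightarrow> nat" and y
      using insert.hyps by (intro sum.cong) auto
    have bij: "bij_betw (\<lambda>(i, \<mu>). \<mu>(x := i)) ?P (?S (insert x K) m)"
    proof (rule bij_betw_byWitness[of _ "\<lambda>\<nu>. (\<nu> x, \<nu>(x := undefined))"])
      show "\<forall>p\<in>?P. (((\<lambda>(i, \<mu>). \<mu>(x := i)) p) x, ((\<lambda>(i, \<mu>). \<mu>(x := i)) p)(x := undefined)) = p"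
        using insert.hyps by (auto simp: fun_eq_iff extensional_def)
      show "(\<lambda>(i, \<mu>). \<mu>(x := i)) ` ?P \<subseteq> ?S (insert x K) m"
        using insert.hyps restr by (auto simp: extensional_def)
      show "(\<lambda>\<nu>. (\<nu> x, \<nu>(x := undefined))) ` ?S (insert x K) m \<subseteq> ?P"
        using insert.hyps restr by (auto simp: extensional_def)
    qed auto
    have finS: "finite (?S K n)" for n
    proof (rule finite_subset)
      show "?S K n \<subseteq> PiE K (\<lambda>_. {..n})"
        using insert.hyps by (auto simp: PiE_def intro: member_le_sum)
      show "finite (PiE K (\<lambda>_. {..n}))" using insert.hyps by (intro finite_PiE) auto
    qed
    have "(\<Prod>k\<in>insert x K. f k) $ m = (\<Sum>i=0..m. f x $ i * (\<Prod>k\<in>K. f k) $ (m - i))"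
      using insert.hyps by (simp add: fps_mult_nth)
    also have "\<dots> = (\<Sum>i=0..m. \<Sum>\<mu>\<in>?S K (m - i). f x $ i * (\<Prod>k\<in>K. f k $ \<mu> k))"
      by (simp add: insert.IH sum_distrib_left)
    also have "\<dots> = (\<Sum>p\<in>?P. f x $ fst p * (\<Prod>k\<in>K. f k $ snd p k))"
      by (subst sum.Sigma) (use finS in \<open>auto simp: split_def\<close>)
    also have "\<dots> = (\<Sum>p\<in>?P. \<Prod>k\<in>insert x K. f k $ (\<lambda>(i, \<mu>). \<mu>(x := i)) p k)"
    proof (rule sum.cong[OF refl])
      fix p
      have "(\<Prod>k\<in>K. f k $ snd p k) = (\<Prod>k\<in>K. f k $ ((snd p)(x := fst p)) k)"
        using insert.hyps by (intro prod.cong) auto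
      then show "f x $ fst p * (\<Prod>k\<in>K. f k $ snd p k) = (\<Prod>k\<in>insert x K. f k $ (\<lambda>(i, \<mu>). \<mu>(x := i)) p k)"
        using insert.hyps by (simp add: split_def)
    qed
    also have "\<dots> = (\<Sum>\<mu>\<in>?S (insert x K) m. \<Prod>k\<in>insert x K. f k $ \<mu> k)"
      by (rule sum.reindex_bij_betw[OF bij])
    finally show ?case .
  qed
qed

text \<open>For either sign of b the coefficient of x^b in the propagator is -b / (1 - q^b),
  expanded as in \<open>kap\<close>. An edge running against the order has b = -a, and
  \<open>kap_flip\<close> then produces \<open>kap 1 a - 1\<close>.\<close>

lemma propagator_eq:
  "propagator (if \<delta> then - a else a) n = (fps_const (- of_int a) * (kap 1 a - of_bool \<delta>)) $ n"
proof -
  have p: "propagator b n = (fps_const (- of_int b) * kap 1 b) $ n" for b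
  proof (cases "n = 0")
    case True
    then show ?thesis
      by (cases b "0 :: int" rule: linorder_cases) (auto simp: propagator_def kap_pos_nth kap_neg_nth)
  next
    case False
    have D: "finite {d. d dvd n}" "\<And>d. d dvd n \<Longrightarrow> d > 0" using False by (auto intro: dvd_pos_nat)
    have "(\<Sum>d | d dvd n. of_nat d * (of_bool (b = int d) + of_bool (b = - int d)))
      = (\<Sum>d\<in>{nat \<bar>b\<bar>} \<inter> {d. d dvd n}. of_nat d * (of_bool (b = int d) + of_bool (b = - int d)) :: rat)"
    proof (rule sum.mono_neutral_right)
      show "\<forall>d\<in>{d. d dvd n} - {nat \<bar>b\<bar>} \<inter> {d. d dvd n}.
          of_nat d * (of_bool (b = int d) + of_bool (b = - int d)) = (0 :: rat)" by auto
    qed (use D(1) in auto)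
    also have "\<dots> = of_int b * kap 1 b $ n"
    proof (cases b "0 :: int" rule: linorder_cases)
      case equal
      then show ?thesis using False by simp
    next
      case less
      then have "{nat \<bar>b\<bar>} \<inter> {d. d dvd n} = (if nat (- b) dvd n then {nat (- b)} else {})" by auto
      then show ?thesis using less False by (simp add: kap_neg_nth)
    next
      case greater
      then have "{nat \<bar>b\<bar>} \<inter> {d. d dvd n} = (if nat b dvd n then {nat b} else {})" by auto
      then show ?thesis using greater False by (simp add: kap_pos_nth)
    qed
    finally show ?thesis using False by (simp add: propagator_def)
  qed
  show ?thesis
  proof (cases \<delta>)
    case True
    show ?thesis
    proof (cases "a = 0")
      case False
      then have k: "kap (1 :: rat) (- a) = 1 - kap 1 a" using kap_flip[of 1 "- a"] by simp
      have "propagator (- a) n = (fps_const (- of_int (- a)) * (1 - kap 1 a)) $ n"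
        using p[of "- a"] unfolding k .
      also have "\<dots> = (fps_const (- of_int a) * (kap 1 a - 1)) $ n" by (simp add: algebra_simps)
      finally show ?thesis using True by simp
    qed (use True p[of 0] in simp)
  qed (use p[of a] in simp)
qed

lemma propagator_quotient_eq:
  assumes "u \<noteq> v"
  shows "propagator_quotient u v (\<lambda>w. b * (of_bool (w = u) - of_bool (w = v))) m = propagator b m"
proof -
  have "{a. (\<lambda>w. b * (of_bool (w = u) - of_bool (w = v))) = (\<lambda>w. a * (of_bool (w = u) - of_bool (w = v)))} = {b}"
  proof (intro equalityI subsetI)
    fix a assume "a \<in> {a. (\<lambda>w. b * (of_bool (w = u) - of_bool (w = v))) = (\<lambda>w. a * (of_bool (w = u) - of_bool (w = v)))}"
    then have "b * (of_bool (u = u) - of_bool (u = v)) = a * (of_bool (u = u) - of_bool (u = v))"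
      unfolding mem_Collect_eq by (rule fun_cong)
    then show "a \<in> {b}" using assms by simp
  qed simp
  then show ?thesis by (simp add: propagator_quotient_def)
qed

lemma propagator_quotient_nonzero:
  assumes "propagator_quotient u v \<alpha> m \<noteq> 0"
  shows "\<exists>b. \<alpha> = (\<lambda>w. b * (of_bool (w = u) - of_bool (w = v)))"
  using assms unfolding propagator_quotient_def
  by (metis (mono_tags, lifting) mem_Collect_eq sum.neutral)

definition list_order :: "'v list \<Rightarrow> 'v rel" where
  "list_order xs = {(a, b). a \<in> set xs \<and> b \<in> set xs \<and> list_pos xs a \<le> list_pos xs b}"

text \<open>A choice of one monomial per edge is an integer exponent per edge, and the monomials
  multiply to 1 exactly when these exponents form a circulation: taking the constant coefficient is
  conservation at every vertex.\<close>

lemma feynman_integral_list_order: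
  assumes fin: "finite (arcs G)" and xs: "xs \<in> permutations_of_set (verts G)"
    and E: "\<And>e. e \<in> arcs G \<Longrightarrow> tail G e \<in> verts G \<and> head G e \<in> verts G \<and> tail G e \<noteq> head G e"
  shows "feynman_integral G (list_order xs) = circulation_sum xs (tail G) (head G) (arcs G)"
proof (rule fps_ext)
  fix m
  let ?E = "arcs G" and ?\<Omega> = "list_order xs"
  let ?\<delta> = "\<lambda>e. list_pos xs (head G e) < list_pos xs (tail G e)"
  let ?lo = "lower_end G ?\<Omega>" and ?up = "upper_end G ?\<Omega>"
  let ?Q = "\<lambda>e. propagator_quotient (?lo e) (?up e)"
  let ?b = "\<lambda>a e. if ?\<delta> e then - a e else a e :: int"
  let ?mono = "\<lambda>n e w. n * (of_bool (tail G e = w) - of_bool (head G e = w)) :: int"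
  let ?g = "\<lambda>a e. fps_const (- of_int (a e)) * (kap 1 (a e) - of_bool (?\<delta> e)) :: rat fps"
  have setxs: "set xs = verts G" using xs by (simp add: permutations_of_set_def)
  have r: "list_pos xs (tail G e) \<noteq> list_pos xs (head G e)" if "e \<in> ?E" for e
    using E[OF that] inj_on_list_pos_permutation[OF xs] by (meson inj_onD)
  have ends: "?lo e = (if ?\<delta> e then head G e else tail G e)" "?up e = (if ?\<delta> e then tail G e else head G e)"
    if "e \<in> ?E" for e
    using E[OF that] setxs by (auto simp: lower_end_def upper_end_def list_order_def)
  have lo_up: "?lo e \<noteq> ?up e" if "e \<in> ?E" for e using ends[OF that] E[OF that] by auto
  have mono: "?mono (n e) e = (\<lambda>w. ?b n e * (of_bool (w = ?lo e) - of_bool (w = ?up e)))" if "e \<in> ?E" for n e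
    unfolding ends[OF that] by (auto simp: fun_eq_iff)
  have Q: "?Q e (?mono (a e) e) n = ?g a e $ n" if "e \<in> ?E" for a e n
    unfolding mono[OF that, of a] propagator_quotient_eq[OF lo_up[OF that]] by (rule propagator_eq)
  define A where "A = {a \<in> flows ?E (tail G) (head G). \<forall>e\<in>?E. tail G e \<noteq> head G e \<longrightarrow> - int m \<le> ?b a e}"
  have finA: "finite A"
    unfolding A_def by (rule finite_bounded_flows[OF fin]) (rule r)
  let ?M = "{\<mu> \<in> extensional ?E. (\<Sum>e\<in>?E. \<mu> e) = m}"
  define U where "U = {(a, \<mu>). a \<in> flows ?E (tail G) (head G) \<and> \<mu> \<in> ?M \<and> (\<forall>e\<in>?E. ?g a e $ \<mu> e \<noteq> 0)}"
  have low: "- int n \<le> ?b a e" if "?g a e $ n \<noteq> 0" for a e n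
  proof -
    have "phi 1 (1 :: rat) (?\<delta> e) (a e) $ n \<noteq> 0" using that by (auto simp: phi_def)
    then show ?thesis by (rule phi_nth_nonzero)
  qed
  have UA: "U \<subseteq> A \<times> ?M"
  proof
    fix p assume "p \<in> U"
    then obtain a \<mu> where p: "p = (a, \<mu>)" "a \<in> flows ?E (tail G) (head G)" "\<mu> \<in> ?M" "\<And>e. e \<in> ?E \<Longrightarrow> ?g a e $ \<mu> e \<noteq> 0"
      by (auto simp: U_def)
    have "- int m \<le> ?b a e" if "e \<in> ?E" for e
    proof -
      have "\<mu> e \<le> m" using p(3) fin that by (auto intro: member_le_sum)
      then show ?thesis using low[of a e "\<mu> e"] p(4)[OF that] by linarith
    qed
    then show "p \<in> A \<times> ?M" using p by (auto simp: A_def)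
  qed
  have "circulation_sum xs (tail G) (head G) ?E $ m = (\<Sum>a\<in>A. (\<Prod>e\<in>?E. ?g a e) $ m)"
    unfolding circulation_sum_def
  proof (rule q_sum_nth_superset[OF finA])
    fix a assume a: "a \<in> flows ?E (tail G) (head G)" "(\<Prod>e\<in>?E. ?g a e) $ m \<noteq> 0"
    have "- int m \<le> ?b a e" if e: "e \<in> ?E" for e
    proof -
      obtain l where "l \<le> m" "?g a e $ l \<noteq> 0" using fps_prod_nth_nonzero[OF fin a(2) e] by blast
      then show ?thesis using low[of a e l] by linarith
    qed
    then show "a \<in> A" using a(1) by (auto simp: A_def)
  qed (auto simp: A_def)
  also have "\<dots> = (\<Sum>a\<in>A. \<Sum>\<mu>\<in>?M. \<Prod>e\<in>?E. ?g a e $ \<mu> e)"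
    by (simp only: fps_prod_nth_extensional(2)[OF fin])
  also have "\<dots> = (\<Sum>(a, \<mu>)\<in>A \<times> ?M. \<Prod>e\<in>?E. ?g a e $ \<mu> e)"
    by (rule sum.cartesian_product)
  also have "\<dots> = (\<Sum>(a, \<mu>)\<in>U. \<Prod>e\<in>?E. ?g a e $ \<mu> e)"
  proof (rule sum.mono_neutral_right)
    show "finite (A \<times> ?M)" using finA fps_prod_nth_extensional(1)[OF fin] by (rule finite_cartesian_product)
    show "U \<subseteq> A \<times> ?M" by (rule UA)
    show "\<forall>p\<in>A \<times> ?M - U. (case p of (a, \<mu>) \<Rightarrow> \<Prod>e\<in>?E. ?g a e $ \<mu> e) = 0"
      using fin by (fastforce simp: U_def A_def intro: prod_zero)
  qed
  finally have circ: "circulation_sum xs (tail G) (head G) ?E $ m = (\<Sum>(a, \<mu>)\<in>U. \<Prod>e\<in>?E. ?g a e $ \<mu> e)" .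
  define T where "T = {(\<beta>, \<mu>). \<beta> \<in> extensional ?E \<and> \<mu> \<in> extensional ?E \<and> (\<forall>v. (\<Sum>e\<in>?E. \<beta> e v) = 0) \<and>
      (\<Sum>e\<in>?E. \<mu> e) = m \<and> (\<forall>e\<in>?E. ?Q e (\<beta> e) (\<mu> e) \<noteq> 0)}"
  \<comment> \<open>The exponent of an edge is read off from its monomial at the tail.
    \<open>?h'\<close> extends it by 0 outside the graph, whereas the choices in
    \<open>laurent_prod\<close> are \<open>undefined\<close> there.\<close>
  let ?h = "\<lambda>(a, \<mu>). (restrict (\<lambda>e. ?mono (a e) e) ?E, \<mu>)"
  let ?h' = "\<lambda>(\<beta>, \<mu>). ((\<lambda>e. if e \<in> ?E then \<beta> e (tail G e) else 0), \<mu>)"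
  have flow: "a \<in> flows ?E (tail G) (head G) \<longleftrightarrow>
      (\<forall>e. e \<notin> ?E \<longrightarrow> a e = 0) \<and> (\<forall>v. (\<Sum>e\<in>?E. ?mono (a e) e v) = 0)" for a
    using E by (auto simp: flows_def outflow_def mult.commute)
  have bij: "bij_betw ?h U T"
  proof (rule bij_betw_byWitness[of _ ?h'])
    show "\<forall>p\<in>U. ?h' (?h p) = p"
    proof (rule ballI)
      fix p assume "p \<in> U"
      then obtain a \<mu> where p: "p = (a, \<mu>)" and a: "a \<in> flows ?E (tail G) (head G)" by (auto simp: U_def)
      have "(if e \<in> ?E then restrict (\<lambda>e. ?mono (a e) e) ?E e (tail G e) else 0) = a e" for e
        using E[of e] a unfolding flow by (cases "e \<in> ?E") auto
      then show "?h' (?h p) = p" by (simp add: p)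
    qed
    have T_mono: "\<beta> e = ?mono (\<beta> e (tail G e)) e" if "(\<beta>, \<mu>) \<in> T" "e \<in> ?E" for \<beta> \<mu> e
    proof -
      have "?Q e (\<beta> e) (\<mu> e) \<noteq> 0" using that by (auto simp: T_def)
      then obtain b where "\<beta> e = (\<lambda>w. b * (of_bool (w = ?lo e) - of_bool (w = ?up e)))"
        using propagator_quotient_nonzero[of "?lo e" "?up e"] by blast
      then show ?thesis unfolding ends[OF that(2)] using E[OF that(2)] by (auto simp: fun_eq_iff)
    qed
    show "\<forall>p\<in>T. ?h (?h' p) = p"
    proof (rule ballI)
      fix p assume "p \<in> T"
      then obtain \<beta> \<mu> where p: "p = (\<beta>, \<mu>)" and t: "(\<beta>, \<mu>) \<in> T" by (cases p) auto
      have \<beta>_ext: "\<beta> \<in> extensional ?E" using t by (auto simp: T_def)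
      have "restrict (\<lambda>e. ?mono (if e \<in> ?E then \<beta> e (tail G e) else 0) e) ?E e = \<beta> e" for e
      proof (cases "e \<in> ?E")
        case True
        show ?thesis using T_mono[OF t True, symmetric] True by simp
      qed (use \<beta>_ext in \<open>simp add: extensional_def\<close>)
      then have "restrict (\<lambda>e. ?mono (if e \<in> ?E then \<beta> e (tail G e) else 0) e) ?E = \<beta>" by (rule ext)
      then show "?h (?h' p) = p" by (simp only: p split_conv)
    qed
    show "?h ` U \<subseteq> T"
    proof (rule image_subsetI)
      fix p assume "p \<in> U"
      then obtain a \<mu> where p: "p = (a, \<mu>)" and a: "a \<in> flows ?E (tail G) (head G)"
        and \<mu>: "\<mu> \<in> ?M" "\<And>e. e \<in> ?E \<Longrightarrow> ?g a e $ \<mu> e \<noteq> 0"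
        by (auto simp: U_def)
      let ?\<beta> = "restrict (\<lambda>e. ?mono (a e) e) ?E"
      have Q': "?Q e (?\<beta> e) (\<mu> e) \<noteq> 0" if "e \<in> ?E" for e
        unfolding restrict_apply'[OF that] Q[OF that] by (rule \<mu>(2)[OF that])
      have "(\<Sum>e\<in>?E. ?\<beta> e v) = (\<Sum>e\<in>?E. ?mono (a e) e v)" for v by simp
      then have "(\<Sum>e\<in>?E. ?\<beta> e v) = 0" for v using a unfolding flow by simp
      then have "(?\<beta>, \<mu>) \<in> T" using Q' \<mu>(1) unfolding T_def by blast
      then show "?h p \<in> T" by (simp only: p split_conv)
    qed
    show "?h' ` T \<subseteq> U"
    proof (rule image_subsetI)
      fix p assume "p \<in> T"
      then obtain \<beta> \<mu> where p: "p = (\<beta>, \<mu>)" and t: "(\<beta>, \<mu>) \<in> T" by (cases p) auto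
      let ?a = "\<lambda>e. if e \<in> ?E then \<beta> e (tail G e) else 0"
      have \<beta>: "?mono (?a e) e = \<beta> e" if "e \<in> ?E" for e using T_mono[OF t that, symmetric] that by simp
      have sum_\<beta>: "(\<Sum>e\<in>?E. ?mono (?a e) e v) = (\<Sum>e\<in>?E. \<beta> e v)" for v
        using fun_cong[OF \<beta>] by (rule sum.cong[OF refl])
      have "(\<Sum>e\<in>?E. \<beta> e v) = 0" for v using t by (auto simp: T_def)
      then have "?a \<in> flows ?E (tail G) (head G)" unfolding flow sum_\<beta> by simp
      moreover have "\<mu> \<in> ?M" using t by (auto simp: T_def)
      moreover have "?g ?a e $ \<mu> e \<noteq> 0" if "e \<in> ?E" for e
      proof -
        have eq: "?g ?a e $ \<mu> e = ?Q e (\<beta> e) (\<mu> e)"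
          using Q[OF that, of ?a "\<mu> e"] unfolding \<beta>[OF that] by (rule sym)
        show ?thesis unfolding eq using t that unfolding T_def by blast
      qed
      ultimately have "(?a, \<mu>) \<in> U" unfolding U_def by blast
      then show "?h' p \<in> U" by (simp only: p split_conv)
    qed
  qed
  have "feynman_integral G ?\<Omega> $ m = (\<Sum>(\<beta>, \<mu>)\<in>T. \<Prod>e\<in>?E. ?Q e (\<beta> e) (\<mu> e))"
    by (simp add: feynman_integral_def laurent_prod_def T_def)
  also have "\<dots> = (\<Sum>p\<in>U. (\<lambda>(\<beta>, \<mu>). \<Prod>e\<in>?E. ?Q e (\<beta> e) (\<mu> e)) (?h p))"
    by (rule sum.reindex_bij_betw[OF bij, symmetric])
  also have "\<dots> = (\<Sum>(a, \<mu>)\<in>U. \<Prod>e\<in>?E. ?g a e $ \<mu> e)"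
    by (intro sum.cong refl) (auto simp: Q intro!: prod.cong)
  finally show "feynman_integral G ?\<Omega> $ m = circulation_sum xs (tail G) (head G) ?E $ m"
    unfolding circ .
qed

section \<open>Linear orders as lists\<close>

lemma list_pos_nth: "distinct xs \<Longrightarrow> i < length xs \<Longrightarrow> list_pos xs (xs ! i) = i"
  by (metis distinct_conv_nth list_pos_less nth_list_pos nth_mem)

text \<open>Recovers a position from comparisons alone, which is what makes
  \<open>list_order\<close> injective.\<close>

lemma list_pos_eq_card:
  assumes "distinct xs" "x \<in> set xs"
  shows "list_pos xs x = card {y \<in> set xs. list_pos xs y < list_pos xs x}"
proof -
  have "bij_betw (list_pos xs) {y \<in> set xs. list_pos xs y < list_pos xs x} {..<list_pos xs x}"
  proof (rule bij_betw_imageI)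
    show "inj_on (list_pos xs) {y \<in> set xs. list_pos xs y < list_pos xs x}"
      by (rule inj_on_subset[OF inj_on_list_pos]) auto
    show "list_pos xs ` {y \<in> set xs. list_pos xs y < list_pos xs x} = {..<list_pos xs x}"
    proof (intro equalityI subsetI)
      fix i assume i: "i \<in> {..<list_pos xs x}"
      then have "i < length xs" using list_pos_less[OF assms(2)] by simp
      then show "i \<in> list_pos xs ` {y \<in> set xs. list_pos xs y < list_pos xs x}"
        using i list_pos_nth[OF assms(1)] by (intro image_eqI[of _ _ "xs ! i"]) auto
    qed auto
  qed
  then show ?thesis using bij_betw_same_card by fastforce
qed

lemma bij_betw_list_order:
  assumes "finite V"
  shows "bij_betw list_order (permutations_of_set V) {\<Omega>. linear_order_on V \<Omega>}"
proof (rule bij_betw_imageI)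
  show "inj_on list_order (permutations_of_set V)"
  proof (rule inj_onI)
    fix xs ys assume xy: "xs \<in> permutations_of_set V" "ys \<in> permutations_of_set V" "list_order xs = list_order ys"
    then have x: "set xs = V" "distinct xs" and y: "set ys = V" "distinct ys" by (auto simp: permutations_of_set_def)
    have "list_pos xs a < list_pos xs b \<longleftrightarrow> list_pos ys a < list_pos ys b" if "a \<in> V" "b \<in> V" for a b
    proof -
      have "(b, a) \<in> list_order xs \<longleftrightarrow> (b, a) \<in> list_order ys" using xy(3) by simp
      then show ?thesis using that x(1) y(1) by (auto simp: list_order_def)
    qed
    then have pos: "list_pos xs a = list_pos ys a" if "a \<in> V" for a
      using list_pos_eq_card[of xs a] list_pos_eq_card[of ys a] x y that by (metis (no_types, lifting) Collect_cong)
    show "xs = ys"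
    proof (rule nth_equalityI)
      show len: "length xs = length ys" using x y by (metis distinct_card)
      fix i assume i: "i < length xs"
      then have "list_pos ys (xs ! i) = i" using pos[of "xs ! i"] x list_pos_nth[of xs i] nth_mem by metis
      moreover have "xs ! i \<in> set ys" using i x y by auto
      ultimately show "xs ! i = ys ! i" using nth_list_pos by metis
    qed
  qed
  show "list_order ` permutations_of_set V = {\<Omega>. linear_order_on V \<Omega>}"
  proof (intro equalityI subsetI)
    fix \<Omega> assume "\<Omega> \<in> list_order ` permutations_of_set V"
    then obtain xs where xs: "\<Omega> = list_order xs" "set xs = V" "distinct xs" by (auto simp: permutations_of_set_def)
    have "linear_order_on V (list_order xs)"
      unfolding order_on_defs refl_on_def total_on_def
      using inj_on_list_pos[of xs] xs(2)
      by (auto simp: list_order_def trans_def antisym_def dest: inj_onD)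
    then show "\<Omega> \<in> {\<Omega>. linear_order_on V \<Omega>}" using xs(1) by simp
  next
    fix \<Omega> assume "\<Omega> \<in> {\<Omega>. linear_order_on V \<Omega>}"
    then have lin: "\<Omega> \<subseteq> V \<times> V" "\<And>x. x \<in> V \<Longrightarrow> (x, x) \<in> \<Omega>" "trans \<Omega>" "antisym \<Omega>" "total_on V \<Omega>"
      by (auto simp: order_on_defs refl_on_def)
    \<comment> \<open>The number of strict predecessors is strictly monotone, hence a bijection onto
      an initial segment of the naturals; its inverse lists the elements in order.\<close>
    define \<rho> where "\<rho> x = card {y \<in> V. (y, x) \<in> \<Omega> \<and> y \<noteq> x}" for x
    have mono: "\<rho> x < \<rho> y" if "(x, y) \<in> \<Omega>" "x \<noteq> y" for x y
      unfolding \<rho>_def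
    proof (rule psubset_card_mono)
      have "x \<in> {z \<in> V. (z, y) \<in> \<Omega> \<and> z \<noteq> y}" using that lin(1) by auto
      moreover have "x \<notin> {z \<in> V. (z, x) \<in> \<Omega> \<and> z \<noteq> x}" by simp
      moreover have "{z \<in> V. (z, x) \<in> \<Omega> \<and> z \<noteq> x} \<subseteq> {z \<in> V. (z, y) \<in> \<Omega> \<and> z \<noteq> y}"
        using that lin(3,4) by (auto dest: transD antisymD)
      ultimately show "{z \<in> V. (z, x) \<in> \<Omega> \<and> z \<noteq> x} \<subset> {z \<in> V. (z, y) \<in> \<Omega> \<and> z \<noteq> y}" by blast
    qed (use assms in simp)
    have inj: "inj_on \<rho> V"
      using mono lin(5) unfolding total_on_def by (metis inj_onI less_irrefl)
    have "\<rho> x < card V" if "x \<in> V" for x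
      unfolding \<rho>_def by (rule psubset_card_mono[OF assms]) (use that in auto)
    then have "\<rho> ` V \<subseteq> {..<card V}" by auto
    then have img: "\<rho> ` V = {..<card V}"
      by (intro card_subset_eq) (simp_all add: card_image[OF inj])
    define xs where "xs = map (the_inv_into V \<rho>) [0..<card V]"
    have nth: "i < card V \<Longrightarrow> xs ! i = the_inv_into V \<rho> i" for i by (simp add: xs_def)
    have bij: "bij_betw (the_inv_into V \<rho>) {..<card V} V"
      using bij_betw_the_inv_into[of \<rho> V "{..<card V}"] inj img by (simp add: bij_betw_def)
    have setxs: "set xs = V" using bij by (auto simp: xs_def bij_betw_def atLeast0LessThan[symmetric])
    have dist: "distinct xs" using bij by (simp add: xs_def distinct_map bij_betw_def atLeast0LessThan)
    have pos: "list_pos xs x = \<rho> x" if "x \<in> V" for x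
    proof -
      have lt: "\<rho> x < card V" using img that by blast
      then have "xs ! \<rho> x = x" using nth the_inv_into_f_f[OF inj that] by simp
      moreover have "\<rho> x < length xs" using lt by (simp add: xs_def)
      ultimately show ?thesis using list_pos_nth[OF dist] by metis
    qed
    have "list_order xs = \<Omega>"
    proof (intro equalityI subsetI)
      fix p assume "p \<in> list_order xs"
      then obtain a b where p: "p = (a, b)" "a \<in> V" "b \<in> V" "\<rho> a \<le> \<rho> b"
        using pos setxs by (auto simp: list_order_def)
      then show "p \<in> \<Omega>" using mono[of b a] lin(2,5) unfolding total_on_def by (metis not_le)
    next
      fix p assume "p \<in> \<Omega>"
      then obtain a b where p: "p = (a, b)" "a \<in> V" "b \<in> V" "(a, b) \<in> \<Omega>" using lin(1) by auto
      then have "\<rho> a \<le> \<rho> b" using mono[of a b] by (cases "a = b") auto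
      then show "p \<in> list_order xs" using p pos setxs by (auto simp: list_order_def)
    qed
    then show "\<Omega> \<in> list_order ` permutations_of_set V"
      using setxs dist by (intro image_eqI[of _ _ xs]) (auto simp: permutations_of_set_def)
  qed
qed

theorem theorem5p5:
  fixes d2 g :: nat and W :: "'v set" and G :: "('v, 'e) pre_digraph"
  assumes "d2 > 0" and "g > 0"
    and "pearl_chain d2 g W G"
  shows "quasimodular_form (4 * (d2 + g - 1)) (pearl_chain_series W G)"
proof -
  have G: "digraph G" "W \<subseteq> verts G" "int (card (verts G - W)) = int d2 + int g - 1"
    "\<And>e. e \<in> arcs G \<Longrightarrow> tail G e \<in> W \<and> head G e \<in> verts G - W"
    "\<And>b. b \<in> verts G - W \<Longrightarrow> in_degree G b = 2"
    using assms(3) by (auto simp: pearl_chain_def)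
  interpret digraph G by (rule G(1))
  have E: "tail G e \<in> verts G \<and> head G e \<in> verts G \<and> tail G e \<noteq> head G e" if "e \<in> arcs G" for e
    using G(2) G(4)[OF that] by auto
  \<comment> \<open>Every edge is counted at its black end, where exactly two edges meet; this turns
    2|E| into the stated weight.\<close>
  have "arcs G = (\<Union>b\<in>verts G - W. in_arcs G b)" using G(4) by (auto simp: in_arcs_def)
  then have "card (arcs G) = (\<Sum>b\<in>verts G - W. card (in_arcs G b))"
    by (simp only:) (rule card_UN_disjoint, auto simp: in_arcs_def)
  also have "\<dots> = 2 * card (verts G - W)"
    using G(5) by (simp add: in_degree_def)
  finally have weight: "2 * card (arcs G) = 4 * (d2 + g - 1)" using G(3) assms(1) by linarith
  have "(\<Sum>\<Omega> | linear_order_on (verts G) \<Omega>. feynman_integral G \<Omega>)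
      = (\<Sum>xs\<in>permutations_of_set (verts G). feynman_integral G (list_order xs))"
    by (rule sum.reindex_bij_betw[OF bij_betw_list_order[OF finite_verts], symmetric])
  also have "\<dots> = (\<Sum>xs\<in>permutations_of_set (verts G). circulation_sum xs (tail G) (head G) (arcs G))"
    by (intro sum.cong refl feynman_integral_list_order) (use E in auto)
  finally have "quasimodular_form (4 * (d2 + g - 1)) (\<Sum>\<Omega> | linear_order_on (verts G) \<Omega>. feynman_integral G \<Omega>)"
    using quasimodular_form_circulation_sum[OF finite_verts finite_arcs E] weight by (simp only:)
  then show ?thesis
    unfolding pearl_chain_series_def by (rule quasimodular_form_const_mult)
qed

end
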